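(* Let $m\ge1$ and let $Q=(q_{i,j})$ be an $m\times m$ matrix of functions satisfying $\overline{q_{i,j}(-x)}=q_{i,j}(x)$, $q_{i,j}(x+\pi)=q_{i,j}(x)$, $q_{i,j}\in L_2[0,\pi]$. Let $A=\int_0^\pi Q(x)\,dx$ (a real matrix) and let $\mu_1<\mu_2<\dots<\mu_s$ be the distinct real eigenvalues of $A$. If $A$ has at least three real eigenvalues $\mu_{j_1},\mu_{j_2},\mu_{j_3}$ of odd multiplicities such that $$\min_{i_1,i_2,i_3\in\{1,\dots,s\}}\operatorname{diam}\left(\{\mu_{j_1}+\mu_{i_1},\ \mu_{j_2}+\mu_{i_2},\ \mu_{j_3}+\mu_{i_3}\}\right)=d\ne0,$$ then there exists a number $H$ such that $[H,\infty)\subset\sigma(L(Q))$.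
   Context: $L(Q)$ is the operator generated in $L_2(\mathbb R;\mathbb C^m)$ by $-y''+Qy$; its spectrum is $\sigma(L(Q))=\bigcup_{t\in(-1,1]}\sigma(L_t(Q))$, where $L_t(Q)$ is the operator in $L_2([0,\pi];\mathbb C^m)$ generated by $-y''+Qy$ and $y(\pi)=e^{i\pi t}y(0)$, $y'(\pi)=e^{i\pi t}y'(0)$. The multiplicity of an eigenvalue of $A$ is its algebraic multiplicity. $\operatorname{diam}(E)=\sup_{x,y\in E}|x-y|$. *)

theory Defs
  imports "HOL-Analysis.Analysis" "HOL-Computational_Algebra.Polynomial"
begin

section \<open>Square-integrable functions\<close>

text \<open>Elements of \<open>L\<^sub>2\<close> are represented by functions; equality in \<open>L\<^sub>2\<close> is equality
  almost everywhere.\<close>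

definition L2_space :: "'a measure \<Rightarrow> ('a \<Rightarrow> 'b::euclidean_space) set" where
  "L2_space M = {f \<in> borel_measurable M. integrable M (\<lambda>x. (norm (f x))\<^sup>2)}"

definition L2_norm :: "'a measure \<Rightarrow> ('a \<Rightarrow> 'b::euclidean_space) \<Rightarrow> real" where
  "L2_norm M f = sqrt (\<integral>x. (norm (f x))\<^sup>2 \<partial>M)"


section \<open>Spectrum of an unbounded operator\<close>

text \<open>An operator in \<open>L\<^sub>2(M; \<complex>\<^sup>m)\<close> is given by its graph \<open>T\<close>, a set of pairs of representatives.
  A number \<open>z\<close> is in the resolvent set iff the operator minus \<open>z\<close> maps its domain bijectively onto
  \<open>L\<^sub>2\<close> and has a bounded inverse. The norm estimate expresses boundedness of the inverse and, by
  linearity, also injectivity (up to null sets).\<close>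

definition L2_resolvent_set ::
    "'a measure \<Rightarrow> (('a \<Rightarrow> complex^'m) \<times> ('a \<Rightarrow> complex^'m)) set \<Rightarrow> complex set" where
  "L2_resolvent_set M T = {z.
     (\<forall>g \<in> L2_space M. \<exists>(y, f) \<in> T. AE x in M. f x - z *s y x = g x) \<and>
     (\<exists>C. \<forall>(y, f) \<in> T. L2_norm M y \<le> C * L2_norm M (\<lambda>x. f x - z *s y x))}"

definition L2_spectrum ::
    "'a measure \<Rightarrow> (('a \<Rightarrow> complex^'m) \<times> ('a \<Rightarrow> complex^'m)) set \<Rightarrow> complex set" where
  "L2_spectrum M T = - L2_resolvent_set M T"


section \<open>The Schroedinger operator with a matrix potential\<close>

text \<open>\<open>f\<close> is absolutely continuous on every bounded interval, with almost everywhere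
  derivative \<open>g\<close>, i.e. \<open>f\<close> is an indefinite integral of the locally Lebesgue integrable
  function \<open>g\<close>.\<close>

definition loc_abs_cont_deriv ::
    "(real \<Rightarrow> 'b::euclidean_space) \<Rightarrow> (real \<Rightarrow> 'b) \<Rightarrow> bool" where
  "loc_abs_cont_deriv f g \<longleftrightarrow>
     (\<forall>a b. a \<le> b \<longrightarrow> g absolutely_integrable_on {a..b} \<and> f b - f a = integral {a..b} g)"

text \<open>The operator \<open>L(Q)\<close> in \<open>L\<^sub>2(\<real>; \<complex>\<^sup>m)\<close> generated by \<open>-y'' + Q y\<close>: its domain consists of the
  \<open>y \<in> L\<^sub>2\<close> such that \<open>y\<close> and \<open>y'\<close> are locally absolutely continuous and \<open>-y'' + Q y \<in> L\<^sub>2\<close>. In the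
  definition, \<open>y1\<close> and \<open>y2\<close> stand for \<open>y'\<close> and \<open>y''\<close>.\<close>

definition schroedinger_graph ::
    "(real \<Rightarrow> complex^'m^'m) \<Rightarrow> ((real \<Rightarrow> complex^'m) \<times> (real \<Rightarrow> complex^'m)) set" where
  "schroedinger_graph Q = {(y, f).
     y \<in> L2_space lebesgue \<and> f \<in> L2_space lebesgue \<and>
     (\<exists>y1 y2. loc_abs_cont_deriv y y1 \<and> loc_abs_cont_deriv y1 y2 \<and>
        (AE x in lebesgue. f x = - y2 x + Q x *v y x))}"

definition schroedinger_spectrum :: "(real \<Rightarrow> complex^'m^'m) \<Rightarrow> complex set" where
  "schroedinger_spectrum Q = L2_spectrum lebesgue (schroedinger_graph Q)"


section \<open>Eigenvalues of matrices\<close>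

definition is_eigenvalue :: "'a::field^'n^'n \<Rightarrow> 'a \<Rightarrow> bool" where
  "is_eigenvalue A \<mu> \<longleftrightarrow> (\<exists>v. v \<noteq> 0 \<and> A *v v = \<mu> *s v)"

definition charpoly :: "'a::field^'n^'n \<Rightarrow> 'a poly" where
  "charpoly A = det (mat [:0, 1:] - map_matrix (\<lambda>a. [:a:]) A)"

definition alg_multiplicity :: "'a::field^'n^'n \<Rightarrow> 'a \<Rightarrow> nat" where
  "alg_multiplicity A \<mu> = order \<mu> (charpoly A)"

end

theory Submission
  imports Defs "HOL-Probability.Sinc_Integral"
begin

text \<open>Write the energy as \<open>\<rho>\<^sup>2\<close>. If the equation \<open>-y'' + Q y = \<rho>\<^sup>2 y\<close> has a nonzero solution with
\<open>y(x + \<pi>) = z y(x)\<close> and \<open>\<bar>z\<bar> = 1\<close>, then this solution is bounded, and cutting it off slowly shows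
that \<open>\<rho>\<^sup>2\<close> has no bounded resolvent (\<open>bounded_solution_in_spectrum\<close>). So it suffices to find, for
every large \<open>\<rho>\<close>, a Floquet multiplier \<open>z\<close> on the unit circle.

The symmetry of \<open>Q\<close> turns a solution \<open>y(x)\<close> into the solution \<open>cnj (y(-x))\<close> and hence a multiplier
\<open>z\<close> into \<open>1 / cnj z\<close>: the multipliers are symmetric in the unit circle. Counted with multiplicity, those off
the circle come in pairs, so a small symmetric region that contains an odd number of them contains one
on the circle. Instead of counting roots, the proof uses that such a symmetric characteristic
polynomial, multiplied by a power of \<open>z\<close> and a constant, is real on the circle; an odd number of roots
shows up as a change of sign, and the intermediate value theorem yields a root
(\<open>unimodular_root_if_sign_change\<close>).

For large \<open>\<rho>\<close> the multipliers are explicit up to \<open>o(1/\<rho>)\<close>. In the coordinates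
\<open>y = exp(i\<rho>x) u + exp(-i\<rho>x) v\<close> the equation reads \<open>(u, v)' = (2i\<rho>)\<^sup>-\<^sup>1 B (u, v)\<close> with a matrix
\<open>B\<close> whose diagonal blocks are \<open>Q\<close> and \<open>-Q\<close> and whose other blocks oscillate. A first-order
Volterra expansion and the Riemann--Lebesgue lemma give the transfer matrix
\<open>1 + (2i\<rho>)\<^sup>-\<^sup>1 diag(A, -A) + o(1/\<rho>)\<close> for \<open>(u, v)\<close>. To this order there are two families of multipliers, with the angles
\<open>\<pi>\<rho> - \<mu>/(2\<rho>)\<close> and \<open>-\<pi>\<rho> + \<mu>/(2\<rho>)\<close>, where \<open>\<mu>\<close> runs through the eigenvalues of \<open>A\<close>.

A real eigenvalue \<open>\<mu>\<^sub>j\<close> of odd multiplicity thus produces a change of sign, unless its angle collides, at the scale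
\<open>1/\<rho>\<close>, with an angle of the second family. If \<open>\<pi>\<rho>\<close> differs from an integral multiple of \<open>\<pi>\<close> by
about \<open>b/(4\<rho>)\<close>, then a collision means that \<open>b = \<mu>\<^sub>j + \<mu>\<^sub>i\<close> for a real eigenvalue \<open>\<mu>\<^sub>i\<close>; at larger
distances there is none. If each of three eigenvalues collided for the same \<open>b\<close>, the three
sums \<open>\<mu>\<^sub>j + \<mu>\<^sub>i\<close> would coincide, which the condition on the diameters excludes
(\<open>three_shifts_separated\<close>). A sequence of energies outside the spectrum that tends to infinity therefore leads to a
contradiction.\<close>

section \<open>The Riemann--Lebesgue lemma\<close>

lemma absolutely_integrable_norm_integrable:
  fixes f :: "'a::euclidean_space \<Rightarrow> 'b::euclidean_space"
  shows "f absolutely_integrable_on S \<Longrightarrow> (\<lambda>x. norm (f x)) integrable_on S"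
  by (simp add: absolutely_integrable_on_def)

lemmas absolutely_integrable_abs_integrable =
  absolutely_integrable_norm_integrable[where 'b=real, unfolded real_norm_def]

text \<open>Truncation reduces the claim to bounded functions, a measurable function is an almost everywhere limit of
continuous ones, and continuous functions are uniform limits of polynomials; dominated convergence
controls the first two steps.\<close>

lemma polynomial_dense_in_L1:
  fixes q :: "real \<Rightarrow> real"
  assumes q: "q absolutely_integrable_on {a..b}" and e: "e > 0"
  obtains p where "real_polynomial_function p" "integral {a..b} (\<lambda>x. \<bar>q x - p x\<bar>) < e"
proof -
  define t where "t = (\<lambda>(k::nat) x::real. max (- real k) (min (real k) x))"
  have t_le: "\<bar>t k x\<bar> \<le> real k" for k x by (auto simp: t_def)
  have t_cont: "continuous_on UNIV (t k)" for k
    unfolding t_def by (intro continuous_intros)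
  have qm: "q \<in> borel_measurable (lebesgue_on {a..b})"
    using absolutely_integrable_imp_borel_measurable[OF q] by simp
  have tq: "(\<lambda>x. t k (q x)) absolutely_integrable_on {a..b}" for k
  proof (rule measurable_bounded_by_integrable_imp_absolutely_integrable[where g="\<lambda>_. real k"])
    have "t k \<in> borel_measurable borel"
      by (intro borel_measurable_continuous_onI t_cont)
    then show "(\<lambda>x. t k (q x)) \<in> borel_measurable (lebesgue_on {a..b})"
      using measurable_compose[OF qm, of "t k" borel] by simp
  qed (use t_le in auto)
  have "(\<lambda>k. integral {a..b} (\<lambda>x. \<bar>q x - t k (q x)\<bar>)) \<longlonglongrightarrow> integral {a..b} (\<lambda>x. 0::real)"
  proof (rule dominated_convergence[where h="\<lambda>x. \<bar>q x\<bar>"])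
    show "(\<lambda>x. \<bar>q x - t k (q x)\<bar>) integrable_on {a..b}" for k
      by (rule absolutely_integrable_abs_integrable[OF set_integral_diff(1)[OF q tq[of k]]])
    show "(\<lambda>x. \<bar>q x\<bar>) integrable_on {a..b}"
      by (rule absolutely_integrable_abs_integrable[OF q])
    show "norm \<bar>q x - t k (q x)\<bar> \<le> \<bar>q x\<bar>" for k x
      by (auto simp: t_def)
    fix x
    have "\<forall>\<^sub>F k in sequentially. \<bar>q x - t k (q x)\<bar> = 0"
      using eventually_ge_at_top[of "nat \<lceil>\<bar>q x\<bar>\<rceil>"]
    proof eventually_elim
      case (elim k)
      then have "\<bar>q x\<bar> \<le> real k" by linarith
      then show ?case by (auto simp: t_def)
    qed
    then show "(\<lambda>k. \<bar>q x - t k (q x)\<bar>) \<longlonglongrightarrow> 0"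
      by (rule tendsto_eventually)
  qed
  then have "\<forall>\<^sub>F k in sequentially. integral {a..b} (\<lambda>x. \<bar>q x - t k (q x)\<bar>) < e/3"
    using e by (intro order_tendstoD(2)[where y="0"]) auto
  then obtain k where k: "integral {a..b} (\<lambda>x. \<bar>q x - t k (q x)\<bar>) < e/3"
    using eventually_sequentially by auto
  have "q measurable_on {a..b}"
    using qm measurable_on_iff_borel_measurable by (metis lmeasurable_iff_integrable_on fmeasurableD lmeasurable_interval(1) cbox_interval)
  then obtain N g where N: "negligible N" and g: "\<And>n. continuous_on UNIV (g n)"
    and lim: "\<And>x. x \<notin> N \<Longrightarrow> (\<lambda>n. g n x) \<longlonglongrightarrow> (if x \<in> {a..b} then q x else 0)"
    unfolding measurable_on_def by blast
  have tg: "continuous_on {a..b} (\<lambda>x. t k (g n x))" for n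
    using continuous_on_compose2[OF t_cont g] continuous_on_subset by blast
  \<comment> \<open>the error, set to zero on the exceptional null set so that it converges at every point\<close>
  define r where "r = (\<lambda>n x. if x \<in> N then 0 else \<bar>t k (q x) - t k (g n x)\<bar>)"
  have rint: "(\<lambda>x. \<bar>t k (q x) - t k (g n x)\<bar>) integrable_on {a..b}" for n
    by (rule absolutely_integrable_abs_integrable[OF set_integral_diff(1)[OF tq[of k] absolutely_integrable_continuous_real[OF tg[of n]]]])
  have req: "integral {a..b} (r n) = integral {a..b} (\<lambda>x. \<bar>t k (q x) - t k (g n x)\<bar>)" for n
    by (rule integral_spike[OF N]) (auto simp: r_def)
  have "(\<lambda>n. integral {a..b} (r n)) \<longlonglongrightarrow> integral {a..b} (\<lambda>x. 0::real)"
  proof (rule dominated_convergence[where h="\<lambda>x. 2 * real k"])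
    show "r n integrable_on {a..b}" for n
      by (rule integrable_spike[OF rint[of n] N]) (auto simp: r_def)
    show "norm (r n x) \<le> 2 * real k" for n x
      using t_le[of k "q x"] t_le[of k "g n x"] by (auto simp: r_def)
    show "(\<lambda>n. r n x) \<longlonglongrightarrow> 0" if "x \<in> {a..b}" for x
    proof (cases "x \<in> N")
      case False
      have "(\<lambda>n. g n x) \<longlonglongrightarrow> q x" using lim[OF False] that by simp
      then have "(\<lambda>n. \<bar>t k (q x) - t k (g n x)\<bar>) \<longlonglongrightarrow> \<bar>t k (q x) - t k (q x)\<bar>"
        unfolding t_def by (intro tendsto_intros)
      then show ?thesis using False by (simp add: r_def)
    qed (simp add: r_def)
  qed auto
  then have "\<forall>\<^sub>F n in sequentially. integral {a..b} (r n) < e/3"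
    using e by (intro order_tendstoD(2)[where y="0"]) auto
  then obtain n where n: "integral {a..b} (r n) < e/3"
    using eventually_sequentially by auto
  define d where "d = e / (3 * (\<bar>b - a\<bar> + 1))"
  have d: "d > 0" using e by (simp add: d_def add_nonneg_pos)
  obtain p where p: "real_polynomial_function p" and pc: "\<And>x. x \<in> {a..b} \<Longrightarrow> \<bar>t k (g n x) - p x\<bar> < d"
    using Stone_Weierstrass_real_polynomial_function[OF compact_Icc tg d] by blast
  have pcont: "continuous_on {a..b} p"
    using p continuous_on_polymonial_function by (simp add: real_polynomial_function_eq)
  have int3: "(\<lambda>x. \<bar>t k (g n x) - p x\<bar>) integrable_on {a..b}"
    by (intro integrable_continuous_real continuous_intros tg pcont)
  have "integral {a..b} (\<lambda>x. \<bar>t k (g n x) - p x\<bar>) \<le> integral {a..b} (\<lambda>x. d)"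
    by (rule integral_le[OF int3]) (use pc in \<open>auto intro: less_imp_le\<close>)
  also have "\<dots> \<le> d * (\<bar>b - a\<bar>+1)"
    using d by (auto simp: mult_left_mono max_def)
  also have "\<dots> = e/3"
  proof -
    have "\<bar>b - a\<bar> + 1 \<noteq> 0" by linarith
    then show ?thesis unfolding d_def by (metis (no_types, lifting) divide_divide_eq_left nonzero_eq_divide_eq times_divide_eq_left)
  qed
  finally have 3: "integral {a..b} (\<lambda>x. \<bar>t k (g n x) - p x\<bar>) \<le> e/3" .
  have int1: "(\<lambda>x. \<bar>q x - t k (q x)\<bar>) integrable_on {a..b}"
    by (rule absolutely_integrable_abs_integrable[OF set_integral_diff(1)[OF q tq[of k]]])
  have "integral {a..b} (\<lambda>x. \<bar>q x - p x\<bar>) \<le>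
      integral {a..b} (\<lambda>x. \<bar>q x - t k (q x)\<bar> + (\<bar>t k (q x) - t k (g n x)\<bar> + \<bar>t k (g n x) - p x\<bar>))"
  proof (rule integral_le)
    have "p absolutely_integrable_on {a..b}"
      by (rule absolutely_integrable_continuous_real[OF pcont])
    then show "(\<lambda>x. \<bar>q x - p x\<bar>) integrable_on {a..b}"
      by (intro absolutely_integrable_abs_integrable set_integral_diff(1) q)
  qed (use int1 rint int3 in \<open>auto intro!: integrable_add\<close>)
  also have "\<dots> = integral {a..b} (\<lambda>x. \<bar>q x - t k (q x)\<bar>) + (integral {a..b} (r n)
      + integral {a..b} (\<lambda>x. \<bar>t k (g n x) - p x\<bar>))"
    by (simp add: integral_add int1 rint int3 integrable_add req)
  also have "\<dots> < e" using k n 3 by linarith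
  finally show ?thesis using that p by blast
qed

lemma absolutely_integrable_bilinear_continuous:
  fixes h :: "'a::euclidean_space \<Rightarrow> 'b::euclidean_space \<Rightarrow> 'c::euclidean_space"
  assumes "bounded_bilinear h" "continuous_on {a..b::real} f" "g absolutely_integrable_on {a..b}"
  shows "(\<lambda>x. h (f x) (g x)) absolutely_integrable_on {a..b}"
proof (rule absolutely_integrable_bounded_measurable_product[where h=h and f=f])
  show "bilinear h" using assms(1) bilinear_conv_bounded_bilinear by blast
  show "f \<in> borel_measurable (lebesgue_on {a..b})"
    using continuous_imp_measurable_on_sets_lebesgue[OF assms(2)] by simp
  show "bounded (f ` {a..b})"
    using compact_continuous_image[OF assms(2)] compact_imp_bounded by blast
qed (use assms in auto)

lemmas absolutely_integrable_bilinear_continuous' =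
  absolutely_integrable_bilinear_continuous[OF bounded_bilinear.flip]

text \<open>Integration by parts gains a factor \<open>1 / w\<close>.\<close>

lemma oscillating_polynomial_integral_bound:
  assumes p: "real_polynomial_function p"
  obtains C where "\<And>w. w \<noteq> 0 \<Longrightarrow> norm (integral {a..b} (\<lambda>x. cis (w * x) * of_real (p x))) \<le> C / \<bar>w\<bar>"
proof (cases "a \<le> b")
  case False
  then show ?thesis using that[of 0] by simp
next
  case ab: True
  obtain p' where p': "real_polynomial_function p'" and D: "\<And>x. (p has_real_derivative p' x) (at x)"
    using has_real_derivative_polynomial_function[OF p] by blast
  have pc: "continuous_on {a..b} p" and p'c: "continuous_on {a..b} p'"
    using p p' continuous_on_polymonial_function by (simp_all add: real_polynomial_function_eq)
  define C where "C = \<bar>p a\<bar> + \<bar>p b\<bar> + integral {a..b} (\<lambda>x. \<bar>p' x\<bar>)"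
  have "norm (integral {a..b} (\<lambda>x. cis (w * x) * of_real (p x))) \<le> C / \<bar>w\<bar>" if w: "w \<noteq> 0" for w
  proof -
    define f where "f = (\<lambda>x. cis (w * x) * of_real (p x) / (\<i> * of_real w))"
    define g where "g = (\<lambda>x. cis (w * x) * of_real (p' x) / (\<i> * of_real w))"
    have cis_c: "continuous_on S (\<lambda>x. cis (w * x))" for S
      by (intro continuous_intros)
    have "((\<lambda>x. cis (w * x) * of_real (p x) + g x) has_integral (f b - f a)) {a..b}"
    proof (rule fundamental_theorem_of_calculus[OF ab])
      fix x
      have "((\<lambda>x. exp (\<i> * of_real w * of_real x)) has_vector_derivative (\<i> * of_real w) * exp (\<i> * of_real w * of_real x)) (at x)"
        by (rule has_vector_derivative_real_field) (auto intro!: derivative_eq_intros)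
      then have 1: "((\<lambda>x. cis (w * x)) has_vector_derivative (\<i> * of_real w) * cis (w * x)) (at x)"
        by (simp add: cis_conv_exp mult.assoc)
      have 2: "((\<lambda>x. complex_of_real (p x)) has_vector_derivative of_real (p' x)) (at x)"
        using D by (simp add: has_vector_derivative_of_real has_real_derivative_iff_has_vector_derivative)
      have "((\<lambda>x. cis (w * x) * of_real (p x) * inverse (\<i> * of_real w)) has_vector_derivative
        (cis (w * x) * of_real (p' x) + (\<i> * of_real w) * cis (w * x) * of_real (p x)) * inverse (\<i> * of_real w)) (at x)"
        by (intro has_vector_derivative_mult_left has_vector_derivative_mult 1 2)
      moreover have "(cis (w * x) * of_real (p' x) + (\<i> * of_real w) * cis (w * x) * of_real (p x)) * inverse (\<i> * of_real w)
         = cis (w * x) * of_real (p x) + g x"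
        using w by (simp add: g_def field_simps)
      ultimately have "(f has_vector_derivative (cis (w * x) * of_real (p x) + g x)) (at x)"
        by (simp add: f_def divide_inverse)
      then show "(f has_vector_derivative (cis (w * x) * of_real (p x) + g x)) (at x within {a..b})"
        by (rule has_vector_derivative_at_within)
    qed
    moreover have g_int: "g integrable_on {a..b}"
      unfolding g_def by (intro integrable_continuous_real continuous_intros p'c) (use w in auto)
    moreover have "(\<lambda>x. cis (w * x) * of_real (p x)) integrable_on {a..b}"
      by (intro integrable_continuous_real continuous_intros pc)
    ultimately have "integral {a..b} (\<lambda>x. cis (w * x) * of_real (p x)) = f b - f a - integral {a..b} g"
        using g_int by (simp add: has_integral_iff integral_add algebra_simps)
    also have "norm \<dots> \<le> norm (f b) + norm (f a) + norm (integral {a..b} g)"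
      by (meson add_mono_thms_linordered_semiring(3) norm_triangle_ineq4 order_trans)
    also have "norm (integral {a..b} g) \<le> integral {a..b} (\<lambda>x. \<bar>p' x\<bar> / \<bar>w\<bar>)"
      by (rule integral_norm_bound_integral[OF g_int])
         (use w in \<open>auto intro!: integrable_continuous_real continuous_intros p'c simp: g_def norm_divide norm_mult\<close>)
    also have "\<dots> = integral {a..b} (\<lambda>x. \<bar>p' x\<bar>) / \<bar>w\<bar>" by simp
    finally show ?thesis
      by (simp add: f_def C_def norm_divide norm_mult add_divide_distrib)
  qed
  then show ?thesis using that by blast
qed

lemma riemann_lebesgue_real:
  fixes q :: "real \<Rightarrow> real" and \<omega> :: "'n \<Rightarrow> real"
  assumes q: "q absolutely_integrable_on {a..b}" and w: "filterlim \<omega> at_infinity F"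
  shows "((\<lambda>n. integral {a..b} (\<lambda>x. cis (\<omega> n * x) * of_real (q x))) \<longlongrightarrow> 0) F"
proof (rule tendstoI)
  fix e :: real assume e: "e > 0"
  obtain p where p: "real_polynomial_function p" and pq: "integral {a..b} (\<lambda>x. \<bar>q x - p x\<bar>) < e/2"
    using polynomial_dense_in_L1[OF q, of "e/2"] e by auto
  obtain C where C: "\<And>w. w \<noteq> 0 \<Longrightarrow> norm (integral {a..b} (\<lambda>x. cis (w * x) * of_real (p x))) \<le> C / \<bar>w\<bar>"
    using oscillating_polynomial_integral_bound[OF p] by metis
  have pc: "continuous_on {a..b} p"
    using p continuous_on_polymonial_function by (simp add: real_polynomial_function_eq)
  have dint: "(\<lambda>x. \<bar>q x - p x\<bar>) integrable_on {a..b}"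
    by (rule absolutely_integrable_abs_integrable[OF set_integral_diff(1)[OF q absolutely_integrable_continuous_real[OF pc]]])
  have cq: "(\<lambda>x. cis (w * x) * of_real (q x)) integrable_on {a..b}" for w
  proof -
    have "(\<lambda>x. complex_of_real (q x)) absolutely_integrable_on {a..b}"
      using absolutely_integrable_linear[OF q bounded_linear_of_real] by (simp add: o_def)
    then show ?thesis
      by (intro absolutely_integrable_bilinear_continuous[OF bounded_bilinear_mult,
            THEN absolutely_integrable_on_def[THEN iffD1], THEN conjunct1] continuous_intros)
  qed
  have cp: "(\<lambda>x. cis (w * x) * of_real (p x)) integrable_on {a..b}" for w
    by (intro integrable_continuous_real continuous_intros pc)
  have bound: "norm (integral {a..b} (\<lambda>x. cis (w * x) * of_real (q x))) < e"
    if "\<bar>w\<bar> \<ge> 2 * \<bar>C\<bar> / e + 1" for w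
  proof -
    have wpos: "\<bar>w\<bar> > 0" using that e by (smt (verit) divide_nonneg_pos abs_ge_zero)
    have "norm (integral {a..b} (\<lambda>x. cis (w * x) * of_real (q x))
        - integral {a..b} (\<lambda>x. cis (w * x) * of_real (p x)))
      = norm (integral {a..b} (\<lambda>x. cis (w * x) * of_real (q x) - cis (w * x) * of_real (p x)))"
      by (subst integral_diff) (use cq cp in auto)
    also have "\<dots> \<le> integral {a..b} (\<lambda>x. \<bar>q x - p x\<bar>)"
    proof (rule integral_norm_bound_integral[OF integrable_diff[OF cq cp] dint])
      show "norm (cis (w * x) * of_real (q x) - cis (w * x) * of_real (p x)) \<le> \<bar>q x - p x\<bar>" for x
        by (simp add: norm_mult flip: right_diff_distrib of_real_diff)
    qed
    finally have 1: "norm (integral {a..b} (\<lambda>x. cis (w * x) * of_real (q x))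
        - integral {a..b} (\<lambda>x. cis (w * x) * of_real (p x))) < e/2" using pq by linarith
    have "2 * \<bar>C\<bar> / e < \<bar>w\<bar>" using that by linarith
    then have "\<bar>C\<bar> / \<bar>w\<bar> < e/2" using e wpos by (simp add: field_simps)
    moreover have "C / \<bar>w\<bar> \<le> \<bar>C\<bar> / \<bar>w\<bar>" by (simp add: divide_right_mono)
    ultimately have "norm (integral {a..b} (\<lambda>x. cis (w * x) * of_real (p x))) < e/2"
      using C[of w] wpos by linarith
    then show ?thesis using 1 norm_triangle_sub by (smt (verit, best) field_sum_of_halves)
  qed
  have "\<forall>\<^sub>F n in F. \<bar>\<omega> n\<bar> \<ge> 2 * \<bar>C\<bar> / e + 1"
  proof -
    have "2 * \<bar>C\<bar> / e + 1 > 0" using e by (simp add: add_nonneg_pos)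
    then show ?thesis using w filterlim_at_infinity[of 0 \<omega> F] by auto
  qed
  then show "\<forall>\<^sub>F n in F. dist (integral {a..b} (\<lambda>x. cis (\<omega> n * x) * of_real (q x))) 0 < e"
    by eventually_elim (use bound in auto)
qed

lemma riemann_lebesgue:
  fixes q :: "real \<Rightarrow> complex" and \<omega> :: "'n \<Rightarrow> real"
  assumes q: "q absolutely_integrable_on {a..b}" and w: "filterlim \<omega> at_infinity F"
  shows "((\<lambda>n. integral {a..b} (\<lambda>x. cis (\<omega> n * x) * q x)) \<longlongrightarrow> 0) F"
proof -
  have re: "(\<lambda>x. Re (q x)) absolutely_integrable_on {a..b}" and im: "(\<lambda>x. Im (q x)) absolutely_integrable_on {a..b}"
    using absolutely_integrable_linear[OF q bounded_linear_Re] absolutely_integrable_linear[OF q bounded_linear_Im]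
    by (simp_all add: o_def)
  have int: "(\<lambda>x. cis (v * x) * of_real (r x)) integrable_on {a..b}"
    if "r absolutely_integrable_on {a..b}" for v and r :: "real \<Rightarrow> real"
  proof -
    have "(\<lambda>x. complex_of_real (r x)) absolutely_integrable_on {a..b}"
      using absolutely_integrable_linear[OF that bounded_linear_of_real] by (simp add: o_def)
    then show ?thesis
      by (intro absolutely_integrable_bilinear_continuous[OF bounded_bilinear_mult,
            THEN absolutely_integrable_on_def[THEN iffD1], THEN conjunct1] continuous_intros)
  qed
  have eq: "integral {a..b} (\<lambda>x. cis (v * x) * q x) =
     integral {a..b} (\<lambda>x. cis (v * x) * of_real (Re (q x))) +
     \<i> * integral {a..b} (\<lambda>x. cis (v * x) * of_real (Im (q x)))" for v
  proof -
    have "cis (v * x) * q x = cis (v * x) * of_real (Re (q x)) + \<i> * (cis (v * x) * of_real (Im (q x)))" for x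
      by (subst (1) complex_eq[of "q x"]) (simp add: algebra_simps)
    then have "integral {a..b} (\<lambda>x. cis (v * x) * q x) = integral {a..b} (\<lambda>x. cis (v * x) * of_real (Re (q x)) + \<i> * (cis (v * x) * of_real (Im (q x))))"
      by presburger
    also have "\<dots> = integral {a..b} (\<lambda>x. cis (v * x) * of_real (Re (q x))) + integral {a..b} (\<lambda>x. \<i> * (cis (v * x) * of_real (Im (q x))))"
      by (rule integral_add[OF int[OF re] integrable_on_mult_right[OF int[OF im]]])
    finally show ?thesis by (simp only: integral_mult_right)
  qed
  show ?thesis
    unfolding eq using tendsto_add[OF riemann_lebesgue_real[OF re w] tendsto_mult_left[OF riemann_lebesgue_real[OF im w], of \<i>]]
    by simp
qed

section \<open>Linear Volterra equations with a small kernel\<close>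

lemma volterra_integral_bound:
  fixes h :: "'c::euclidean_space \<Rightarrow> 'a::euclidean_space \<Rightarrow> 'a"
  assumes h: "bounded_bilinear h" and K: "\<And>x y. norm (h x y) \<le> K * norm x * norm y" "0 \<le> K"
    and B: "B absolutely_integrable_on {a..b::real}"
    and X: "continuous_on {a..b} X" and M: "\<And>t. t \<in> {a..b} \<Longrightarrow> norm (X t) \<le> M"
    and x: "x \<in> {a..b}"
  shows "norm (integral {a..x} (\<lambda>t. h (B t) (X t))) \<le> K * integral {a..b} (\<lambda>t. norm (B t)) * M"
proof -
  have M0: "0 \<le> M" using M[OF x] norm_ge_zero order_trans by blast
  have Bx: "B absolutely_integrable_on {a..x}"
    using absolutely_integrable_on_subinterval[OF B] x by auto
  have Xx: "continuous_on {a..x} X" using X x continuous_on_subset by fastforce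
  have 1: "(\<lambda>t. h (B t) (X t)) integrable_on {a..x}"
    using absolutely_integrable_bilinear_continuous'[OF h Xx Bx] absolutely_integrable_on_def by blast
  have nB: "(\<lambda>t. norm (B t)) integrable_on {a..b}" "(\<lambda>t. norm (B t)) integrable_on {a..x}"
    using B Bx absolutely_integrable_on_def by blast+
  have "norm (integral {a..x} (\<lambda>t. h (B t) (X t))) \<le> integral {a..x} (\<lambda>t. K * M * norm (B t))"
  proof (rule integral_norm_bound_integral[OF 1])
    show "(\<lambda>t. K * M * norm (B t)) integrable_on {a..x}"
      using nB(2) by (rule integrable_on_mult_right)
    fix t assume "t \<in> {a..x}"
    then have "norm (X t) \<le> M" using M x by auto
    then have "K * norm (B t) * norm (X t) \<le> K * norm (B t) * M"
      using K(2) by (intro mult_left_mono) auto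
    then show "norm (h (B t) (X t)) \<le> K * M * norm (B t)"
      using K(1)[of "B t" "X t"] by (simp add: mult_ac)
  qed
  also have "\<dots> = K * M * integral {a..x} (\<lambda>t. norm (B t))" by simp
  also have "\<dots> \<le> K * M * integral {a..b} (\<lambda>t. norm (B t))"
    using x K(2) M0 by (intro mult_left_mono integral_subset_le nB) auto
  finally show ?thesis by (simp add: mult_ac)
qed

text \<open>The integral operator is a contraction with constant \<open>1/2\<close>, so the Banach fixed point theorem applies
without iterating the kernel. Functions are frozen outside of \<open>[a, b]\<close> to obtain bounded continuous
functions on the line.\<close>

lemma volterra_exists:
  fixes h :: "'c::euclidean_space \<Rightarrow> 'a::euclidean_space \<Rightarrow> 'a"
  assumes h: "bounded_bilinear h" and K: "\<And>x y. norm (h x y) \<le> K * norm x * norm y" "0 \<le> K"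
    and B: "B absolutely_integrable_on {a..b::real}" and ab: "a \<le> b"
    and small: "K * integral {a..b} (\<lambda>t. norm (B t)) \<le> 1/2"
  obtains X where "continuous_on {a..b} X"
    "\<And>x. x \<in> {a..b} \<Longrightarrow> X x = X0 + integral {a..x} (\<lambda>t. h (B t) (X t))"
proof -
  define cl where "cl = (\<lambda>x. max a (min b x))"
  have cl: "cl x \<in> {a..b}" for x using ab by (auto simp: cl_def)
  have clc: "continuous_on UNIV cl" unfolding cl_def by (intro continuous_intros)
  define P where "P = (\<lambda>f x. X0 + integral {a..cl x} (\<lambda>t. h (B t) (apply_bcontfun f t)))"
  have cf: "continuous_on {a..b} (apply_bcontfun f)" for f :: "real \<Rightarrow>\<^sub>C 'a" by auto
  have hint: "(\<lambda>t. h (B t) (apply_bcontfun f t)) integrable_on {a..b}" for f :: "real \<Rightarrow>\<^sub>C 'a"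
    using absolutely_integrable_bilinear_continuous'[OF h cf B] absolutely_integrable_on_def by blast
  have bounds: "norm (integral {a..cl x} (\<lambda>t. h (B t) (apply_bcontfun f t))) \<le> 1/2 * M"
    if "\<And>t. norm (apply_bcontfun f t) \<le> M" for f :: "real \<Rightarrow>\<^sub>C 'a" and M x
  proof -
    have "0 \<le> M" using that norm_ge_zero order_trans by blast
    then have "K * integral {a..b} (\<lambda>t. norm (B t)) * M \<le> 1/2 * M"
      by (rule mult_right_mono[OF small])
    then show ?thesis
      using volterra_integral_bound[OF h K B cf that cl] order_trans by blast
  qed
  have Pb: "P f \<in> bcontfun" for f
  proof (rule bcontfun_normI)
    have "continuous_on {a..b} (\<lambda>x. integral {a..x} (\<lambda>t. h (B t) (apply_bcontfun f t)))"
      by (rule indefinite_integral_continuous_1[OF hint])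
    then have "continuous_on UNIV (\<lambda>x. integral {a..cl x} (\<lambda>t. h (B t) (apply_bcontfun f t)))"
      by (rule continuous_on_compose2[OF _ clc]) (use cl in auto)
    then show "continuous_on UNIV (P f)" unfolding P_def by (intro continuous_intros)
    show "norm (P f x) \<le> norm X0 + 1/2 * norm f" for x
      unfolding P_def by (intro norm_triangle_mono order_refl bounds norm_bounded)
  qed
  have "\<exists>!f. Bcontfun (P f) = f"
  proof (rule banach_fix_type[of "1/2"]; (intro allI)?)
    fix f g :: "real \<Rightarrow>\<^sub>C 'a"
    have "norm (Bcontfun (P f) - Bcontfun (P g)) \<le> 1/2 * norm (f - g)"
    proof (rule norm_bound)
      fix x
      have "apply_bcontfun (Bcontfun (P f) - Bcontfun (P g)) x = P f x - P g x"
        by (simp add: Bcontfun_inverse Pb)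
      also have "\<dots> = integral {a..cl x} (\<lambda>t. h (B t) (apply_bcontfun (f - g) t))"
      proof -
        have i: "(\<lambda>t. h (B t) (apply_bcontfun f t)) integrable_on {a..cl x}" for f :: "real \<Rightarrow>\<^sub>C 'a"
          using integrable_on_subinterval[OF hint, of a "cl x"] cl[of x] by auto
        have "integral {a..cl x} (\<lambda>t. h (B t) (apply_bcontfun (f - g) t)) =
          integral {a..cl x} (\<lambda>t. h (B t) (apply_bcontfun f t) - h (B t) (apply_bcontfun g t))"
          by (simp add: bounded_bilinear.diff_right[OF h])
        also have "\<dots> = integral {a..cl x} (\<lambda>t. h (B t) (apply_bcontfun f t)) - integral {a..cl x} (\<lambda>t. h (B t) (apply_bcontfun g t))"
          by (rule integral_diff[OF i i])
        finally show ?thesis by (simp add: P_def)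
      qed
      also have "norm \<dots> \<le> 1/2 * norm (f - g)"
        by (rule bounds[OF norm_bounded])
      finally show "norm (apply_bcontfun (Bcontfun (P f) - Bcontfun (P g)) x) \<le> 1/2 * norm (f - g)" .
    qed
    then show "dist (Bcontfun (P f)) (Bcontfun (P g)) \<le> 1/2 * dist f g"
      by (simp add: dist_norm)
  qed auto
  then obtain f where f: "Bcontfun (P f) = f" by blast
  have "apply_bcontfun f x = X0 + integral {a..x} (\<lambda>t. h (B t) (apply_bcontfun f t))" if "x \<in> {a..b}" for x
  proof -
    have "apply_bcontfun f x = P f x" using f Bcontfun_inverse[OF Pb] by metis
    moreover have "cl x = x" using that by (auto simp: cl_def)
    ultimately show ?thesis by (simp add: P_def)
  qed
  then show ?thesis using that cf by blast
qed

lemma volterra_bound: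
  fixes h :: "'c::euclidean_space \<Rightarrow> 'a::euclidean_space \<Rightarrow> 'a"
  assumes h: "bounded_bilinear h" and K: "\<And>x y. norm (h x y) \<le> K * norm x * norm y" "0 \<le> K"
    and B: "B absolutely_integrable_on {a..b::real}" and ab: "a \<le> b"
    and small: "K * integral {a..b} (\<lambda>t. norm (B t)) \<le> 1/2"
    and X: "continuous_on {a..b} X"
    and eq: "\<And>x. x \<in> {a..b} \<Longrightarrow> X x = X0 + integral {a..x} (\<lambda>t. h (B t) (X t))"
    and x: "x \<in> {a..b}"
  shows "norm (X x) \<le> 2 * norm X0"
proof -
  have "compact ((\<lambda>x. norm (X x)) ` {a..b})"
    by (intro compact_continuous_image continuous_intros X) auto
  then obtain x0 where x0: "x0 \<in> {a..b}" and max: "\<And>t. t \<in> {a..b} \<Longrightarrow> norm (X t) \<le> norm (X x0)"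
    using compact_attains_sup[of "(\<lambda>x. norm (X x)) ` {a..b}"] ab by auto
  have "norm (integral {a..x0} (\<lambda>t. h (B t) (X t))) \<le> K * integral {a..b} (\<lambda>t. norm (B t)) * norm (X x0)"
    by (rule volterra_integral_bound[OF h K B X max x0])
  also have "\<dots> \<le> 1/2 * norm (X x0)" using small by (intro mult_right_mono) auto
  finally have "norm (integral {a..x0} (\<lambda>t. h (B t) (X t))) \<le> 1/2 * norm (X x0)" .
  moreover have "norm (X x0) \<le> norm X0 + norm (integral {a..x0} (\<lambda>t. h (B t) (X t)))"
    by (subst eq[OF x0]) (rule norm_triangle_ineq)
  ultimately have "norm (X x0) \<le> norm X0 + 1/2 * norm (X x0)" by linarith
  then show ?thesis using max[OF x] by linarith
qed

lemma volterra_unique: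
  fixes h :: "'c::euclidean_space \<Rightarrow> 'a::euclidean_space \<Rightarrow> 'a"
  assumes h: "bounded_bilinear h" and K: "\<And>x y. norm (h x y) \<le> K * norm x * norm y" "0 \<le> K"
    and B: "B absolutely_integrable_on {a..b::real}" and ab: "a \<le> b"
    and small: "K * integral {a..b} (\<lambda>t. norm (B t)) \<le> 1/2"
    and X: "continuous_on {a..b} X" "continuous_on {a..b} Y"
    and eq: "\<And>x. x \<in> {a..b} \<Longrightarrow> X x = X0 + integral {a..x} (\<lambda>t. h (B t) (X t))"
      "\<And>x. x \<in> {a..b} \<Longrightarrow> Y x = X0 + integral {a..x} (\<lambda>t. h (B t) (Y t))"
    and x: "x \<in> {a..b}"
  shows "X x = Y x"
proof -
  have i: "(\<lambda>t. h (B t) (Z t)) integrable_on {a..x}" if "continuous_on {a..b} Z" "x \<in> {a..b}" for x Z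
    using integrable_on_subinterval[of "\<lambda>t. h (B t) (Z t)" "{a..b}" a x] that
      absolutely_integrable_bilinear_continuous'[OF h that(1) B] absolutely_integrable_on_def by auto
  have "norm (X x - Y x) \<le> 2 * norm (0::'a)"
  proof (rule volterra_bound[OF h K B ab small _ _ x])
    show "continuous_on {a..b} (\<lambda>x. X x - Y x)" by (intro continuous_intros X)
    show "X x - Y x = 0 + integral {a..x} (\<lambda>t. h (B t) (X t - Y t))" if "x \<in> {a..b}" for x
    proof -
      have "integral {a..x} (\<lambda>t. h (B t) (X t - Y t)) = integral {a..x} (\<lambda>t. h (B t) (X t) - h (B t) (Y t))"
        by (simp add: bounded_bilinear.diff_right[OF h])
      also have "\<dots> = integral {a..x} (\<lambda>t. h (B t) (X t)) - integral {a..x} (\<lambda>t. h (B t) (Y t))"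
        by (rule integral_diff[OF i i]) (use X that in auto)
      finally show ?thesis using eq that by simp
    qed
  qed
  then show ?thesis by simp
qed

text \<open>Replacing the solution by its initial value inside the integral costs a second factor of the size of the
kernel. This quadratic error makes the expansion of the transfer matrix accurate to order \<open>o(1/\<rho>)\<close>.\<close>

lemma volterra_first_order:
  fixes h :: "'c::euclidean_space \<Rightarrow> 'a::euclidean_space \<Rightarrow> 'a"
  assumes h: "bounded_bilinear h" and K: "\<And>x y. norm (h x y) \<le> K * norm x * norm y" "0 \<le> K"
    and B: "B absolutely_integrable_on {a..b::real}" and ab: "a \<le> b"
    and small: "K * integral {a..b} (\<lambda>t. norm (B t)) \<le> 1/2"
    and X: "continuous_on {a..b} X"
    and eq: "\<And>x. x \<in> {a..b} \<Longrightarrow> X x = X0 + integral {a..x} (\<lambda>t. h (B t) (X t))"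
  shows "norm (X b - X0 - integral {a..b} (\<lambda>t. h (B t) X0))
    \<le> 2 * (K * integral {a..b} (\<lambda>t. norm (B t)))\<^sup>2 * norm X0"
proof -
  define L where "L = K * integral {a..b} (\<lambda>t. norm (B t))"
  note bd = volterra_bound[OF h K B ab small X eq]
  have i: "(\<lambda>t. h (B t) (Z t)) integrable_on {a..b}" if "continuous_on {a..b} Z" for Z
    using absolutely_integrable_bilinear_continuous'[OF h that B] absolutely_integrable_on_def by auto
  have dev: "norm (X t - X0) \<le> L * (2 * norm X0)" if t: "t \<in> {a..b}" for t
    using volterra_integral_bound[OF h K B X bd t] eq[OF t] by (simp add: L_def)
  have "X b - X0 - integral {a..b} (\<lambda>t. h (B t) X0) = integral {a..b} (\<lambda>t. h (B t) (X t)) - integral {a..b} (\<lambda>t. h (B t) X0)"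
    using eq[of b] ab by simp
  also have "\<dots> = integral {a..b} (\<lambda>t. h (B t) (X t) - h (B t) X0)"
    by (rule integral_diff[symmetric]) (use i X in auto)
  also have "\<dots> = integral {a..b} (\<lambda>t. h (B t) (X t - X0))"
    by (simp add: bounded_bilinear.diff_right[OF h])
  also have "norm \<dots> \<le> K * integral {a..b} (\<lambda>t. norm (B t)) * (L * (2 * norm X0))"
    by (rule volterra_integral_bound[OF h K B _ dev]) (use ab X in \<open>auto intro!: continuous_intros\<close>)
  finally show ?thesis by (simp add: L_def power2_eq_square mult_ac)
qed

section \<open>Calculus of absolutely continuous functions\<close>

definition abs_cont_deriv_on :: "real set \<Rightarrow> (real \<Rightarrow> 'b::euclidean_space) \<Rightarrow> (real \<Rightarrow> 'b) \<Rightarrow> bool" where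
  "abs_cont_deriv_on S f g \<longleftrightarrow>
     (\<forall>a\<in>S. \<forall>b\<in>S. a \<le> b \<longrightarrow> g absolutely_integrable_on {a..b} \<and> f b - f a = integral {a..b} g)"

lemma loc_abs_cont_deriv_iff: "loc_abs_cont_deriv f g \<longleftrightarrow> abs_cont_deriv_on UNIV f g"
  by (auto simp: loc_abs_cont_deriv_def abs_cont_deriv_on_def)

lemma abs_cont_deriv_onD:
  assumes "abs_cont_deriv_on S f g" "a \<in> S" "b \<in> S" "a \<le> b"
  shows "g absolutely_integrable_on {a..b}" "g integrable_on {a..b}" "f b - f a = integral {a..b} g"
  using assms unfolding abs_cont_deriv_on_def absolutely_integrable_on_def by blast+

lemma abs_cont_deriv_on_subset:
  "abs_cont_deriv_on S f g \<Longrightarrow> T \<subseteq> S \<Longrightarrow> abs_cont_deriv_on T f g"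
  unfolding abs_cont_deriv_on_def by blast

lemma abs_cont_deriv_on_add:
  assumes "abs_cont_deriv_on S f g" "abs_cont_deriv_on S f' g'"
  shows "abs_cont_deriv_on S (\<lambda>x. f x + f' x) (\<lambda>x. g x + g' x)"
  unfolding abs_cont_deriv_on_def
proof (intro ballI impI)
  fix a b assume ab: "a \<in> S" "b \<in> S" "a \<le> b"
  note D = abs_cont_deriv_onD[OF assms(1) ab] abs_cont_deriv_onD[OF assms(2) ab]
  have "integral {a..b} (\<lambda>x. g x + g' x) = (f b - f a) + (f' b - f' a)"
    unfolding D(3) D(6) by (rule integral_add[OF D(2) D(5)])
  then show "(\<lambda>x. g x + g' x) absolutely_integrable_on {a..b} \<and>
      f b + f' b - (f a + f' a) = integral {a..b} (\<lambda>x. g x + g' x)"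
    using set_integral_add(1)[OF D(1) D(4)] by simp
qed

lemma abs_cont_deriv_on_continuous:
  assumes "abs_cont_deriv_on {a..b} f g"
  shows "continuous_on {a..b} f"
proof (cases "a \<le> b")
  case True
  then have g: "g integrable_on {a..b}"
    by (intro abs_cont_deriv_onD(2)[OF assms]) auto
  have "continuous_on {a..b} (\<lambda>x. f a + integral {a..x} g)"
    by (intro continuous_intros indefinite_integral_continuous_1[OF g])
  moreover have "f a + integral {a..x} g = f x" if "x \<in> {a..b}" for x
  proof -
    have "f x - f a = integral {a..x} g"
      by (rule abs_cont_deriv_onD(3)[OF assms]) (use that True in auto)
    then show ?thesis by (simp add: algebra_simps)
  qed
  ultimately show ?thesis by (rule continuous_on_eq)
qed auto

lemma abs_cont_deriv_onI:
  assumes g: "g absolutely_integrable_on {a..b}"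
    and f: "\<And>x. x \<in> {a..b} \<Longrightarrow> f x = f a + integral {a..x} g"
  shows "abs_cont_deriv_on {a..b} f g"
  unfolding abs_cont_deriv_on_def
proof (intro ballI impI conjI)
  fix x y assume xy: "x \<in> {a..b}" "y \<in> {a..b}" "x \<le> y"
  show "g absolutely_integrable_on {x..y}"
    using absolutely_integrable_on_subinterval[OF g] xy by auto
  have "g absolutely_integrable_on {a..y}"
    using absolutely_integrable_on_subinterval[OF g] xy by auto
  then have "g integrable_on {a..y}" unfolding absolutely_integrable_on_def by blast
  then have "integral {a..x} g + integral {x..y} g = integral {a..y} g"
    using xy by (intro Henstock_Kurzweil_Integration.integral_combine) auto
  then show "f y - f x = integral {x..y} g"
    unfolding f[OF xy(1)] f[OF xy(2)] by (metis add_diff_cancel_left add_diff_cancel_left')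
qed

text \<open>On a partition into \<open>n\<close> equal pieces the bounds add up to \<open>C (b - a) (G b - G a) / n\<close>.
This replaces differentiation almost everywhere in the product rule below.\<close>

lemma endpoints_equal_if_increments_second_order:
  fixes f :: "real \<Rightarrow> 'a::real_normed_vector" and G :: "real \<Rightarrow> real"
  assumes ab: "a \<le> b"
    and bd: "\<And>x y. a \<le> x \<Longrightarrow> x \<le> y \<Longrightarrow> y \<le> b \<Longrightarrow> norm (f y - f x) \<le> C * (y - x) * (G y - G x)"
  shows "f b = f a"
proof -
  have "norm (f b - f a) \<le> C * (b - a) * (G b - G a) / real (Suc n)" for n
  proof -
    define N where "N = real (Suc n)"
    have N: "N > 0" by (simp add: N_def)
    define t where "t = (\<lambda>k. a + real k * ((b - a) / N))"
    have t0: "t 0 = a" and tn: "t (Suc n) = b" using N by (auto simp: t_def N_def)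
    have step: "t (Suc k) - t k = (b - a) / N" for k
      unfolding t_def of_nat_Suc distrib_right by simp
    have mono: "t i \<le> t j" if "i \<le> j" for i j
      unfolding t_def using that ab N by (intro add_left_mono mult_right_mono) auto
    have "f b - f a = (\<Sum>k<Suc n. f (t (Suc k)) - f (t k))"
      using sum_lessThan_telescope[of "\<lambda>k. f (t k)" "Suc n"] t0 tn by simp
    also have "norm \<dots> \<le> (\<Sum>k<Suc n. norm (f (t (Suc k)) - f (t k)))" by (rule norm_sum)
    also have "\<dots> \<le> (\<Sum>k<Suc n. C * ((b - a) / N) * (G (t (Suc k)) - G (t k)))"
    proof (rule sum_mono)
      fix k assume "k \<in> {..<Suc n}"
      then have "a \<le> t k" "t k \<le> t (Suc k)" "t (Suc k) \<le> b"
        using mono[of 0 k] mono[of k "Suc k"] mono[of "Suc k" "Suc n"] t0 tn by auto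
      then show "norm (f (t (Suc k)) - f (t k)) \<le> C * ((b - a) / N) * (G (t (Suc k)) - G (t k))"
        using bd[of "t k" "t (Suc k)"] step[of k] by simp
    qed
    also have "\<dots> = C * ((b - a) / N) * (\<Sum>k<Suc n. G (t (Suc k)) - G (t k))"
      by (rule sum_distrib_left[symmetric])
    also have "(\<Sum>k<Suc n. G (t (Suc k)) - G (t k)) = G b - G a"
      using sum_lessThan_telescope[of "\<lambda>k. G (t k)" "Suc n"] t0 tn by simp
    finally show ?thesis by (simp add: N_def)
  qed
  moreover have "(\<lambda>n. C * (b - a) * (G b - G a) / real (Suc n)) \<longlonglongrightarrow> 0"
    by (rule LIMSEQ_Suc[OF lim_const_over_n])
  ultimately have "norm (f b - f a) \<le> 0"
    by (intro tendsto_lowerbound[where F=sequentially]) auto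
  then show ?thesis by simp
qed

text \<open>The product rule. The difference of both sides has increments bounded by the length of the interval times the
increment of \<open>\<integral>\<bar>g\<bar>\<close>, so the previous lemma applies; only \<open>f\<close> has to be
continuously differentiable.\<close>

lemma abs_cont_deriv_on_bilinear:
  fixes h :: "'a::euclidean_space \<Rightarrow> 'b::euclidean_space \<Rightarrow> 'c::euclidean_space"
  assumes h: "bounded_bilinear h"
    and f: "\<And>x. (f has_vector_derivative f' x) (at x)" and f': "continuous_on UNIV f'"
    and u: "abs_cont_deriv_on S u g" and S: "is_interval S"
  shows "abs_cont_deriv_on S (\<lambda>x. h (f x) (u x)) (\<lambda>x. h (f' x) (u x) + h (f x) (g x))"
  unfolding abs_cont_deriv_on_def
proof (intro ballI impI)
  fix a b assume ab: "a \<in> S" "b \<in> S" and le: "a \<le> b"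
  have sub: "{a..b} \<subseteq> S" using ab S unfolding is_interval_1 by (meson atLeastAtMost_iff subsetI)
  have u': "abs_cont_deriv_on {a..b} u g"
    by (rule abs_cont_deriv_on_subset[OF u sub])
  have uc: "continuous_on {a..b} u" by (rule abs_cont_deriv_on_continuous[OF u'])
  have fc: "continuous_on X f" for X
    by (rule continuous_at_imp_continuous_on) (simp add: has_vector_derivative_continuous[OF f])
  have f'c: "continuous_on X f'" for X by (rule continuous_on_subset[OF f']) simp
  have g: "g absolutely_integrable_on {x..y}" if "a \<le> x" "x \<le> y" "y \<le> b" for x y
    by (rule abs_cont_deriv_onD(1)[OF u']) (use that in auto)
  have gab: "g absolutely_integrable_on {a..b}" by (rule g[OF order_refl le order_refl])
  have i1: "(\<lambda>x. h (f' x) (u x)) absolutely_integrable_on {a..b}"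
    by (rule absolutely_integrable_continuous_real, rule bounded_bilinear.continuous_on[OF h f'c uc])
  have i2: "(\<lambda>x. h (f x) (g x)) absolutely_integrable_on {a..b}"
    by (rule absolutely_integrable_bilinear_continuous[OF h fc gab])
  note i12 = set_integral_add(1)[OF i1 i2]
  obtain K where K: "K > 0" "\<And>x y. norm (h x y) \<le> norm x * norm y * K"
    using bounded_bilinear.pos_bounded[OF h] by (elim exE conjE) simp
  have "bounded (f' ` {a..b})"
    by (rule compact_imp_bounded[OF compact_continuous_image[OF f'c compact_Icc]])
  then obtain M where M: "M > 0" "\<And>x. x \<in> {a..b} \<Longrightarrow> norm (f' x) \<le> M"
    unfolding bounded_pos by (elim exE conjE) simp
  define D where "D = (\<lambda>x. h (f x) (u x) - integral {a..x} (\<lambda>x. h (f' x) (u x) + h (f x) (g x)))"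
  define G where "G = (\<lambda>x. integral {a..x} (\<lambda>t. norm (g t)))"
  have "D b = D a"
  proof (rule endpoints_equal_if_increments_second_order[OF le, where C="2 * K * M" and G=G])
    fix x y assume x: "a \<le> x" and xy: "x \<le> y" and y: "y \<le> b"
    have sub: "{x..y} \<subseteq> {a..b}" using x y by auto
    have ng: "(\<lambda>t. norm (g t)) integrable_on {s..t}" if "a \<le> s" "s \<le> t" "t \<le> b" for s t
      using absolutely_integrable_norm_integrable[OF g[OF that]] .
    have gi: "g integrable_on {s..t}" if "a \<le> s" "s \<le> t" "t \<le> b" for s t
      using g[OF that] unfolding absolutely_integrable_on_def by blast
    have Gd: "G y - G x = integral {x..y} (\<lambda>t. norm (g t))"
    proof -
      have "integral {a..x} (\<lambda>t. norm (g t)) + integral {x..y} (\<lambda>t. norm (g t)) = integral {a..y} (\<lambda>t. norm (g t))"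
        by (rule Henstock_Kurzweil_Integration.integral_combine[OF x xy ng[OF order_refl order_trans[OF x xy] y]])
      then show ?thesis unfolding G_def by linarith
    qed
    have int: "(\<lambda>x. h (f' x) (u x) + h (f x) (g x)) integrable_on {s..t}" if "a \<le> s" "s \<le> t" "t \<le> b" for s t
    proof -
      have "(\<lambda>x. h (f' x) (u x) + h (f x) (g x)) absolutely_integrable_on {s..t}"
        by (rule absolutely_integrable_on_subinterval[OF i12]) (use that in auto)
      then show ?thesis unfolding absolutely_integrable_on_def by blast
    qed
    have Dd: "D y - D x = h (f y) (u y) - h (f x) (u x) - integral {x..y} (\<lambda>x. h (f' x) (u x) + h (f x) (g x))"
      unfolding D_def
      unfolding Henstock_Kurzweil_Integration.integral_combine[OF x xy int[OF order_refl order_trans[OF x xy] y], symmetric]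
      by simp
    have ud: "u t - u s = integral {s..t} g" if "a \<le> s" "s \<le> t" "t \<le> b" for s t
      by (rule abs_cont_deriv_onD(3)[OF u']) (use that in auto)
    have ub: "norm (u t - u s) \<le> G y - G x" if "x \<le> s" "s \<le> t" "t \<le> y" for s t
    proof -
      have "norm (u t - u s) \<le> integral {s..t} (\<lambda>t. norm (g t))"
        unfolding ud[of s t, OF order_trans[OF x that(1)] that(2) order_trans[OF that(3) y]]
        by (rule integral_norm_bound_integral) (use that x y ng[of s t] gi[of s t] in auto)
      also have "\<dots> \<le> integral {x..y} (\<lambda>t. norm (g t))"
        by (rule integral_subset_le[OF _ ng ng]) (use that x y in auto)
      finally show ?thesis using Gd by simp
    qed
    have FT: "(f' has_integral (f t - f s)) {s..t}" if "s \<le> t" for s t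
      by (rule fundamental_theorem_of_calculus[OF that has_vector_derivative_at_within[OF f]])
    have fb: "norm (f t - f x) \<le> M * (y - x)" if "t \<in> {x..y}" for t
    proof -
      have "norm (f t - f x) \<le> M * (t - x)"
      proof -
        have "norm (f' s) \<le> M" if "s \<in> {x..t} - {}" for s
          using that \<open>t \<in> {x..y}\<close> sub by (intro M(2)) auto
        then have "norm (f t - f x) \<le> M * Henstock_Kurzweil_Integration.content {x..t}"
          by (intro has_integral_bound_real[OF _ _ FT, where S="{}"]) (use that M(1) in auto)
        then show ?thesis using that by simp
      qed
      also have "\<dots> \<le> M * (y - x)" by (rule mult_left_mono) (use that M(1) in auto)
      finally show ?thesis .
    qed
    \<comment> \<open>the increment of the product is \<open>h (f y - f x) (u y) + h (f x) (u y - u x)\<close>\<close>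
    have e1: "h (f y - f x) (u y) = integral {x..y} (\<lambda>t. h (f' t) (u y))"
      using has_integral_linear[OF FT[OF xy] bounded_bilinear.bounded_linear_left[OF h, of "u y"]]
      by (simp add: o_def integral_unique)
    have gu: "(g has_integral (u y - u x)) {x..y}"
      unfolding ud[OF x xy y] by (rule integrable_integral[OF gi[OF x xy y]])
    have e2: "h (f x) (u y - u x) = integral {x..y} (\<lambda>t. h (f x) (g t))"
      using has_integral_linear[OF gu bounded_bilinear.bounded_linear_right[OF h, of "f x"]]
      by (simp add: o_def integral_unique)
    have j1: "(\<lambda>t. h (f' t) (u y)) integrable_on {x..y}"
      by (rule integrable_continuous_real[OF bounded_bilinear.continuous_on[OF h f'c continuous_on_const]])
    have j2: "(\<lambda>t. h (f x) (g t)) integrable_on {x..y}"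
      using has_integral_linear[OF gu bounded_bilinear.bounded_linear_right[OF h, of "f x"]]
      by (auto simp: o_def integrable_on_def)
    have "D y - D x = (h (f y - f x) (u y) + h (f x) (u y - u x)) - integral {x..y} (\<lambda>x. h (f' x) (u x) + h (f x) (g x))"
      unfolding Dd bounded_bilinear.diff_left[OF h] bounded_bilinear.diff_right[OF h] by simp
    also have "\<dots> = integral {x..y} (\<lambda>t. (h (f' t) (u y) + h (f x) (g t)) - (h (f' t) (u t) + h (f t) (g t)))"
      unfolding integral_diff[OF integrable_add[OF j1 j2] int[OF x xy y]] integral_add[OF j1 j2]
      by (rule arg_cong2[where f="(-)", OF arg_cong2[where f="(+)", OF e1 e2] refl])
    also have "\<dots> = integral {x..y} (\<lambda>t. h (f' t) (u y - u t) - h (f t - f x) (g t))"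
      by (intro arg_cong[where f="integral {x..y}"] ext) (simp only: bounded_bilinear.diff_left[OF h] bounded_bilinear.diff_right[OF h], simp)
    also have "norm \<dots> \<le> integral {x..y} (\<lambda>t. M * (G y - G x) * K + M * (y - x) * K * norm (g t))"
    proof (rule integral_norm_bound_integral)
      have "(\<lambda>t. (h (f' t) (u y) + h (f x) (g t)) - (h (f' t) (u t) + h (f t) (g t))) integrable_on {x..y}"
        by (rule integrable_diff[OF integrable_add[OF j1 j2] int[OF x xy y]])
      moreover have "(h (f' t) (u y) + h (f x) (g t)) - (h (f' t) (u t) + h (f t) (g t)) = h (f' t) (u y - u t) - h (f t - f x) (g t)" for t
        by (simp only: bounded_bilinear.diff_left[OF h] bounded_bilinear.diff_right[OF h], simp)
      ultimately show "(\<lambda>t. h (f' t) (u y - u t) - h (f t - f x) (g t)) integrable_on {x..y}"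
        by simp
      show "(\<lambda>t. M * (G y - G x) * K + M * (y - x) * K * norm (g t)) integrable_on {x..y}"
        by (rule integrable_add[OF integrable_const_ivl integrable_on_mult_right[OF ng[OF x xy y]]])
      fix t assume t: "t \<in> {x..y}"
      have "norm (h (f' t) (u y - u t)) \<le> M * (G y - G x) * K"
      proof -
        have "norm (f' t) * norm (u y - u t) * K \<le> M * (G y - G x) * K"
          using M(2)[of t] ub[of t y] t sub K(1) M(1) by (intro mult_right_mono mult_mono) auto
        then show ?thesis using K(2)[of "f' t" "u y - u t"] by linarith
      qed
      moreover have "norm (h (f t - f x) (g t)) \<le> M * (y - x) * K * norm (g t)"
      proof -
        have "norm (f t - f x) * norm (g t) * K \<le> (M * (y - x)) * norm (g t) * K"
          using fb[OF t] K(1) by (intro mult_right_mono) auto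
        then show ?thesis using K(2)[of "f t - f x" "g t"] by (simp add: mult_ac)
      qed
      ultimately show "norm (h (f' t) (u y - u t) - h (f t - f x) (g t)) \<le> M * (G y - G x) * K + M * (y - x) * K * norm (g t)"
        using norm_triangle_ineq4[of "h (f' t) (u y - u t)" "h (f t - f x) (g t)"] by linarith
    qed
    also have "\<dots> = M * (G y - G x) * K * (y - x) + M * (y - x) * K * (G y - G x)"
      unfolding integral_add[OF integrable_const_ivl integrable_on_mult_right[OF ng[OF x xy y]]] Gd
      using xy by simp
    finally show "norm (D y - D x) \<le> 2 * K * M * (y - x) * (G y - G x)"
      by (simp add: algebra_simps)
  qed
  then have "h (f b) (u b) - h (f a) (u a) = integral {a..b} (\<lambda>x. h (f' x) (u x) + h (f x) (g x))"
    unfolding D_def by (simp add: algebra_simps)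
  with i12 show "(\<lambda>x. h (f' x) (u x) + h (f x) (g x)) absolutely_integrable_on {a..b} \<and>
       h (f b) (u b) - h (f a) (u a) = integral {a..b} (\<lambda>x. h (f' x) (u x) + h (f x) (g x))" by blast
qed

section \<open>Quasi-periodic functions\<close>

lemma norm_smult_vec: "norm (c *s v) = norm c * norm (v :: complex^'n)"
  by (simp add: norm_vec_def L2_set_def norm_mult power_mult_distrib real_sqrt_mult flip: sum_distrib_left)

lemma bounded_bilinear_smult_vec: "bounded_bilinear (\<lambda>c (v :: complex^'n). c *s v)"
proof
  fix c c' :: complex and v w :: "complex^'n" and r :: real
  show "(c + c') *s v = c *s v + c' *s v" by (rule vector_sadd_rdistrib)
  show "c *s (v + w) = c *s v + c *s w" by (rule vector_add_ldistrib)
  show "(r *\<^sub>R c) *s v = r *\<^sub>R (c *s v)" "c *s (r *\<^sub>R v) = r *\<^sub>R (c *s v)"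
    by (simp_all add: vec_eq_iff)
  show "\<exists>K. \<forall>c (v :: complex^'n). norm (c *s v) \<le> norm c * norm v * K"
    by (rule exI[of _ 1]) (simp add: norm_smult_vec)
qed

lemmas bounded_linear_smult_vec = bounded_bilinear.bounded_linear_right[OF bounded_bilinear_smult_vec]

lemma AE_lebesgue_translate:
  fixes c :: "'a::euclidean_space"
  assumes "AE x in lebesgue. P x"
  shows "AE x in lebesgue. P (x + c)"
proof -
  obtain N where N: "negligible N" "{x. \<not> P x} \<subseteq> N"
    using assms unfolding eventually_ae_filter_negligible by blast
  have "{x. \<not> P (x + c)} \<subseteq> (+) (- c) ` N"
  proof
    fix x assume "x \<in> {x. \<not> P (x + c)}"
    then have "x + c \<in> N" using N by blast
    then show "x \<in> (+) (- c) ` N" by (rule rev_image_eqI) simp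
  qed
  then show ?thesis
    unfolding eventually_ae_filter_negligible using negligible_translation[OF N(1)] by blast
qed

lemma AE_periodic_int:
  fixes f :: "real \<Rightarrow> 'a"
  assumes "AE x in lebesgue. f (x + p) = f x"
  shows "AE x in lebesgue. \<forall>k::int. f (x + of_int k * p) = f x"
proof -
  have nat: "AE x in lebesgue. f (x + real n * p) = f x" for n
  proof (induction n)
    case (Suc n)
    from Suc AE_lebesgue_translate[OF assms, of "real n * p"]
    show ?case by eventually_elim (simp add: algebra_simps)
  qed simp
  have "AE x in lebesgue. f (x + of_int k * p) = f x" for k :: int
  proof (cases "k \<ge> 0")
    case True
    then show ?thesis using nat[of "nat k"] by simp
  next
    case False
    have "AE x in lebesgue. f (x + of_int k * p + real (nat (- k)) * p) = f (x + of_int k * p)"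
      by (rule AE_lebesgue_translate[OF nat[of "nat (- k)"]])
    moreover have "x + of_int k * p + real (nat (- k)) * p = x" for x
      using False by (simp add: algebra_simps)
    ultimately have "AE x in lebesgue. f x = f (x + of_int k * p)" by simp
    then show ?thesis by eventually_elim (rule sym)
  qed
  then show ?thesis by (simp add: AE_all_countable)
qed

definition quasi_periodic :: "real \<Rightarrow> complex \<Rightarrow> (real \<Rightarrow> complex^'n) \<Rightarrow> bool" where
  "quasi_periodic p z f \<longleftrightarrow> (\<forall>x. f (x + p) = z *s f x)"

lemma quasi_periodic_minus:
  assumes "quasi_periodic p z f" "z \<noteq> 0"
  shows "quasi_periodic (- p) (inverse z) f"
  unfolding quasi_periodic_def
proof
  fix x
  have "f x = z *s f (x - p)"
    using assms(1) unfolding quasi_periodic_def by (metis diff_add_cancel)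
  then show "f (x + - p) = inverse z *s f x" using assms(2) by (simp add: vector_smult_assoc)
qed

lemma abs_cont_deriv_on_shift:
  fixes f g :: "real \<Rightarrow> complex^'n"
  assumes "abs_cont_deriv_on {a..b} f g" "quasi_periodic p z f" "quasi_periodic p z g"
  shows "abs_cont_deriv_on {a + p..b + p} f g"
  unfolding abs_cont_deriv_on_def
proof (intro ballI impI)
  fix x y assume xy: "x \<in> {a + p..b + p}" "y \<in> {a + p..b + p}" "x \<le> y"
  have g: "g absolutely_integrable_on {x - p..y - p}" and fg: "f (y - p) - f (x - p) = integral {x - p..y - p} g"
    using abs_cont_deriv_onD[OF assms(1), of "x - p" "y - p"] xy by auto
  have gi: "g integrable_on {x - p..y - p}" "(\<lambda>t. norm (g t)) integrable_on {x - p..y - p}"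
    using g unfolding absolutely_integrable_on_def by blast+
  have gs: "g \<circ> (+) p = (\<lambda>t. z *s g t)"
    using assms(3) by (simp add: quasi_periodic_def fun_eq_iff add.commute)
  have "(g has_integral z *s integral {x - p..y - p} g) {x..y}"
    using has_integral_linear[OF integrable_integral[OF gi(1)] bounded_linear_smult_vec[of z]]
      has_integral_shift_Icc_real[of g p _ "x - p" "y - p"] gs by (simp add: o_def)
  then have 1: "g integrable_on {x..y}" "integral {x..y} g = z *s integral {x - p..y - p} g"
    by (simp_all add: has_integral_iff)
  have "((\<lambda>t. norm (g t)) \<circ> (+) p) = (\<lambda>t. norm z * norm (g t))"
    using gs by (simp add: fun_eq_iff norm_smult_vec)
  then have "((\<lambda>t. norm (g t)) has_integral norm z * integral {x - p..y - p} (\<lambda>t. norm (g t))) {x..y}"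
    using has_integral_mult_right[OF integrable_integral[OF gi(2)], of "norm z"]
      has_integral_shift_Icc_real[of "\<lambda>t. norm (g t)" p _ "x - p" "y - p"] by simp
  then have 2: "(\<lambda>t. norm (g t)) integrable_on {x..y}" by (auto simp: integrable_on_def)
  have "f y - f x = z *s (f (y - p) - f (x - p))"
    using assms(2) unfolding quasi_periodic_def
    by (metis diff_add_cancel vector_ssub_ldistrib)
  then show "g absolutely_integrable_on {x..y} \<and> f y - f x = integral {x..y} g"
    using 1 2 fg unfolding absolutely_integrable_on_def by simp
qed

lemma abs_cont_deriv_on_combine:
  assumes "abs_cont_deriv_on {a..b} f g" "abs_cont_deriv_on {b..c} f g" "a \<le> b" "b \<le> c"
  shows "abs_cont_deriv_on {a..c} f g"
proof (rule abs_cont_deriv_onI)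
  have 1: "g absolutely_integrable_on {a..b}" "g absolutely_integrable_on {b..c}"
    using abs_cont_deriv_onD(1)[OF assms(1)] abs_cont_deriv_onD(1)[OF assms(2)] assms(3,4) by auto
  show ac: "g absolutely_integrable_on {a..c}"
    by (rule absolutely_integrable_on_combine[OF 1 assms(3,4)])
  fix x assume x: "x \<in> {a..c}"
  show "f x = f a + integral {a..x} g"
  proof (cases "x \<le> b")
    case True
    then have "f x - f a = integral {a..x} g" using abs_cont_deriv_onD(3)[OF assms(1), of a x] x assms(3) by auto
    then show ?thesis by (simp add: algebra_simps)
  next
    case False
    have a: "f b - f a = integral {a..b} g" using abs_cont_deriv_onD(3)[OF assms(1), of a b] assms(3) by auto
    have b: "f x - f b = integral {b..x} g" using abs_cont_deriv_onD(3)[OF assms(2), of b x] False x by auto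
    have "g absolutely_integrable_on {a..x}"
      by (rule absolutely_integrable_on_subinterval[OF ac]) (use x in auto)
    then have "g integrable_on {a..x}" unfolding absolutely_integrable_on_def by blast
    then have "integral {a..b} g + integral {b..x} g = integral {a..x} g"
      using assms(3) False by (intro Henstock_Kurzweil_Integration.integral_combine) auto
    then show ?thesis unfolding a[symmetric] b[symmetric] by (simp add: algebra_simps)
  qed
qed

text \<open>One period determines everything: the relation is translated to each period and the pieces are glued
together.\<close>

lemma quasi_periodic_loc_abs_cont_deriv:
  fixes f g :: "real \<Rightarrow> complex^'n"
  assumes fg: "abs_cont_deriv_on {0..p} f g" and q: "quasi_periodic p z f" "quasi_periodic p z g"
    and p: "p > 0" and z: "z \<noteq> 0"
  shows "loc_abs_cont_deriv f g"
proof -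
  have up: "abs_cont_deriv_on {real n * p..real (Suc n) * p} f g" for n
  proof (induction n)
    case (Suc n)
    show ?case using abs_cont_deriv_on_shift[OF Suc q] by (simp add: algebra_simps)
  qed (use fg in simp)
  have down: "abs_cont_deriv_on {- real (Suc n) * p..- real n * p} f g" for n
  proof (induction n)
    case 0
    show ?case using abs_cont_deriv_on_shift[OF fg quasi_periodic_minus[OF q(1) z] quasi_periodic_minus[OF q(2) z]] by simp
  next
    case (Suc n)
    have "- real (Suc n) * p + - p = - real (Suc (Suc n)) * p" "- real n * p + - p = - real (Suc n) * p"
      unfolding of_nat_Suc by algebra+
    then show ?case
      using abs_cont_deriv_on_shift[OF Suc quasi_periodic_minus[OF q(1) z] quasi_periodic_minus[OF q(2) z]] by metis
  qed
  have all: "abs_cont_deriv_on {- real n * p..real n * p} f g" for n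
  proof (induction n)
    case 0
    show ?case
      by (rule abs_cont_deriv_onI) (simp_all add: absolutely_integrable_negligible[OF negligible_sing])
  next
    case (Suc n)
    have "abs_cont_deriv_on {- real n * p..real (Suc n) * p} f g"
      by (rule abs_cont_deriv_on_combine[OF Suc up]) (use p in \<open>auto intro: mult_right_mono order_trans[of _ 0]\<close>)
    then show ?case
      by (rule abs_cont_deriv_on_combine[OF down]) (use p in \<open>auto simp: algebra_simps\<close>)
  qed
  show ?thesis
    unfolding loc_abs_cont_deriv_def
  proof (intro allI impI)
    fix a b :: real assume ab: "a \<le> b"
    obtain n where n: "max \<bar>a\<bar> \<bar>b\<bar> / p \<le> real n" using real_arch_simple by blast
    then have "\<bar>a\<bar> \<le> real n * p" "\<bar>b\<bar> \<le> real n * p" using p by (simp_all add: field_simps)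
    then have "a \<in> {- real n * p..real n * p}" "b \<in> {- real n * p..real n * p}" by auto
    then show "g absolutely_integrable_on {a..b} \<and> f b - f a = integral {a..b} g"
      using abs_cont_deriv_onD[OF all _ _ ab] by blast
  qed
qed

text \<open>Continuing from the half-open period \<open>[0, p)\<close> makes the extension quasi-periodic for every \<open>f\<close>; it agrees with \<open>f\<close>
at \<open>p\<close> if \<open>f\<close> satisfies the boundary condition.\<close>

definition quasi_periodic_ext :: "real \<Rightarrow> complex \<Rightarrow> (real \<Rightarrow> complex^'n) \<Rightarrow> real \<Rightarrow> complex^'n" where
  "quasi_periodic_ext p z f x = (z powi \<lfloor>x / p\<rfloor>) *s f (x - of_int \<lfloor>x / p\<rfloor> * p)"

lemma floor_frac_period:
  fixes p :: real assumes "p > 0"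
  shows "x - of_int \<lfloor>x / p\<rfloor> * p \<in> {0..p}" "x - of_int \<lfloor>x / p\<rfloor> * p < p"
proof -
  have "of_int \<lfloor>x / p\<rfloor> \<le> x / p" "x / p < of_int \<lfloor>x / p\<rfloor> + 1" by linarith+
  then show "x - of_int \<lfloor>x / p\<rfloor> * p \<in> {0..p}" "x - of_int \<lfloor>x / p\<rfloor> * p < p"
    using assms unfolding pos_le_divide_eq[OF assms] pos_divide_less_eq[OF assms]
    by (auto simp: algebra_simps)
qed

lemma quasi_periodic_quasi_periodic_ext:
  assumes "p > 0" "z \<noteq> 0"
  shows "quasi_periodic p z (quasi_periodic_ext p z f)"
  unfolding quasi_periodic_def
proof
  fix x
  have "\<lfloor>(x + p) / p\<rfloor> = \<lfloor>x / p\<rfloor> + 1" using assms by (simp add: add_divide_distrib)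
  moreover have "x + p - of_int (k + 1) * p = x - of_int k * p" for k :: int
    by (simp add: distrib_right)
  ultimately show "quasi_periodic_ext p z f (x + p) = z *s quasi_periodic_ext p z f x"
    unfolding quasi_periodic_ext_def using assms(2)
    by (simp only: power_int_add_1' vector_smult_assoc simp_thms)
qed

lemma quasi_periodic_ext_eq:
  assumes "0 \<le> x" "x < p"
  shows "quasi_periodic_ext p z f x = f x"
proof -
  have "\<lfloor>x / p\<rfloor> = 0" using assms by (simp add: floor_eq_iff)
  then show ?thesis by (simp add: quasi_periodic_ext_def)
qed

lemma quasi_periodic_ext_eq_closed:
  assumes "p > 0" "f p = z *s f 0" "x \<in> {0..p}"
  shows "quasi_periodic_ext p z f x = f x"
proof (cases "x = p")
  case True
  then show ?thesis using assms by (simp add: quasi_periodic_ext_def)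
qed (use assms quasi_periodic_ext_eq[of x p z f] in auto)

lemma norm_quasi_periodic_ext:
  assumes "norm z = 1"
  shows "norm (quasi_periodic_ext p z f x) = norm (f (x - of_int \<lfloor>x / p\<rfloor> * p))"
  using assms by (simp add: quasi_periodic_ext_def norm_smult_vec norm_power_int)

lemma loc_abs_cont_deriv_quasi_periodic_ext:
  assumes fg: "abs_cont_deriv_on {0..p} f g" and p: "p > 0" and z: "z \<noteq> 0" and f: "f p = z *s f 0"
  shows "loc_abs_cont_deriv (quasi_periodic_ext p z f) (quasi_periodic_ext p z g)"
proof (rule quasi_periodic_loc_abs_cont_deriv[OF _ quasi_periodic_quasi_periodic_ext[OF p z] quasi_periodic_quasi_periodic_ext[OF p z] p z])
  show "abs_cont_deriv_on {0..p} (quasi_periodic_ext p z f) (quasi_periodic_ext p z g)"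
    unfolding abs_cont_deriv_on_def
  proof (intro ballI impI)
    fix a b assume ab: "a \<in> {0..p}" "b \<in> {0..p}" "a \<le> b"
    have *: "quasi_periodic_ext p z g x = g x" if "x \<in> {a..b} - {p}" for x
      using that ab by (intro quasi_periodic_ext_eq) auto
    note D = abs_cont_deriv_onD[OF fg ab]
    have "quasi_periodic_ext p z g absolutely_integrable_on {a..b}"
      by (rule absolutely_integrable_spike[OF D(1) negligible_sing *])
    moreover have "integral {a..b} g = integral {a..b} (quasi_periodic_ext p z g)"
      by (rule integral_spike[OF negligible_sing *])
    ultimately show "quasi_periodic_ext p z g absolutely_integrable_on {a..b} \<and>
      quasi_periodic_ext p z f b - quasi_periodic_ext p z f a = integral {a..b} (quasi_periodic_ext p z g)"
      unfolding quasi_periodic_ext_eq_closed[OF p f ab(1)] quasi_periodic_ext_eq_closed[OF p f ab(2)] using D(3) by simp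
  qed
qed

section \<open>Bounded solutions and the spectrum on the line\<close>

text \<open>This is the profile of the cutoff functions below.\<close>

lemma integrable_inverse_one_plus_square: "integrable lebesgue (\<lambda>x::real. inverse (1 + x\<^sup>2))"
proof -
  have "integrable lborel (\<lambda>x::real. inverse (1 + x\<^sup>2))"
    using integrable_inverse_1_plus_square by (simp add: set_integrable_def)
  then show ?thesis by (intro integrable_completion[THEN iffD2]) simp_all
qed

text \<open>Weyl's criterion. For the cutoff \<open>\<phi>(x) = 1 / (1 + (x/N)\<^sup>2)\<close> both derivatives are
\<open>O(\<phi>/N)\<close>, so \<open>\<phi> y\<close> solves the equation up to an error of squared norm \<open>O(1/N)\<close>,
whereas its own squared norm grows at least like \<open>N\<close> because \<open>\<bar>y\<bar>\<close> is periodic. This is impossible if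
the resolvent is bounded.\<close>

lemma bounded_solution_in_spectrum:
  fixes Q :: "real \<Rightarrow> complex^'m^'m" and y y1 y2 :: "real \<Rightarrow> complex^'m" and l :: complex
  assumes y: "loc_abs_cont_deriv y y1" "loc_abs_cont_deriv y1 y2"
    and eq: "AE x in lebesgue. y2 x = Q x *v y x - l *s y x"
    and bd: "\<And>x. norm (y x) \<le> Y0" "\<And>x. norm (y1 x) \<le> Y1"
    and per: "\<And>x. norm (y (x + p)) = norm (y x)" and p: "p > 0"
    and nz: "\<exists>x\<in>{0..p}. y x \<noteq> 0"
  shows "l \<in> schroedinger_spectrum Q"
proof (rule ccontr)
  assume "l \<notin> schroedinger_spectrum Q"
  then obtain C where "\<And>u f. (u, f) \<in> schroedinger_graph Q \<Longrightarrow>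
      L2_norm lebesgue u \<le> C * L2_norm lebesgue (\<lambda>x. f x - l *s u x)"
    unfolding schroedinger_spectrum_def L2_spectrum_def L2_resolvent_set_def by fastforce
  note C = this
  have Y: "Y0 \<ge> 0" "Y1 \<ge> 0" using bd norm_ge_zero order_trans by blast+
  have cont: "continuous_on UNIV f" if "loc_abs_cont_deriv f g" for f g :: "real \<Rightarrow> complex^'m"
  proof -
    have "isCont f x" for x
    proof -
      have "continuous_on {x-1..x+1} f"
        using that abs_cont_deriv_on_continuous abs_cont_deriv_on_subset[of UNIV f g "{x-1..x+1}"]
        unfolding loc_abs_cont_deriv_iff by blast
      then show ?thesis by (rule continuous_on_interior) simp
    qed
    then show ?thesis by (simp add: continuous_at_imp_continuous_on)
  qed
  note yc = cont[OF y(1)] cont[OF y(2)]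
  define I where "I = integral {0..p} (\<lambda>x. (norm (y x))\<^sup>2)"
  have n2c: "continuous_on S (\<lambda>x. (norm (y x))\<^sup>2)" for S
    by (intro continuous_intros continuous_on_subset[OF yc(1)]) auto
  have I: "I > 0"
  proof -
    have "I \<noteq> 0" unfolding I_def using integral_eq_0_iff[OF n2c p] nz by auto
    moreover have "I \<ge> 0" unfolding I_def by (rule integral_nonneg[OF integrable_continuous_real[OF n2c]]) auto
    ultimately show ?thesis by linarith
  qed
  have In: "integral {0..real n * p} (\<lambda>x. (norm (y x))\<^sup>2) = real n * I" for n
  proof (induction n)
    case (Suc n)
    have pern: "norm (y (x + real n * p)) = norm (y x)" for n x
    proof (induction n)
      case (Suc n)
      have "x + real (Suc n) * p = (x + real n * p) + p" by (simp add: distrib_right)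
      then show ?case using Suc per by metis
    qed simp
    have "integral {0..real (Suc n) * p} (\<lambda>x. (norm (y x))\<^sup>2) = integral {0..real n * p} (\<lambda>x. (norm (y x))\<^sup>2)
      + integral {real n * p..real (Suc n) * p} (\<lambda>x. (norm (y x))\<^sup>2)"
      by (rule Henstock_Kurzweil_Integration.integral_combine[symmetric])
        (use p in \<open>auto intro!: integrable_continuous_real n2c mult_right_mono\<close>)
    also have "integral {real n * p..real (Suc n) * p} (\<lambda>x. (norm (y x))\<^sup>2) = I"
      unfolding I_def using integral_shift_Icc_real[of 0 p "\<lambda>x. (norm (y x))\<^sup>2" "real n * p"]
      by (simp add: o_def pern add.commute distrib_right)
    finally show ?case using Suc by (simp add: distrib_right)
  qed simp
  define J where "J = integral\<^sup>L lebesgue (\<lambda>x::real. inverse (1 + x\<^sup>2))"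
  define c0 where "c0 = (inverse (1 + p\<^sup>2))\<^sup>2"
  have "1 + p\<^sup>2 > 0" by (simp add: add_pos_nonneg)
  then have c0: "c0 > 0" unfolding c0_def by (intro zero_less_power) simp
  define D where "D = 2 * Y1 + 4 * Y0"
  have main: "c0 * real N * I \<le> C\<^sup>2 * (D\<^sup>2 * J) / real N" if N: "N > 0" for N :: nat
  proof -
    \<comment> \<open>\<open>ph\<close> is the cutoff, \<open>ph1\<close> and \<open>ph2\<close> are its derivatives\<close>
    define e where "e = inverse (real N)"
    have e: "e > 0" "e \<le> 1" using N by (auto simp: e_def field_simps)
    define ph where "ph = (\<lambda>x. inverse (1 + (e * x)\<^sup>2))"
    define ph1 where "ph1 = (\<lambda>x. - (2 * e\<^sup>2 * x) * (ph x)\<^sup>2)"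
    define ph2 where "ph2 = (\<lambda>x. - (2 * e\<^sup>2) * (ph x)\<^sup>2 - (2 * e\<^sup>2 * x) * (2 * ph x * ph1 x))"
    have pos: "1 + (e * x)\<^sup>2 > 0" for x by (simp add: add_pos_nonneg)
    have ph0: "0 < ph x" "ph x \<le> 1" for x using pos[of x] by (auto simp: ph_def field_simps)
    have d1: "(ph has_real_derivative ph1 x) (at x)" for x
    proof -
      have "((\<lambda>x. 1 + (e * x)\<^sup>2) has_real_derivative 2 * e\<^sup>2 * x) (at x)"
        by (auto intro!: derivative_eq_intros simp: power2_eq_square)
      from DERIV_inverse_fun[OF this] pos[of x]
      show ?thesis unfolding ph_def ph1_def by (simp add: power2_eq_square)
    qed
    have d2: "(ph1 has_real_derivative ph2 x) (at x)" for x
    proof -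
      have "((\<lambda>x. - (2 * e\<^sup>2 * x)) has_real_derivative - (2 * e\<^sup>2)) (at x)"
        by (auto intro!: derivative_eq_intros)
      from DERIV_mult[OF this DERIV_power[OF d1, of 2]]
      show ?thesis unfolding ph1_def[abs_def] ph2_def by (simp add: ph1_def algebra_simps)
    qed
    have phc: "continuous_on S ph" for S
      by (rule continuous_at_imp_continuous_on) (simp add: DERIV_isCont[OF d1])
    have ph1c: "continuous_on S ph1" for S
      by (rule continuous_at_imp_continuous_on) (simp add: DERIV_isCont[OF d2])
    have ph2c: "continuous_on S ph2" for S
      unfolding ph2_def by (intro continuous_intros phc ph1c)
    have ex: "2 * \<bar>e * x\<bar> * ph x \<le> 1" for x
    proof -
      have "2 * \<bar>e * x\<bar> \<le> 1 + (e * x)\<^sup>2" using zero_le_power2[of "\<bar>e * x\<bar> - 1"] by (simp add: power2_diff)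
      then show ?thesis using pos[of x] unfolding ph_def by (simp add: field_simps)
    qed
    have b1: "\<bar>ph1 x\<bar> \<le> e * ph x" for x
    proof -
      have "\<bar>ph1 x\<bar> = e * ph x * (2 * \<bar>e * x\<bar> * ph x)"
        using ph0[of x] e by (simp add: ph1_def abs_mult power2_eq_square)
      also have "\<dots> \<le> e * ph x * 1" using ex[of x] ph0[of x] e by (intro mult_left_mono) auto
      finally show ?thesis by simp
    qed
    have b2: "\<bar>ph2 x\<bar> \<le> 4 * e * ph x" for x
    proof -
      have "\<bar>ph2 x\<bar> \<le> 2 * e\<^sup>2 * (ph x)\<^sup>2 + 2 * e * (2 * \<bar>e * x\<bar> * ph x) * \<bar>ph1 x\<bar>"
        unfolding ph2_def using ph0[of x] e
        by (intro order_trans[OF abs_triangle_ineq4]) (simp add: abs_mult power2_eq_square)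
      also have "\<dots> \<le> 2 * e\<^sup>2 * (ph x)\<^sup>2 + 2 * e * 1 * (e * ph x)"
        using ex[of x] b1[of x] ph0[of x] e by (intro add_left_mono mult_mono mult_left_mono) auto
      also have "\<dots> \<le> 2 * e * ph x + 2 * e * ph x"
      proof (rule add_mono)
        have "e\<^sup>2 \<le> e" "(ph x)\<^sup>2 \<le> ph x" using e ph0[of x] by (simp_all add: power2_eq_square mult_left_le)
        then show "2 * e\<^sup>2 * (ph x)\<^sup>2 \<le> 2 * e * ph x" using e ph0[of x] by (intro mult_mono) auto
        have "e * e \<le> e * 1" using e by (intro mult_left_mono) auto
        then have "e * e * ph x \<le> e * ph x" using ph0[of x] by (intro mult_right_mono) auto
        then show "2 * e * 1 * (e * ph x) \<le> 2 * e * ph x" by (simp add: algebra_simps)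
      qed
      finally show ?thesis by simp
    qed
    \<comment> \<open>\<open>w\<close> is the commutator term: no derivative of \<open>y1\<close> occurs in it, so \<open>f\<close> is continuous\<close>
    define u where "u = (\<lambda>x. ph x *\<^sub>R y x)"
    define w where "w = (\<lambda>x. - (2 * ph1 x) *\<^sub>R y1 x - ph2 x *\<^sub>R y x)"
    define f where "f = (\<lambda>x. l *s u x + w x)"
    have uc: "continuous_on UNIV u" unfolding u_def by (intro continuous_intros phc yc)
    have wc: "continuous_on UNIV w" unfolding w_def by (intro continuous_intros phc ph1c ph2c yc)
    have fc: "continuous_on UNIV f" unfolding f_def
      by (rule continuous_on_add[OF bounded_linear.continuous_on[OF bounded_linear_smult_vec uc] wc])
    have meas: "g \<in> borel_measurable lebesgue" if "continuous_on UNIV g" for g :: "real \<Rightarrow> complex^'m"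
      by (rule measurable_completion) (simp add: borel_measurable_continuous_onI[OF that])
    have iph: "integrable lebesgue ph"
      unfolding ph_def
      using lebesgue_integrable_real_affine_iff[of e "\<lambda>x. inverse (1 + x\<^sup>2)" 0] integrable_inverse_one_plus_square e
      by simp
    have phJ: "(\<integral>x. ph x \<partial>lebesgue) = real N * J"
      using lebesgue_integral_real_affine[of e "\<lambda>x. inverse (1 + x\<^sup>2)" 0] e N
      unfolding ph_def[symmetric] J_def[symmetric] by (simp add: e_def ph_def field_simps)
    have un: "norm (u x) \<le> Y0 * ph x" for x
      using ph0[of x] bd(1)[of x] by (simp add: u_def mult.commute mult_left_mono)
    have wn: "norm (w x) \<le> D * e * ph x" for x
    proof -
      have "norm (w x) \<le> 2 * \<bar>ph1 x\<bar> * norm (y1 x) + \<bar>ph2 x\<bar> * norm (y x)"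
        unfolding w_def by (rule order_trans[OF norm_triangle_ineq4]) (simp add: abs_mult)
      also have "\<dots> \<le> 2 * (e * ph x) * Y1 + (4 * e * ph x) * Y0"
        using b1[of x] b2[of x] bd[of x] e ph0[of x] Y by (intro add_mono mult_mono) auto
      finally show ?thesis by (simp add: D_def algebra_simps)
    qed
    have L2: "g \<in> L2_space lebesgue" "(\<integral>x. (norm (g x))\<^sup>2 \<partial>lebesgue) \<le> K\<^sup>2 * (real N * J)"
      if g: "continuous_on UNIV g" and b: "\<And>x. norm (g x) \<le> K * ph x" for g :: "real \<Rightarrow> complex^'m" and K
    proof -
      have sq: "(norm (g x))\<^sup>2 \<le> K\<^sup>2 * ph x" for x
      proof -
        have "(norm (g x))\<^sup>2 \<le> (K * ph x)\<^sup>2" using b[of x] by (intro power_mono) auto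
        also have "\<dots> = K\<^sup>2 * (ph x * ph x)" by (simp add: power2_eq_square mult_ac)
        also have "\<dots> \<le> K\<^sup>2 * ph x" using ph0[of x] by (intro mult_left_mono) (auto simp: mult_left_le)
        finally show ?thesis .
      qed
      have int: "integrable lebesgue (\<lambda>x. (norm (g x))\<^sup>2)"
        by (rule Bochner_Integration.integrable_bound[OF integrable_mult_right[OF iph, of "K\<^sup>2"]])
           (use sq ph0 meas[OF g] in \<open>auto simp: less_imp_le\<close>)
      then show "g \<in> L2_space lebesgue" using meas[OF g] by (simp add: L2_space_def)
      have "(\<integral>x. (norm (g x))\<^sup>2 \<partial>lebesgue) \<le> (\<integral>x. K\<^sup>2 * ph x \<partial>lebesgue)"
        by (rule integral_mono[OF int integrable_mult_right[OF iph]]) (rule sq)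
      then show "(\<integral>x. (norm (g x))\<^sup>2 \<partial>lebesgue) \<le> K\<^sup>2 * (real N * J)" by (simp add: phJ)
    qed
    have fn: "norm (f x) \<le> (norm l * Y0 + D * e) * ph x" for x
    proof -
      have "norm (f x) \<le> norm l * norm (u x) + norm (w x)"
        unfolding f_def by (rule order_trans[OF norm_triangle_ineq]) (simp add: norm_smult_vec)
      also have "\<dots> \<le> norm l * (Y0 * ph x) + D * e * ph x"
        using un[of x] wn[of x] by (intro add_mono mult_left_mono) auto
      finally show ?thesis by (simp add: algebra_simps)
    qed
    note B = bounded_bilinear_scaleR[where 'a="complex^'m"]
    have v1: "(ph has_vector_derivative ph1 x) (at x)" "(ph1 has_vector_derivative ph2 x) (at x)" for x
      using d1 d2 by (simp_all add: has_real_derivative_iff_has_vector_derivative)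
    have U: "abs_cont_deriv_on UNIV u (\<lambda>x. ph1 x *\<^sub>R y x + ph x *\<^sub>R y1 x)"
      unfolding u_def using y(1) unfolding loc_abs_cont_deriv_iff
      by (intro abs_cont_deriv_on_bilinear[OF B v1(1) ph1c]) auto
    have U1: "abs_cont_deriv_on UNIV (\<lambda>x. ph1 x *\<^sub>R y x + ph x *\<^sub>R y1 x)
       (\<lambda>x. (ph2 x *\<^sub>R y x + ph1 x *\<^sub>R y1 x) + (ph1 x *\<^sub>R y1 x + ph x *\<^sub>R y2 x))"
    proof -
      have a: "abs_cont_deriv_on UNIV (\<lambda>x. ph1 x *\<^sub>R y x) (\<lambda>x. ph2 x *\<^sub>R y x + ph1 x *\<^sub>R y1 x)"
        using y(1) unfolding loc_abs_cont_deriv_iff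
        by (intro abs_cont_deriv_on_bilinear[OF B v1(2) ph2c]) auto
      have b: "abs_cont_deriv_on UNIV (\<lambda>x. ph x *\<^sub>R y1 x) (\<lambda>x. ph1 x *\<^sub>R y1 x + ph x *\<^sub>R y2 x)"
        using y(2) unfolding loc_abs_cont_deriv_iff
        by (intro abs_cont_deriv_on_bilinear[OF B v1(1) ph1c]) auto
      show ?thesis by (rule abs_cont_deriv_on_add[OF a b])
    qed
    have "AE x in lebesgue. f x = - ((ph2 x *\<^sub>R y x + ph1 x *\<^sub>R y1 x) + (ph1 x *\<^sub>R y1 x + ph x *\<^sub>R y2 x)) + Q x *v u x"
      using eq
    proof eventually_elim
      case (elim x)
      have "Q x *v u x = ph x *\<^sub>R (Q x *v y x)"
        by (simp add: u_def vec_eq_iff matrix_vector_mult_def scaleR_sum_right)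
      moreover have "l *s u x = ph x *\<^sub>R (l *s y x)" by (simp add: u_def vec_eq_iff)
      moreover have "- (2 * ph1 x) *\<^sub>R y1 x = - (ph1 x *\<^sub>R y1 x) - ph1 x *\<^sub>R y1 x"
        by (simp add: vec_eq_iff scaleR_conv_of_real)
      ultimately show ?case unfolding f_def w_def elim
        by (simp only: scaleR_right_diff_distrib) simp
    qed
    then have "(u, f) \<in> schroedinger_graph Q"
      unfolding schroedinger_graph_def
      using L2(1)[OF uc un] L2(1)[OF fc fn] U U1 unfolding loc_abs_cont_deriv_iff by blast
    from C[OF this] have "L2_norm lebesgue u \<le> C * L2_norm lebesgue w"
      by (simp add: f_def)
    then have "(L2_norm lebesgue u)\<^sup>2 \<le> (C * L2_norm lebesgue w)\<^sup>2"
      by (intro power_mono) (simp_all add: L2_norm_def)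
    then have "(\<integral>x. (norm (u x))\<^sup>2 \<partial>lebesgue) \<le> C\<^sup>2 * (\<integral>x. (norm (w x))\<^sup>2 \<partial>lebesgue)"
      by (simp add: L2_norm_def power_mult_distrib)
    also have "\<dots> \<le> C\<^sup>2 * ((D * e)\<^sup>2 * (real N * J))"
      by (intro mult_left_mono L2(2)[OF wc wn]) auto
    also have "\<dots> = C\<^sup>2 * (D\<^sup>2 * J) / real N" using N by (simp add: e_def power2_eq_square field_simps)
    finally have upper: "(\<integral>x. (norm (u x))\<^sup>2 \<partial>lebesgue) \<le> C\<^sup>2 * (D\<^sup>2 * J) / real N" .
    have iu: "integrable lebesgue (\<lambda>x. (norm (u x))\<^sup>2)" using L2(1)[OF uc un] by (simp add: L2_space_def)
    have "c0 * real N * I = integral {0..real N * p} (\<lambda>x. c0 * (norm (y x))\<^sup>2)"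
      using In[of N] by simp
    also have "\<dots> \<le> integral {0..real N * p} (\<lambda>x. (norm (u x))\<^sup>2)"
    proof (rule integral_le)
      show "(\<lambda>x. c0 * (norm (y x))\<^sup>2) integrable_on {0..real N * p}"
        by (intro integrable_continuous_real continuous_intros n2c)
      show "(\<lambda>x. (norm (u x))\<^sup>2) integrable_on {0..real N * p}"
        by (intro integrable_continuous_real continuous_intros continuous_on_subset[OF uc]) auto
      fix x assume x: "x \<in> {0..real N * p}"
      then have "e * x \<le> p" "0 \<le> e * x" using N e by (auto simp: e_def field_simps)
      then have "(e * x)\<^sup>2 \<le> p\<^sup>2" by (intro power_mono)
      then have "inverse (1 + p\<^sup>2) \<le> ph x" unfolding ph_def using pos by (intro le_imp_inverse_le) auto
      then have "c0 \<le> (ph x)\<^sup>2" unfolding c0_def by (intro power_mono) (auto simp: add_nonneg_nonneg)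
      then show "c0 * (norm (y x))\<^sup>2 \<le> (norm (u x))\<^sup>2"
        by (simp add: u_def power_mult_distrib mult_right_mono)
    qed
    also have "\<dots> \<le> integral UNIV (\<lambda>x. (norm (u x))\<^sup>2)"
    proof (rule integral_subset_le[OF subset_UNIV])
      show "(\<lambda>x. (norm (u x))\<^sup>2) integrable_on {0..real N * p}"
        by (intro integrable_continuous_real continuous_intros continuous_on_subset[OF uc]) auto
      show "(\<lambda>x. (norm (u x))\<^sup>2) integrable_on UNIV" by (rule integrable_on_lebesgue[OF iu])
    qed simp
    also have "\<dots> = (\<integral>x. (norm (u x))\<^sup>2 \<partial>lebesgue)"
      by (rule integral_lebesgue[OF iu])
    finally show ?thesis using upper by linarith
  qed
  obtain N :: nat where N: "real N > C\<^sup>2 * (D\<^sup>2 * J) / (c0 * I) + 1" using reals_Archimedean2 by blast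
  have J: "J \<ge> 0" unfolding J_def by (intro Bochner_Integration.integral_nonneg) (simp add: add_nonneg_nonneg)
  have "0 \<le> C\<^sup>2 * (D\<^sup>2 * J) / (c0 * I)" using J c0 I by (intro divide_nonneg_nonneg mult_nonneg_nonneg) auto
  then have N1: "real N > 1" using N by linarith
  have "c0 * real N * I * real N \<le> C\<^sup>2 * (D\<^sup>2 * J)"
    using main[of N] N1 by (simp add: field_simps)
  then have "real N * real N \<le> C\<^sup>2 * (D\<^sup>2 * J) / (c0 * I)"
    using c0 I by (simp add: field_simps)
  moreover have "real N * 1 \<le> real N * real N" using N1 by (intro mult_left_mono) auto
  ultimately show False using N by linarith
qed

section \<open>Determinants and pencils symmetric in the unit circle\<close>

text \<open>Transpositions on either summand stay transpositions, so both factors can be treated by induction.\<close>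

lemma sign_map_sum:
  fixes q :: "'m::finite \<Rightarrow> 'm" and r :: "'n::finite \<Rightarrow> 'n"
  assumes "q permutes UNIV" "r permutes UNIV"
  shows "sign (map_sum q r) = sign q * sign r"
proof -
  have q: "sign (map_sum q (id :: 'n \<Rightarrow> 'n)) = sign q \<and> permutation (map_sum q (id :: 'n \<Rightarrow> 'n))"
    using assms(1) finite
  proof (induction rule: permutes_induct)
    case id
    show ?case by (simp only: sum.map_id0 sign_id permutation_id simp_thms)
  next
    case (swap a b p)
    have p: "permutation p" using swap.hyps finite permutation_permutes by blast
    have eq: "map_sum (Transposition.transpose a b \<circ> p) id
        = Transposition.transpose (Inl a) (Inl b) \<circ> map_sum p (id :: 'n \<Rightarrow> 'n)"
    proof
      fix x :: "'m + 'n"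
      show "map_sum (Transposition.transpose a b \<circ> p) id x
          = (Transposition.transpose (Inl a) (Inl b) \<circ> map_sum p id) x"
        by (cases x) (auto simp: Transposition.transpose_def)
    qed
    show ?case
      unfolding eq using swap.IH p
      by (simp only: sign_compose permutation_swap_id permutation_compose sign_swap_id swap.hyps if_False simp_thms sum.inject)
  qed
  have r: "sign (map_sum (id :: 'm \<Rightarrow> 'm) r) = sign r \<and> permutation (map_sum (id :: 'm \<Rightarrow> 'm) r)"
    using assms(2) finite
  proof (induction rule: permutes_induct)
    case id
    show ?case by (simp only: sum.map_id0 sign_id permutation_id simp_thms)
  next
    case (swap a b p)
    have p: "permutation p" using swap.hyps finite permutation_permutes by blast
    have eq: "map_sum id (Transposition.transpose a b \<circ> p)
        = Transposition.transpose (Inr a) (Inr b) \<circ> map_sum (id :: 'm \<Rightarrow> 'm) p"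
    proof
      fix x :: "'m + 'n"
      show "map_sum id (Transposition.transpose a b \<circ> p) x
          = (Transposition.transpose (Inr a) (Inr b) \<circ> map_sum id p) x"
        by (cases x) (auto simp: Transposition.transpose_def)
    qed
    show ?case
      unfolding eq using swap.IH p
      by (simp only: sign_compose permutation_swap_id permutation_compose sign_swap_id swap.hyps if_False simp_thms sum.inject)
  qed
  have "map_sum q r = map_sum q id \<circ> map_sum id r" by (rule ext, case_tac x) simp_all
  then show ?thesis using q r by (simp add: sign_compose)
qed

definition block_matrix :: "'a^'m^'m \<Rightarrow> 'a^'m^'m \<Rightarrow> 'a^'m^'m \<Rightarrow> 'a^'m^'m \<Rightarrow> 'a^('m + 'm)^('m + 'm)" where
  "block_matrix A B C D = (\<chi> i j. case i of
      Inl a \<Rightarrow> (case j of Inl b \<Rightarrow> A$a$b | Inr b \<Rightarrow> B$a$b)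
    | Inr a \<Rightarrow> (case j of Inl b \<Rightarrow> C$a$b | Inr b \<Rightarrow> D$a$b))"

lemma block_matrix_nth [simp]:
  "block_matrix A B C D $ Inl a $ Inl b = A$a$b"
  "block_matrix A B C D $ Inl a $ Inr b = B$a$b"
  "block_matrix A B C D $ Inr a $ Inl b = C$a$b"
  "block_matrix A B C D $ Inr a $ Inr b = D$a$b"
  by (simp_all add: block_matrix_def)

lemma prod_UNIV_sum: "prod f (UNIV :: ('m::finite + 'n::finite) set) = (\<Prod>a\<in>UNIV. f (Inl a)) * (\<Prod>b\<in>UNIV. f (Inr b))"
  using prod.Plus[of UNIV UNIV f] by (simp add: o_def)

lemma sum_UNIV_sum: "sum f (UNIV :: ('m::finite + 'n::finite) set) = (\<Sum>a\<in>UNIV. f (Inl a)) + (\<Sum>b\<in>UNIV. f (Inr b))"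
  using sum.Plus[of UNIV UNIV f] by (simp add: o_def)

text \<open>Only the permutations that preserve both summands contribute, and these are the pairs of permutations
of the summands.\<close>

lemma det_block_diagonal:
  fixes A D :: "'a::comm_ring_1^'m^'m"
  shows "det (block_matrix A 0 0 D) = det A * det D"
proof -
  let ?M = "block_matrix A 0 0 D"
  let ?P = "{p :: 'm \<Rightarrow> 'm. p permutes UNIV}"
  let ?h = "\<lambda>(q, r). map_sum q r :: 'm + 'm \<Rightarrow> 'm + 'm"
  let ?f = "\<lambda>p. of_int (sign p) * (\<Prod>i\<in>UNIV. ?M $ i $ p i)"
  have inj: "inj_on ?h (?P \<times> ?P)"
  proof (rule inj_onI, clarify)
    fix q r q' r' :: "'m \<Rightarrow> 'm"
    assume eq: "map_sum q r = map_sum q' r'"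
    have "q a = q' a" for a using fun_cong[OF eq, of "Inl a"] by simp
    moreover have "r a = r' a" for a using fun_cong[OF eq, of "Inr a"] by simp
    ultimately show "q = q' \<and> r = r'" by blast
  qed
  have sub: "?h ` (?P \<times> ?P) \<subseteq> {p. p permutes UNIV}"
  proof clarify
    fix q r :: "'m \<Rightarrow> 'm" assume "q permutes UNIV" "r permutes UNIV"
    then have "bij q" "bij r" by (simp_all add: permutes_bij)
    then have "inj (map_sum q r)" by (simp add: bij_def sum.inj_map)
    then show "map_sum q r permutes UNIV"
      using finite_UNIV_inj_surj[of "map_sum q r"] by (intro bij_imp_permutes) (auto simp: bij_def)
  qed
  have zero: "?f p = 0" if p: "p \<in> {p. p permutes UNIV} - ?h ` (?P \<times> ?P)" for p
  proof (rule ccontr)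
    assume "?f p \<noteq> 0"
    then have nz: "(\<Prod>i\<in>UNIV. ?M $ i $ p i) \<noteq> 0" by auto
    have fac: "?M $ i $ p i \<noteq> 0" for i
      using nz prod_zero[of UNIV "\<lambda>i. ?M $ i $ p i"] by auto
    have l: "\<exists>b. p (Inl a) = Inl b" for a
      using fac[of "Inl a"] by (cases "p (Inl a)") auto
    have r: "\<exists>b. p (Inr a) = Inr b" for a
      using fac[of "Inr a"] by (cases "p (Inr a)") auto
    obtain q where q: "\<And>a. p (Inl a) = Inl (q a)" using l by metis
    obtain s where s: "\<And>a. p (Inr a) = Inr (s a)" using r by metis
    have "inj p" using p by (auto dest: permutes_inj)
    then have "inj q" "inj s" using q s unfolding inj_def by (metis sum.inject)+
    then have "q permutes UNIV" "s permutes UNIV"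
      using finite_UNIV_inj_surj by (auto intro!: bij_imp_permutes simp: bij_def)
    moreover have "p = map_sum q s"
    proof
      fix x show "p x = map_sum q s x" by (cases x) (simp_all add: q s)
    qed
    ultimately have "p \<in> ?h ` (?P \<times> ?P)" by force
    then show False using p by blast
  qed
  have "det ?M = sum ?f {p. p permutes UNIV}" by (simp add: det_def)
  also have "\<dots> = sum ?f (?h ` (?P \<times> ?P))"
    by (rule sum.mono_neutral_right[OF _ sub]) (use zero in \<open>auto simp: finite_permutations\<close>)
  also have "\<dots> = (\<Sum>x\<in>?P \<times> ?P. ?f (?h x))" by (rule sum.reindex[OF inj, unfolded o_def])
  also have "\<dots> = (\<Sum>(q, r)\<in>?P \<times> ?P. (of_int (sign q) * (\<Prod>i\<in>UNIV. A $ i $ q i)) * (of_int (sign r) * (\<Prod>i\<in>UNIV. D $ i $ r i)))"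
    by (rule sum.cong) (auto simp: sign_map_sum prod_UNIV_sum)
  also have "\<dots> = det A * det D"
    by (simp add: det_def sum_product sum.cartesian_product)
  finally show ?thesis .
qed

lemma tendsto_det:
  fixes M :: "'b \<Rightarrow> complex^'n^'n"
  assumes "\<And>i j. ((\<lambda>x. M x $ i $ j) \<longlongrightarrow> L $ i $ j) F"
  shows "((\<lambda>x. det (M x)) \<longlongrightarrow> det L) F"
  unfolding det_def by (intro tendsto_sum tendsto_mult tendsto_const tendsto_prod assms)

lemma mat_mult_nth: "(mat c ** (M :: 'a::comm_ring_1^'n^'n)) $ i $ j = c * M $ i $ j"
  by (simp add: matrix_matrix_mult_def mat_def if_distrib[of "\<lambda>x. x * _"] cong: if_cong)

lemma det_mat: "det (mat c :: 'a::comm_ring_1^'n^'n) = c ^ CARD('n)"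
  by (subst det_diagonal) (auto simp: mat_def)

lemma det_mat_mult: "det (mat c ** (M :: 'a::comm_ring_1^'n^'n)) = c ^ CARD('n) * det M"
  by (simp add: det_mul det_mat)

abbreviation cnj_matrix :: "complex^'n^'m \<Rightarrow> complex^'n^'m" where
  "cnj_matrix \<equiv> map_matrix cnj"

lemma det_cnj_matrix: "det (cnj_matrix M) = cnj (det M)"
  by (simp add: det_def map_matrix_def cnj_sum cnj_prod)

text \<open>If \<open>\<bar>z\<bar> = 1\<close>, then \<open>T (cnj T - cnj z cnj V) V = V - cnj z T = - cnj z (T - z V)\<close>; the claim is
the determinant of this identity.\<close>

lemma pencil_reflection:
  fixes T V :: "complex^'n^'n"
  assumes T: "T ** cnj_matrix T = mat 1" and V: "V ** cnj_matrix V = mat 1" and z: "norm z = 1"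
  shows "det T * cnj (det (T - mat z ** V)) * det V = (- cnj z) ^ CARD('n) * det (T - mat z ** V)"
proof -
  have V': "cnj_matrix V ** V = mat 1" using V matrix_left_right_inverse by blast
  have zz: "cnj z * z = 1" using z complex_norm_square[of z] by (simp add: mult.commute)
  have e: "cnj_matrix (T - mat z ** V) = cnj_matrix T - mat (cnj z) ** cnj_matrix V"
    by (simp add: vec_eq_iff map_matrix_def mat_mult_nth)
  have comm: "X ** mat c = mat c ** X" for X :: "complex^'n^'n" and c
    by (simp add: vec_eq_iff mat_mult_nth matrix_matrix_mult_def mat_def if_distrib[of "\<lambda>x. _ * x"] mult.commute cong: if_cong)
  have "T ** cnj_matrix (T - mat z ** V) ** V = (T ** cnj_matrix T) ** V - mat (cnj z) ** T ** (cnj_matrix V ** V)"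
  proof -
    have d: "(X - Y) ** Z = X ** Z - Y ** Z" "Z ** (X - Y) = Z ** X - Z ** Y" for X Y Z :: "complex^'n^'n"
      by (simp_all add: vec_eq_iff matrix_matrix_mult_def sum_subtractf left_diff_distrib right_diff_distrib)
    have "T ** (mat (cnj z) ** cnj_matrix V) ** V = mat (cnj z) ** T ** (cnj_matrix V ** V)"
      unfolding matrix_mul_assoc comm[of T] ..
    then show ?thesis unfolding e d by simp
  qed
  also have "\<dots> = mat (- cnj z) ** (T - mat z ** V)"
    unfolding T V' using zz
    by (simp add: vec_eq_iff mat_mult_nth right_diff_distrib mult.assoc[symmetric])
  finally have "det (T ** cnj_matrix (T - mat z ** V) ** V) = det (mat (- cnj z) ** (T - mat z ** V))"
    by simp
  then show ?thesis by (simp only: det_mul det_cnj_matrix det_mat)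
qed

lemma norm_eq_1_if_mult_cnj:
  assumes "w * cnj w = 1"
  shows "norm w = 1"
proof -
  have "(norm w)\<^sup>2 = 1" using assms complex_norm_square[of w] by (metis of_real_eq_1_iff)
  then show ?thesis using norm_ge_zero[of w] unfolding power2_eq_1_iff by linarith
qed

text \<open>By the reflection identity, \<open>p\<close> becomes real after multiplication by \<open>exp(-in\<theta>/2)\<close> and a constant, where \<open>n\<close> is the
size of the matrices. The quotient in the last hypothesis is the quotient of the values of this real
function, so its negativity is a change of sign.\<close>

lemma unimodular_root_if_sign_change:
  fixes T V :: "complex^'n^'n"
  assumes T: "T ** cnj_matrix T = mat 1" and V: "V ** cnj_matrix V = mat 1"
  defines "p \<equiv> \<lambda>\<theta>. det (T - mat (cis \<theta>) ** V)"
  assumes \<theta>: "\<theta>1 \<le> \<theta>2" and p2: "p \<theta>2 \<noteq> 0"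
    and neg: "Re (cis (- (real CARD('n) * (\<theta>1 - \<theta>2) / 2)) * (p \<theta>1 / p \<theta>2)) < 0"
  shows "\<exists>\<theta>. p \<theta> = 0"
proof -
  let ?n = "CARD('n)"
  define D where "D = det T * det V"
  have "det T * cnj (det T) = 1" "det V * cnj (det V) = 1"
    using arg_cong[OF T, of det] arg_cong[OF V, of det] by (simp_all add: det_mul det_cnj_matrix)
  then have "norm (det T) = 1" "norm (det V) = 1"
    by (simp_all add: norm_eq_1_if_mult_cnj)
  then have nD: "norm D = 1" by (simp add: D_def norm_mult)
  then have nD: "norm D = 1" "D \<noteq> 0" by auto
  \<comment> \<open>conjugation multiplies \<open>f / c\<close> by \<open>(-1)^n / D\<close>; a unimodular \<open>c\<close> with this square makes \<open>f\<close> real\<close>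
  define c where "c = csqrt ((-1) ^ ?n / D)"
  have c2: "c\<^sup>2 = (-1) ^ ?n / D" by (simp add: c_def)
  have nc: "norm c = 1" by (simp add: c_def norm_divide norm_power nD)
  then have cc: "cnj c * c = 1" using complex_norm_square[of c] by (simp add: mult.commute)
  define f where "f = (\<lambda>\<theta>. c * cis (- (real ?n * \<theta> / 2)) * p \<theta>)"
  have real: "cnj (f \<theta>) = f \<theta>" for \<theta>
  proof -
    have refl: "D * cnj (p \<theta>) = (- cis (- \<theta>)) ^ ?n * p \<theta>"
      using pencil_reflection[OF T V, of "cis \<theta>"] by (simp add: p_def D_def cis_cnj mult_ac)
    have "(- cis (- \<theta>)) ^ ?n = (-1) ^ ?n * cis (- (real ?n * \<theta>))"
      
    proof -
      have "cis (- \<theta>) ^ ?n = cis (real ?n * - \<theta>)" by (rule Complex.DeMoivre)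
      also have "\<dots> = cis (- (real ?n * \<theta>))" by (rule arg_cong[of _ _ cis]) simp
      finally show ?thesis by (simp only: power_minus[of "cis (- \<theta>)"])
    qed
    then have "cnj (p \<theta>) = ((-1) ^ ?n / D) * cis (- (real ?n * \<theta>)) * p \<theta>"
      using refl nD(2) by (simp add: field_simps)
    then have "cnj (f \<theta>) = cnj c * cis (real ?n * \<theta> / 2) * (c\<^sup>2 * cis (- (real ?n * \<theta>)) * p \<theta>)"
      unfolding f_def c2 by (simp add: cis_cnj)
    also have "\<dots> = (cnj c * c) * c * (cis (real ?n * \<theta> / 2) * cis (- (real ?n * \<theta>))) * p \<theta>"
      by (simp add: power2_eq_square mult_ac)
    also have "cis (real ?n * \<theta> / 2) * cis (- (real ?n * \<theta>)) = cis (- (real ?n * \<theta> / 2))"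
      unfolding cis_mult by (rule arg_cong[of _ _ cis]) simp
    finally show ?thesis by (simp add: cc f_def)
  qed
  have fR: "f \<theta> = complex_of_real (Re (f \<theta>))" for \<theta>
    using real[of \<theta>] by (simp add: complex_eq_iff)
  have f2: "f \<theta>2 \<noteq> 0" using p2 nc by (auto simp: f_def)
  have fp: "f \<theta> = 0 \<longleftrightarrow> p \<theta> = 0" for \<theta> using nc by (auto simp: f_def)
  have "f \<theta>1 / f \<theta>2 = cis (- (real ?n * \<theta>1 / 2)) / cis (- (real ?n * \<theta>2 / 2)) * (p \<theta>1 / p \<theta>2)"
    using nc by (auto simp: f_def)
  also have "cis (- (real ?n * \<theta>1 / 2)) / cis (- (real ?n * \<theta>2 / 2)) = cis (- (real ?n * (\<theta>1 - \<theta>2) / 2))"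
    unfolding cis_divide by (rule arg_cong[of _ _ cis]) (simp add: right_diff_distrib diff_divide_distrib)
  finally have "Re (f \<theta>1 / f \<theta>2) < 0" using neg by simp
  moreover have "f \<theta>1 / f \<theta>2 = of_real (Re (f \<theta>1) / Re (f \<theta>2))"
    using arg_cong2[where f="(/)", OF fR fR, of \<theta>1 \<theta>2] by (simp only: of_real_divide)
  ultimately have "Re (f \<theta>1) / Re (f \<theta>2) < 0" by (simp only: Re_complex_of_real)
  moreover have cont: "continuous_on UNIV (\<lambda>\<theta>. Re (f \<theta>))"
    unfolding f_def p_def det_def vector_minus_component mat_mult_nth
    by (intro continuous_intros) simp
  ultimately have "\<exists>\<theta>. Re (f \<theta>) = 0"
  proof (cases "Re (f \<theta>2) > 0")
    case True
    then have "Re (f \<theta>1) \<le> 0" using \<open>Re (f \<theta>1) / Re (f \<theta>2) < 0\<close> by (simp add: divide_less_0_iff)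
    then show ?thesis using IVT'[of "\<lambda>\<theta>. Re (f \<theta>)" \<theta>1 0 \<theta>2] True \<theta> continuous_on_subset[OF cont] by auto
  next
    case False
    then have "Re (f \<theta>1) \<ge> 0" using \<open>Re (f \<theta>1) / Re (f \<theta>2) < 0\<close> by (simp add: divide_less_0_iff)
    then show ?thesis using IVT2'[of "\<lambda>\<theta>. Re (f \<theta>)" \<theta>2 0 \<theta>1] False \<theta> continuous_on_subset[OF cont] by auto
  qed
  then show ?thesis using fR fp by (metis of_real_0)
qed

lemma poly_det: "poly (det M) x = det (map_matrix (\<lambda>p. poly p x) M)"
  by (simp add: det_def map_matrix_def poly_sum poly_prod)

lemma poly_charpoly: "poly (charpoly A) x = det (mat x - A)"
  unfolding charpoly_def poly_det
  by (rule arg_cong[of _ _ det]) (simp add: vec_eq_iff map_matrix_def mat_def)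

lemma det_minus_mat: "det (A - mat x) = (-1) ^ CARD('n) * poly (charpoly A) x" for A :: "'a::field^'n^'n"
proof -
  have "A - mat x = mat (-1) ** (mat x - A)" by (simp add: vec_eq_iff mat_mult_nth)
  then show ?thesis by (simp only: det_mat_mult poly_charpoly)
qed

lemma singular_matrix_kernel:
  fixes A :: "'a::field^'n^'n"
  shows "det A = 0 \<longleftrightarrow> (\<exists>v. v \<noteq> 0 \<and> A *v v = 0)"
  using invertible_det_nz[of A] matrix_left_invertible_ker[of A]
  by (auto simp: invertible_left_inverse)

lemma is_eigenvalue_iff_root: "is_eigenvalue A x \<longleftrightarrow> poly (charpoly A) x = 0"
  for A :: "'a::field^'n^'n"
proof -
  have "(A - mat x) *v v = 0 \<longleftrightarrow> A *v v = x *s v" for v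
  proof -
    have "(A - mat x) *v v = A *v v - x *s v"
      by (simp add: vec_eq_iff matrix_vector_mult_def mat_def left_diff_distrib sum_subtractf if_distrib[of "\<lambda>x. x * _"] cong: if_cong)
    then show ?thesis by simp
  qed
  then have "is_eigenvalue A x \<longleftrightarrow> det (A - mat x) = 0"
    unfolding is_eigenvalue_def singular_matrix_kernel by simp
  then show ?thesis by (simp add: det_minus_mat)
qed

text \<open>The quotient of \<open>G\<close> at \<open>\<mu> + e\<close> and \<open>\<mu> - e\<close> is \<open>- U(\<mu> + e) / U(\<mu> - e)\<close>, which tends to \<open>-1\<close>. The
values are complex because rescaling a pencil multiplies its characteristic function by complex
constants.\<close>

lemma odd_zero_sign_change:
  fixes U :: "real \<Rightarrow> complex"
  assumes U: "isCont U \<mu>" "U \<mu> \<noteq> 0" and k: "odd k"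
  defines "G \<equiv> \<lambda>\<alpha>. of_real (\<alpha> - \<mu>) ^ k * U \<alpha>"
  shows "\<exists>\<alpha>1 \<alpha>2. \<alpha>2 < \<alpha>1 \<and> G \<alpha>2 \<noteq> 0 \<and> Re (G \<alpha>1 / G \<alpha>2) < 0"
proof -
  have lim: "((\<lambda>e. - (U (\<mu> + e) / U (\<mu> - e))) \<longlongrightarrow> - (U \<mu> / U \<mu>)) (at_right 0)"
  proof (intro tendsto_intros)
    have a: "((\<lambda>e. \<mu> + e) \<longlongrightarrow> \<mu>) (at_right 0)" "((\<lambda>e. \<mu> - e) \<longlongrightarrow> \<mu>) (at_right 0)"
      by (auto intro!: tendsto_eq_intros)
    show "((\<lambda>e. U (\<mu> + e)) \<longlongrightarrow> U \<mu>) (at_right 0)" "((\<lambda>e. U (\<mu> - e)) \<longlongrightarrow> U \<mu>) (at_right 0)"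
      by (rule isCont_tendsto_compose[OF U(1)], rule a)+
  qed (use U in auto)
  have "((\<lambda>e. Re (- (U (\<mu> + e) / U (\<mu> - e)))) \<longlongrightarrow> -1) (at_right 0)"
    using tendsto_Re[OF lim] U by simp
  then have ev1: "\<forall>\<^sub>F e in at_right 0. Re (- (U (\<mu> + e) / U (\<mu> - e))) < 0"
    by (rule order_tendstoD(2)) simp
  have ev2: "\<forall>\<^sub>F e in at_right (0::real). e > 0" by (rule eventually_at_right_less)
  have "\<forall>\<^sub>F e in at_right 0. \<mu> - e < \<mu> + e \<and> G (\<mu> - e) \<noteq> 0 \<and> Re (G (\<mu> + e) / G (\<mu> - e)) < 0"
    using ev1 ev2
  proof eventually_elim
    case (elim e)
    then have Un: "U (\<mu> - e) \<noteq> 0" by auto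
    have "G (\<mu> + e) / G (\<mu> - e) = - (U (\<mu> + e) / U (\<mu> - e))"
      using elim(2) k Un by (simp add: G_def power_minus_odd)
    then show ?case using elim Un by (auto simp: G_def)
  qed
  then obtain e where "\<mu> - e < \<mu> + e \<and> G (\<mu> - e) \<noteq> 0 \<and> Re (G (\<mu> + e) / G (\<mu> - e)) < 0"
    using eventually_happens trivial_limit_at_right_real by blast
  then show ?thesis by blast
qed

section \<open>The fundamental matrix in wave coordinates\<close>

lemma bounded_bilinear_matrix_mult:
  "bounded_bilinear ((**) :: complex^'n^'n \<Rightarrow> complex^'n^'n \<Rightarrow> complex^'n^'n)"
  unfolding bilinear_conv_bounded_bilinear[symmetric] bilinear_def
  by (intro conjI allI linearI)
     (simp_all add: vec_eq_iff matrix_matrix_mult_def distrib_left distrib_right sum.distrib scaleR_sum_right)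

lemma norm_matrix_le_sum: "norm (M :: complex^'n^'m) \<le> (\<Sum>i\<in>UNIV. \<Sum>j\<in>UNIV. norm (M $ i $ j))"
proof -
  have "norm M \<le> (\<Sum>i\<in>UNIV. norm (M $ i))" unfolding norm_vec_def by (rule L2_set_le_sum) simp
  also have "\<dots> \<le> (\<Sum>i\<in>UNIV. \<Sum>j\<in>UNIV. norm (M $ i $ j))"
    by (rule sum_mono) (unfold norm_vec_def, rule L2_set_le_sum, simp)
  finally show ?thesis .
qed

lemma bounded_linear_entry: "bounded_linear (\<lambda>M :: complex^'n^'m. M $ i $ j)"
  using bounded_linear_compose[OF bounded_linear_vec_nth[of j] bounded_linear_vec_nth[of i]] by (simp add: o_def)

lemma absolutely_integrable_matrix:
  fixes f :: "real \<Rightarrow> complex^'n^'m"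
  assumes "\<And>i j. (\<lambda>x. f x $ i $ j) absolutely_integrable_on S"
  shows "f absolutely_integrable_on S"
proof -
  have "(\<lambda>x. \<Sum>b\<in>Basis. (f x \<bullet> b) *\<^sub>R b) absolutely_integrable_on S"
  proof (rule absolutely_integrable_sum[OF finite_Basis])
    fix b :: "complex^'n^'m" assume "b \<in> Basis"
    then obtain i j c where b: "b = axis i (axis j c)" by (auto simp: Basis_vec_def)
    have "(\<lambda>x. f x \<bullet> b) = (\<lambda>x. f x $ i $ j \<bullet> c)" by (simp add: b inner_axis)
    then have "(\<lambda>x. f x \<bullet> b) absolutely_integrable_on S"
      using absolutely_integrable_linear[OF assms[of i j] bounded_linear_inner_left[of c]] by (simp add: o_def)
    then show "(\<lambda>x. (f x \<bullet> b) *\<^sub>R b) absolutely_integrable_on S"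
      by (rule absolutely_integrable_scaleR_right)
  qed
  then show ?thesis by (simp add: euclidean_representation)
qed

lemma bounded_linear_cnj_matrix: "bounded_linear (cnj_matrix :: complex^'n^'m \<Rightarrow> complex^'n^'m)"
  unfolding linear_conv_bounded_linear[symmetric]
  by (rule linearI) (simp_all add: vec_eq_iff map_matrix_def)

lemma cnj_matrix_mult: "cnj_matrix (A ** B) = cnj_matrix A ** cnj_matrix B"
  by (simp add: vec_eq_iff map_matrix_def matrix_matrix_mult_def cnj_sum)

lemma cnj_matrix_mat_1: "cnj_matrix (mat 1) = mat 1"
  by (simp add: vec_eq_iff map_matrix_def mat_def)

lemma integral_reflect_Icc:
  fixes h :: "real \<Rightarrow> 'a::euclidean_space"
  shows "integral {c - x..c} h = integral {0..x} (\<lambda>s. h (c - s))"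
proof -
  have "integral {c - x..c} h = integral {- x..0} (h \<circ> (+) c)"
    using integral_shift_Icc_real[of "-x" 0 h c] by (simp add: add.commute)
  also have "\<dots> = integral {- x..- 0} (\<lambda>s. h (c - (- s)))" by (simp add: o_def)
  also have "\<dots> = integral {0..x} (\<lambda>s. h (c - s))" by (rule Henstock_Kurzweil_Integration.integral_reflect_real)
  finally show ?thesis .
qed

text \<open>The symmetry of \<open>G\<close> makes \<open>x \<mapsto> cnj (X(p - x))\<close> a solution of the same equation, hence by uniqueness it equals
\<open>X(x) cnj (X(p))\<close>. At \<open>x = p\<close> this is the reflection symmetry of the transfer matrix \<open>X(p)\<close>.\<close>

lemma fundamental_matrix:
  fixes G :: "real \<Rightarrow> complex^'n^'n"
  assumes G: "G absolutely_integrable_on {0..p}" and p: "p \<ge> 0"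
    and K: "\<And>(A :: complex^'n^'n) (B :: complex^'n^'n). norm (A ** B) \<le> K * norm A * norm B" "0 \<le> K"
    and small: "K * integral {0..p} (\<lambda>t. norm (G t)) \<le> 1/2"
    and sym: "AE t in lebesgue. cnj_matrix (G (p - t)) = - G t"
  obtains X where "continuous_on {0..p} X" "X 0 = mat 1"
    "\<And>x. x \<in> {0..p} \<Longrightarrow> X x = mat 1 + integral {0..x} (\<lambda>t. G t ** X t)"
    "X p ** cnj_matrix (X p) = mat 1"
    "norm (X p - mat 1 - integral {0..p} G) \<le> 2 * (K * integral {0..p} (\<lambda>t. norm (G t)))\<^sup>2 * norm (mat 1 :: complex^'n^'n)"
proof -
  note vol = bounded_bilinear_matrix_mult K G p small
  obtain X where X: "continuous_on {0..p} X"
    and eq: "\<And>x. x \<in> {0..p} \<Longrightarrow> X x = mat 1 + integral {0..x} (\<lambda>t. G t ** X t)"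
    using volterra_exists[OF vol, of "mat 1"] by blast
  have X0: "X 0 = mat 1" using eq[of 0] p by simp
  have int: "(\<lambda>t. G t ** Z t) integrable_on {a..b}"
    if "continuous_on {0..p} Z" "0 \<le> a" "b \<le> p" for Z :: "real \<Rightarrow> complex^'n^'n" and a b
  proof -
    have "(\<lambda>t. G t ** Z t) absolutely_integrable_on {0..p}"
      by (rule absolutely_integrable_bilinear_continuous'[OF bounded_bilinear_matrix_mult that(1) G])
    then have "(\<lambda>t. G t ** Z t) absolutely_integrable_on {a..b}"
      by (rule absolutely_integrable_on_subinterval) (use that in auto)
    then show ?thesis unfolding absolutely_integrable_on_def by blast
  qed
  define Y where "Y = (\<lambda>x. cnj_matrix (X (p - x)))"
  define Z where "Z = (\<lambda>x. X x ** cnj_matrix (X p))"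
  have Yc: "continuous_on {0..p} Y" unfolding Y_def
    by (rule bounded_linear.continuous_on[OF bounded_linear_cnj_matrix],
        rule continuous_on_compose2[OF X continuous_on_diff[OF continuous_on_const continuous_on_id]]) auto
  have Zc: "continuous_on {0..p} Z" unfolding Z_def
    by (rule bounded_linear.continuous_on[OF bounded_bilinear.bounded_linear_left[OF bounded_bilinear_matrix_mult] X])
  have Yeq: "Y x = cnj_matrix (X p) + integral {0..x} (\<lambda>t. G t ** Y t)" if x: "x \<in> {0..p}" for x
  proof -
    have "integral {0..p - x} (\<lambda>t. G t ** X t) + integral {p - x..p} (\<lambda>t. G t ** X t) = integral {0..p} (\<lambda>t. G t ** X t)"
      by (rule Henstock_Kurzweil_Integration.integral_combine) (use x int[OF X] in auto)
    moreover have "X (p - x) = mat 1 + integral {0..p - x} (\<lambda>t. G t ** X t)"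
      "X p = mat 1 + integral {0..p} (\<lambda>t. G t ** X t)" using eq[of "p - x"] eq[of p] x by auto
    ultimately have 1: "X (p - x) = X p - integral {p - x..p} (\<lambda>t. G t ** X t)"
      by (simp add: eq_diff_eq add.assoc)
    have "cnj_matrix (integral {p - x..p} (\<lambda>t. G t ** X t)) = integral {p - x..p} (\<lambda>t. cnj_matrix (G t ** X t))"
      using integral_linear[OF int[OF X, of "p - x" p] bounded_linear_cnj_matrix] x by (simp add: o_def)
    also have "\<dots> = integral {0..x} (\<lambda>s. cnj_matrix (G (p - s) ** X (p - s)))"
      by (rule integral_reflect_Icc)
    also have "\<dots> = integral {0..x} (\<lambda>s. - (G s ** Y s))"
    proof -
      obtain N where N: "negligible N" "{t. \<not> cnj_matrix (G (p - t)) = - G t} \<subseteq> N"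
        using sym unfolding eventually_ae_filter_negligible by blast
      show ?thesis
      proof (rule integral_spike[OF N(1)])
        fix s assume "s \<in> {0..x} - N"
        then have "cnj_matrix (G (p - s)) = - G s" using N(2) by blast
        then show "- (G s ** Y s) = cnj_matrix (G (p - s) ** X (p - s))"
          unfolding cnj_matrix_mult Y_def
          by (simp add: bounded_bilinear.minus_left[OF bounded_bilinear_matrix_mult])
      qed
    qed
    also have "\<dots> = - integral {0..x} (\<lambda>s. G s ** Y s)" by simp
    finally show ?thesis
      unfolding Y_def 1 linear_diff[OF bounded_linear.linear[OF bounded_linear_cnj_matrix]] by simp
  qed
  have Zeq: "Z x = cnj_matrix (X p) + integral {0..x} (\<lambda>t. G t ** Z t)" if x: "x \<in> {0..p}" for x
  proof -
    have "integral {0..x} (\<lambda>t. G t ** Z t) = integral {0..x} (\<lambda>t. G t ** X t) ** cnj_matrix (X p)"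
      using integral_linear[OF int[OF X, of 0 x] bounded_bilinear.bounded_linear_left[OF bounded_bilinear_matrix_mult, of "cnj_matrix (X p)"]] x
      by (simp add: o_def Z_def matrix_mul_assoc)
    then show ?thesis
      unfolding Z_def eq[OF x] by (simp add: bounded_bilinear.add_left[OF bounded_bilinear_matrix_mult])
  qed
  have "Y p = Z p"
    by (rule volterra_unique[OF vol Yc Zc Yeq Zeq]) (use p in auto)
  then have "X p ** cnj_matrix (X p) = mat 1"
    by (simp add: Y_def Z_def X0 cnj_matrix_mat_1)
  moreover have "norm (X p - mat 1 - integral {0..p} (\<lambda>t. G t ** mat 1))
      \<le> 2 * (K * integral {0..p} (\<lambda>t. norm (G t)))\<^sup>2 * norm (mat 1 :: complex^'n^'n)"
    by (rule volterra_first_order[OF vol X eq])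
  ultimately show ?thesis using that[OF X X0 eq] by simp
qed

lemma abs_cont_deriv_on_linear:
  assumes "bounded_linear L" "abs_cont_deriv_on S f g"
  shows "abs_cont_deriv_on S (\<lambda>x. L (f x)) (\<lambda>x. L (g x))"
  unfolding abs_cont_deriv_on_def
proof (intro ballI impI)
  fix a b assume ab: "a \<in> S" "b \<in> S" "a \<le> b"
  note D = abs_cont_deriv_onD[OF assms(2) ab]
  have "L (f b) - L (f a) = L (f b - f a)" by (simp add: linear_diff[OF bounded_linear.linear[OF assms(1)]])
  also have "\<dots> = integral {a..b} (\<lambda>x. L (g x))"
    unfolding D(3) using integral_linear[OF D(2) assms(1)] by (simp add: o_def)
  finally show "(\<lambda>x. L (g x)) absolutely_integrable_on {a..b} \<and> L (f b) - L (f a) = integral {a..b} (\<lambda>x. L (g x))"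
    using absolutely_integrable_linear[OF D(1) assms(1)] by (simp add: o_def)
qed

lemma abs_cont_deriv_on_cong:
  assumes "abs_cont_deriv_on S f g" "\<And>x. x \<in> S \<Longrightarrow> g' x = g x" "is_interval S"
  shows "abs_cont_deriv_on S f g'"
  unfolding abs_cont_deriv_on_def
proof (intro ballI impI)
  fix a b assume ab: "a \<in> S" "b \<in> S" "a \<le> b"
  have "{a..b} \<subseteq> S" using ab assms(3) unfolding is_interval_1 by (meson atLeastAtMost_iff subsetI)
  then have eq: "g' x = g x" if "x \<in> {a..b} - {}" for x using assms(2) that by blast
  note D = abs_cont_deriv_onD[OF assms(1) ab]
  have "g' absolutely_integrable_on {a..b}" by (rule absolutely_integrable_spike[OF D(1) negligible_empty eq])
  moreover have "integral {a..b} g = integral {a..b} g'" by (rule integral_spike[OF negligible_empty eq])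
  ultimately show "g' absolutely_integrable_on {a..b} \<and> f b - f a = integral {a..b} g'" using D(3) by simp
qed

text \<open>The plane wave with frequency \<open>\<rho>\<close>, centred at the midpoint of the period: with this phase the kernel below is
exactly symmetric under \<open>t \<mapsto> \<pi> - t\<close>.\<close>

definition wave :: "real \<Rightarrow> real \<Rightarrow> complex" where
  "wave \<rho> x = cis (\<rho> * (x - pi / 2))"

text \<open>The kernel of the equation for the amplitudes in \<open>y = wave \<rho> u + wave (-\<rho>) v\<close>. It arises by
variation of constants: \<open>wave \<rho> u' + wave (-\<rho>) v' = 0\<close> and
\<open>i\<rho> (wave \<rho> u' - wave (-\<rho>) v') = Q y\<close>.\<close>

definition wave_kernel :: "(real \<Rightarrow> complex^'m^'m) \<Rightarrow> real \<Rightarrow> real \<Rightarrow> complex^('m + 'm)^('m + 'm)" where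
  "wave_kernel Q \<rho> t = block_matrix
     (mat (1 / (2 * \<i> * of_real \<rho>)) ** Q t) (mat (wave (-2 * \<rho>) t / (2 * \<i> * of_real \<rho>)) ** Q t)
     (mat (- wave (2 * \<rho>) t / (2 * \<i> * of_real \<rho>)) ** Q t) (mat (- 1 / (2 * \<i> * of_real \<rho>)) ** Q t)"

text \<open>The phases that the waves gain over one period enter on the side of the multiplier: \<open>z\<close> is a
multiplier iff \<open>X(\<pi>) - z phase_matrix \<rho>\<close> is singular.\<close>

definition phase_matrix :: "real \<Rightarrow> complex^('m::finite + 'm)^('m + 'm)" where
  "phase_matrix \<rho> = block_matrix (mat (cis (- (pi * \<rho>)))) 0 0 (mat (cis (pi * \<rho>)))"

lemma wave_deriv: "(wave \<rho> has_vector_derivative (\<i> * of_real \<rho>) * wave \<rho> x) (at x)"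
proof -
  have "((\<lambda>x. exp (\<i> * of_real \<rho> * (of_real x - of_real (pi/2)))) has_vector_derivative (\<i> * of_real \<rho>) * exp (\<i> * of_real \<rho> * (of_real x - of_real (pi/2)))) (at x)"
    by (rule has_vector_derivative_real_field) (auto intro!: derivative_eq_intros)
  then show ?thesis by (simp add: wave_def[abs_def] cis_conv_exp mult.assoc)
qed

lemma wave_continuous: "continuous_on S (wave \<rho>)"
  unfolding wave_def[abs_def] by (intro continuous_intros)

lemma wave_mult: "wave \<rho> x * wave \<sigma> x = wave (\<rho> + \<sigma>) x"
  by (simp add: wave_def cis_mult distrib_right)

lemma norm_wave [simp]: "norm (wave \<rho> x) = 1"
  by (simp add: wave_def)

lemma zero_function_zero_deriv:
  assumes "abs_cont_deriv_on {a..b} y y'" "continuous_on {a..b} y'" "a < b" "\<And>x. x \<in> {a..b} \<Longrightarrow> y x = 0"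
  shows "y' a = 0"
proof -
  have d: "((\<lambda>x. integral {a..x} y') has_vector_derivative y' a) (at a within {a..b})"
    by (rule integral_has_vector_derivative[OF assms(2)]) (use assms(3) in auto)
  have z: "0 = integral {a..x} y'" if "x \<in> {a..b}" for x
    using abs_cont_deriv_onD(3)[OF assms(1), of a x] assms(3,4) that by auto
  have "((\<lambda>x. 0) has_vector_derivative y' a) (at a within {a..b})"
    by (rule has_vector_derivative_transform[OF _ z d]) (use assms(3) in auto)
  moreover have "((\<lambda>x. 0) has_vector_derivative 0) (at a within {a..b})" by (rule has_vector_derivative_const)
  ultimately show ?thesis
    using assms(3) by (intro vector_derivative_unique_within_closed_interval[of a b a]) auto
qed

section \<open>From unimodular multipliers to the spectrum\<close>

definition upper_half :: "'a^('m::finite + 'm) \<Rightarrow> 'a^'m" where "upper_half w = (\<chi> a. w $ Inl a)"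
definition lower_half :: "'a^('m::finite + 'm) \<Rightarrow> 'a^'m" where "lower_half w = (\<chi> a. w $ Inr a)"

lemma halves_block_matrix_mult:
  fixes A B C D :: "complex^'m^'m"
  shows "upper_half (block_matrix A B C D *v w) = A *v upper_half w + B *v lower_half w"
    and "lower_half (block_matrix A B C D *v w) = C *v upper_half w + D *v lower_half w"
  by (simp_all add: vec_eq_iff upper_half_def lower_half_def matrix_vector_mult_def sum_UNIV_sum)

lemma mat_mult_vec: "(mat c :: 'a::comm_ring_1^'n^'n) *v w = c *s w"
  by (simp add: vec_eq_iff matrix_vector_mult_def mat_def if_distrib[of "\<lambda>x. x * _"] cong: if_cong)

lemma halves_smult: "upper_half (c *s w) = c *s upper_half w" "lower_half (c *s w) = c *s lower_half w"
  by (simp_all add: vec_eq_iff upper_half_def lower_half_def)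

lemma bounded_linear_halves:
  "bounded_linear (\<lambda>M :: complex^('m + 'm)^('m + 'm). upper_half (M *v w))"
  "bounded_linear (\<lambda>M :: complex^('m::finite + 'm)^('m + 'm). lower_half (M *v w))"
  unfolding linear_conv_bounded_linear[symmetric]
  by (rule linearI; simp add: vec_eq_iff upper_half_def lower_half_def matrix_vector_mult_def
      distrib_right sum.distrib scaleR_sum_right)+

text \<open>A kernel vector of the pencil is an initial value of amplitudes whose function \<open>y\<close> satisfies the boundary conditions
with multiplier \<open>z\<close>. The quasi-periodic extension of \<open>y\<close> is a bounded solution on the line.\<close>

lemma spectrum_if_singular_pencil:
  fixes Q :: "real \<Rightarrow> complex^'m^'m" and X :: "real \<Rightarrow> complex^('m + 'm)^('m + 'm)"
  assumes \<rho>: "\<rho> \<noteq> 0"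
    and per: "AE x in lebesgue. Q (x + pi) = Q x"
    and G: "wave_kernel Q \<rho> absolutely_integrable_on {0..pi}"
    and X: "continuous_on {0..pi} X" and X0: "X 0 = mat 1"
    and eq: "\<And>x. x \<in> {0..pi} \<Longrightarrow> X x = mat 1 + integral {0..x} (\<lambda>t. wave_kernel Q \<rho> t ** X t)"
    and z: "norm z = 1" and sing: "det (X pi - mat z ** phase_matrix \<rho>) = 0"
  shows "complex_of_real (\<rho>\<^sup>2) \<in> schroedinger_spectrum Q"
proof -
  have z0: "z \<noteq> 0" using z by auto
  obtain w where w0: "w \<noteq> 0" and w: "(X pi - mat z ** phase_matrix \<rho>) *v w = 0"
    using sing singular_matrix_kernel by blast
  define u where "u = (\<lambda>x. upper_half (X x *v w))"
  define v where "v = (\<lambda>x. lower_half (X x *v w))"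
  define k where "k = 1 / (2 * \<i> * complex_of_real \<rho>)"
  have k: "2 * \<i> * of_real \<rho> * k = 1" using \<rho> by (simp add: k_def)
  define u' where "u' = (\<lambda>x. k *s (Q x *v u x) + (k * wave (-2 * \<rho>) x) *s (Q x *v v x))"
  define v' where "v' = (\<lambda>x. - (k * wave (2 * \<rho>) x) *s (Q x *v u x) - k *s (Q x *v v x))"
  have kernel: "upper_half ((wave_kernel Q \<rho> x ** X x) *v w) = u' x"
    "lower_half ((wave_kernel Q \<rho> x ** X x) *v w) = v' x" for x
    unfolding matrix_vector_mul_assoc[symmetric] wave_kernel_def halves_block_matrix_mult
    unfolding matrix_vector_mul_assoc[symmetric] mat_mult_vec u_def[symmetric] v_def[symmetric] u'_def v'_def
    by (simp_all add: vec_eq_iff k_def u_def v_def)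
  have "abs_cont_deriv_on {0..pi} X (\<lambda>t. wave_kernel Q \<rho> t ** X t)"
    by (rule abs_cont_deriv_onI, rule absolutely_integrable_bilinear_continuous'[OF bounded_bilinear_matrix_mult X G])
       (simp add: eq X0)
  from abs_cont_deriv_on_linear[OF bounded_linear_halves(1)[of w] this] abs_cont_deriv_on_linear[OF bounded_linear_halves(2)[of w] this]
  have U: "abs_cont_deriv_on {0..pi} u u'" and V: "abs_cont_deriv_on {0..pi} v v'"
    unfolding kernel u_def v_def .
  define y where "y = (\<lambda>x. wave \<rho> x *s u x + wave (- \<rho>) x *s v x)"
  define y1 where "y1 = (\<lambda>x. (\<i> * of_real \<rho> * wave \<rho> x) *s u x + (- \<i> * of_real \<rho> * wave (- \<rho>) x) *s v x)"
  define y2 where "y2 = (\<lambda>x. Q x *v y x - complex_of_real (\<rho>\<^sup>2) *s y x)"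
  have ivl: "is_interval {0..pi}" by simp
  note prod = abs_cont_deriv_on_bilinear[OF bounded_bilinear_smult_vec _ _ _ ivl]
  have wd: "((\<lambda>x. c * wave r x) has_vector_derivative (c * ((\<i> * of_real r) * wave r x))) (at x)" for c r x
    by (rule has_vector_derivative_mult_right[OF wave_deriv])
  have wc: "continuous_on UNIV (\<lambda>x. c * ((\<i> * of_real r) * wave r x))" for c r
    by (intro continuous_intros wave_continuous)
  \<comment> \<open>these identities produce the cancellations of variation of constants\<close>
  have waves: "wave \<rho> x * wave (-2 * \<rho>) x = wave (- \<rho>) x" "wave (- \<rho>) x * wave (2 * \<rho>) x = wave \<rho> x" for x
    by (simp_all add: wave_mult)
  have "abs_cont_deriv_on {0..pi} (\<lambda>x. (1 * wave \<rho> x) *s u x + (1 * wave (- \<rho>) x) *s v x)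
     (\<lambda>x. ((1 * ((\<i> * of_real \<rho>) * wave \<rho> x)) *s u x + (1 * wave \<rho> x) *s u' x) +
        ((1 * ((\<i> * of_real (- \<rho>)) * wave (- \<rho>) x)) *s v x + (1 * wave (- \<rho>) x) *s v' x))"
    by (rule abs_cont_deriv_on_add[OF prod[OF wd wc U] prod[OF wd wc V]])
  then have Y: "abs_cont_deriv_on {0..pi} y y1"
    unfolding y_def mult_1_left
  proof (rule abs_cont_deriv_on_cong[OF _ _ ivl])
    fix x
    have "(wave \<rho> x *s u' x + wave (- \<rho>) x *s v' x) $ a =
      k * ((wave \<rho> x - wave (- \<rho>) x * wave (2 * \<rho>) x) * (Q x *v u x) $ a
        + (wave \<rho> x * wave (-2 * \<rho>) x - wave (- \<rho>) x) * (Q x *v v x) $ a)" for a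
      unfolding u'_def v'_def by (simp add: algebra_simps)
    then have "wave \<rho> x *s u' x + wave (- \<rho>) x *s v' x = 0"
      unfolding waves by (simp add: vec_eq_iff)
    then show "y1 x = \<i> * of_real \<rho> * wave \<rho> x *s u x + wave \<rho> x *s u' x +
        (\<i> * of_real (- \<rho>) * wave (- \<rho>) x *s v x + wave (- \<rho>) x *s v' x)"
      unfolding y1_def by (simp add: algebra_simps)
  qed
  let ?c = "\<i> * complex_of_real \<rho>"
  have "abs_cont_deriv_on {0..pi} (\<lambda>x. (?c * wave \<rho> x) *s u x + (- ?c * wave (- \<rho>) x) *s v x)
     (\<lambda>x. ((?c * ((\<i> * of_real \<rho>) * wave \<rho> x)) *s u x + (?c * wave \<rho> x) *s u' x) +
        ((- ?c * ((\<i> * of_real (- \<rho>)) * wave (- \<rho>) x)) *s v x + (- ?c * wave (- \<rho>) x) *s v' x))"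
    by (rule abs_cont_deriv_on_add[OF prod[OF wd wc U] prod[OF wd wc V]])
  moreover have "(\<lambda>x. (?c * wave \<rho> x) *s u x + (- ?c * wave (- \<rho>) x) *s v x) = y1"
    unfolding y1_def by simp
  ultimately have "abs_cont_deriv_on {0..pi} y1
     (\<lambda>x. ((?c * ((\<i> * of_real \<rho>) * wave \<rho> x)) *s u x + (?c * wave \<rho> x) *s u' x) +
        ((- ?c * ((\<i> * of_real (- \<rho>)) * wave (- \<rho>) x)) *s v x + (- ?c * wave (- \<rho>) x) *s v' x))" by simp
  then have Y1: "abs_cont_deriv_on {0..pi} y1 y2"
  proof (rule abs_cont_deriv_on_cong[OF _ _ ivl])
    fix x
    have Qy: "Q x *v y x = wave \<rho> x *s (Q x *v u x) + wave (- \<rho>) x *s (Q x *v v x)"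
      unfolding y_def by (simp add: vec_eq_iff matrix_vector_mult_def distrib_left sum.distrib sum_distrib_left mult_ac)
    show "y2 x = ((?c * ((\<i> * of_real \<rho>) * wave \<rho> x)) *s u x + (?c * wave \<rho> x) *s u' x) +
        ((- ?c * ((\<i> * of_real (- \<rho>)) * wave (- \<rho>) x)) *s v x + (- ?c * wave (- \<rho>) x) *s v' x)"
    proof (subst vec_eq_iff, rule allI)
      fix a
      have cc: "?c * ?c = - complex_of_real (\<rho>\<^sup>2)" by (simp add: complex_eq_iff power2_eq_square)
      have "(((?c * ((\<i> * of_real \<rho>) * wave \<rho> x)) *s u x + (?c * wave \<rho> x) *s u' x) +
        ((- ?c * ((\<i> * of_real (- \<rho>)) * wave (- \<rho>) x)) *s v x + (- ?c * wave (- \<rho>) x) *s v' x)) $ a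
        = (?c * ?c) * (wave \<rho> x * u x $ a + wave (- \<rho>) x * v x $ a)
          + (?c * k) * ((wave \<rho> x + wave (- \<rho>) x * wave (2 * \<rho>) x) * (Q x *v u x) $ a
             + (wave \<rho> x * wave (-2 * \<rho>) x + wave (- \<rho>) x) * (Q x *v v x) $ a)"
        unfolding u'_def v'_def by (simp add: algebra_simps)
      also have "\<dots> = - of_real (\<rho>\<^sup>2) * y x $ a + (2 * ?c * k) * (Q x *v y x) $ a"
        unfolding waves cc Qy by (simp add: y_def algebra_simps)
      also have "\<dots> = y2 x $ a" using k by (simp add: y2_def mult.assoc)
      finally show "y2 x $ a = (((?c * ((\<i> * of_real \<rho>) * wave \<rho> x)) *s u x + (?c * wave \<rho> x) *s u' x) +
        ((- ?c * ((\<i> * of_real (- \<rho>)) * wave (- \<rho>) x)) *s v x + (- ?c * wave (- \<rho>) x) *s v' x)) $ a" ..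
    qed
  qed
  have bc: "u pi = (z * cis (- (pi * \<rho>))) *s u 0" "v pi = (z * cis (pi * \<rho>)) *s v 0"
  proof -
    have "X pi *v w = mat z *v (phase_matrix \<rho> *v w)"
      using w unfolding matrix_vector_mult_diff_rdistrib matrix_vector_mul_assoc by simp
    then have "upper_half (X pi *v w) = z *s upper_half (phase_matrix \<rho> *v w)"
      "lower_half (X pi *v w) = z *s lower_half (phase_matrix \<rho> *v w)"
      by (simp_all add: mat_mult_vec halves_smult)
    then show "u pi = (z * cis (- (pi * \<rho>))) *s u 0" "v pi = (z * cis (pi * \<rho>)) *s v 0"
      unfolding phase_matrix_def halves_block_matrix_mult
      by (simp_all add: u_def v_def X0 mat_mult_vec vector_smult_assoc)
  qed
  have wv: "wave r pi = cis (pi * r) * wave r 0" for r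
    unfolding wave_def cis_mult by (rule arg_cong[of _ _ cis]) (simp add: algebra_simps)
  have ph: "wave \<rho> pi * (z * cis (- (pi * \<rho>))) = z * wave \<rho> 0" "wave (- \<rho>) pi * (z * cis (pi * \<rho>)) = z * wave (- \<rho>) 0"
  proof -
    have e: "cis b * W * (z * cis c) = z * W" if "b + c = 0" for b c W
    proof -
      have "cis b * W * (z * cis c) = (cis b * cis c) * (z * W)" by (simp only: mult_ac)
      then show ?thesis using that by (simp add: cis_mult)
    qed
    show "wave \<rho> pi * (z * cis (- (pi * \<rho>))) = z * wave \<rho> 0" "wave (- \<rho>) pi * (z * cis (pi * \<rho>)) = z * wave (- \<rho>) 0"
      unfolding wv by (rule e, simp)+
  qed
  have bcy: "y pi = z *s y 0"
    unfolding y_def bc vector_smult_assoc ph by (simp add: vector_add_ldistrib vector_smult_assoc)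
  have bcy1: "y1 pi = z *s y1 0"
  proof -
    have "y1 pi = (?c * (wave \<rho> pi * (z * cis (- (pi * \<rho>))))) *s u 0 + (- ?c * (wave (- \<rho>) pi * (z * cis (pi * \<rho>)))) *s v 0"
      unfolding y1_def bc vector_smult_assoc by (simp add: mult.assoc)
    then show ?thesis unfolding ph y1_def by (simp add: vector_add_ldistrib vector_smult_assoc mult_ac)
  qed
  have y1c: "continuous_on {0..pi} y1" by (rule abs_cont_deriv_on_continuous[OF Y1])
  have yc: "continuous_on {0..pi} y" by (rule abs_cont_deriv_on_continuous[OF Y])
  have nz: "\<exists>x\<in>{0..pi}. y x \<noteq> 0"
  proof (rule ccontr)
    assume "\<not> ?thesis"
    \<comment> \<open>then also \<open>y1\<close> vanishes at 0, and both amplitudes do\<close>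
    then have y0: "\<And>x. x \<in> {0..pi} \<Longrightarrow> y x = 0" by blast
    have 1: "y1 0 = 0" by (rule zero_function_zero_deriv[OF Y y1c pi_gt_zero y0])
    have 2: "y 0 = 0" by (rule y0) simp
    have a: "wave \<rho> 0 * u 0 $ a + wave (- \<rho>) 0 * v 0 $ a = 0" for a
      using arg_cong[OF 2, of "\<lambda>y. y $ a"] by (simp add: y_def)
    have b: "wave \<rho> 0 * u 0 $ a - wave (- \<rho>) 0 * v 0 $ a = 0" for a
    proof -
      have "?c * (wave \<rho> 0 * u 0 $ a - wave (- \<rho>) 0 * v 0 $ a) = 0"
        using arg_cong[OF 1, of "\<lambda>y. y $ a"] by (simp add: y1_def algebra_simps)
      then show ?thesis using \<rho> by simp
    qed
    have wz: "wave r 0 \<noteq> 0" for r by (metis norm_wave norm_zero zero_neq_one)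
    have "wave \<rho> 0 * u 0 $ a = 0" "wave (- \<rho>) 0 * v 0 $ a = 0" for a
    proof -
      have "X = 0 \<and> Y = 0" if "X + Y = 0" "X - Y = 0" for X Y :: complex
      proof -
        have "X = Y" using that(2) by simp
        then show ?thesis using that(1) by simp
      qed
      then show "wave \<rho> 0 * u 0 $ a = 0" "wave (- \<rho>) 0 * v 0 $ a = 0" using a[of a] b[of a] by blast+
    qed
    then have "u 0 = 0" "v 0 = 0" using wz by (simp_all add: vec_eq_iff)
    then have "w $ Inl a = 0" "w $ Inr a = 0" for a
      by (simp_all add: u_def v_def X0 upper_half_def lower_half_def vec_eq_iff)
    then have "w = 0" unfolding vec_eq_iff by (metis sum.exhaust zero_index)
    then show False using w0 by blast
  qed
  let ?e = "quasi_periodic_ext pi z"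
  have bd: "\<exists>B. \<forall>x. norm (?e f x) \<le> B" if "continuous_on {0..pi} f" for f :: "real \<Rightarrow> complex^'m"
  proof -
    have "bounded (f ` {0..pi})" by (rule compact_imp_bounded[OF compact_continuous_image[OF that compact_Icc]])
    then obtain B where "\<And>x. x \<in> {0..pi} \<Longrightarrow> norm (f x) \<le> B" unfolding bounded_iff by blast
    then have "norm (?e f x) \<le> B" for x
      unfolding norm_quasi_periodic_ext[OF z] using floor_frac_period(1)[OF pi_gt_zero] by blast
    then show ?thesis by blast
  qed
  obtain Y0 where B0: "\<And>x. norm (?e y x) \<le> Y0" using bd[OF yc] by blast
  obtain Y1' where B1: "\<And>x. norm (?e y1 x) \<le> Y1'" using bd[OF y1c] by blast
  show ?thesis
  proof (rule bounded_solution_in_spectrum[OF _ _ _ B0 B1 _ pi_gt_zero])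
    show "loc_abs_cont_deriv (?e y) (?e y1)"
      by (rule loc_abs_cont_deriv_quasi_periodic_ext[where f=y, OF Y pi_gt_zero z0 bcy])
    show "loc_abs_cont_deriv (?e y1) (?e y2)"
      by (rule loc_abs_cont_deriv_quasi_periodic_ext[where f=y1, OF Y1 pi_gt_zero z0 bcy1])
    show "AE x in lebesgue. ?e y2 x = Q x *v ?e y x - complex_of_real (\<rho>\<^sup>2) *s ?e y x"
      using AE_periodic_int[OF per]
    proof eventually_elim
      case (elim x)
      have Qx: "Q (x - of_int \<lfloor>x / pi\<rfloor> * pi) = Q x"
        using elim[rule_format, of "- \<lfloor>x / pi\<rfloor>"] by simp
      show ?case
        unfolding quasi_periodic_ext_def y2_def Qx
        by (simp add: vec_eq_iff matrix_vector_mult_def sum_distrib_left algebra_simps)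
    qed
    show "norm (?e y (x + pi)) = norm (?e y x)" for x
      using quasi_periodic_quasi_periodic_ext[OF pi_gt_zero z0, of y] z unfolding quasi_periodic_def by (simp add: norm_smult_vec)
    obtain x where x: "x \<in> {0..pi}" "y x \<noteq> 0" using nz by blast
    have "?e y x = y x" by (rule quasi_periodic_ext_eq_closed[where f=y, OF pi_gt_zero bcy x(1)])
    then show "\<exists>x\<in>{0..pi}. ?e y x \<noteq> 0" using x by force
  qed
qed

section \<open>High-energy asymptotics of the transfer matrix\<close>

lemma phase_matrix_unitary: "phase_matrix \<rho> ** cnj_matrix (phase_matrix \<rho>) = (mat 1 :: complex^('m::finite + 'm)^('m + 'm))"
proof -
  have "(phase_matrix \<rho> ** cnj_matrix (phase_matrix \<rho>)) $ i $ j = (mat 1 :: complex^('m + 'm)^('m + 'm)) $ i $ j"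
    for i j :: "'m + 'm"
    by (cases i; cases j)
       (simp_all add: phase_matrix_def map_matrix_def matrix_matrix_mult_def sum_UNIV_sum mat_def
          if_distrib[of "\<lambda>x. x * _"] if_distrib[of "\<lambda>x. _ * x"] if_distrib[of cnj] cis_cnj cis_mult cong: if_cong)
  then show ?thesis by (simp add: vec_eq_iff)
qed

lemma wave_reflect: "wave r (pi - t) = cnj (wave r t)"
  by (simp add: wave_def cis_cnj algebra_simps)

lemma wave_kernel_entries:
  "wave_kernel Q \<rho> t $ Inl a $ Inl b = 1 / (2 * \<i> * of_real \<rho>) * Q t $ a $ b"
  "wave_kernel Q \<rho> t $ Inl a $ Inr b = wave (-2 * \<rho>) t / (2 * \<i> * of_real \<rho>) * Q t $ a $ b"
  "wave_kernel Q \<rho> t $ Inr a $ Inl b = - wave (2 * \<rho>) t / (2 * \<i> * of_real \<rho>) * Q t $ a $ b"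
  "wave_kernel Q \<rho> t $ Inr a $ Inr b = - 1 / (2 * \<i> * of_real \<rho>) * Q t $ a $ b"
  by (simp_all add: wave_kernel_def mat_mult_nth)

lemma wave_kernel_reflect:
  assumes "cnj_matrix (Q (pi - t)) = Q t"
  shows "cnj_matrix (wave_kernel Q \<rho> (pi - t)) = - wave_kernel Q \<rho> t"
proof -
  have q: "cnj (Q (pi - t) $ a $ b) = Q t $ a $ b" for a b
    using assms by (simp add: vec_eq_iff map_matrix_def)
  have "cnj_matrix (wave_kernel Q \<rho> (pi - t)) $ i $ j = (- wave_kernel Q \<rho> t) $ i $ j" for i j
    by (cases i; cases j) (simp_all add: map_matrix_def wave_kernel_entries q wave_reflect)
  then show ?thesis by (simp add: vec_eq_iff)
qed

lemma absolutely_integrable_wave_kernel: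
  assumes "\<And>i j. (\<lambda>x. Q x $ i $ j) absolutely_integrable_on {0..pi}"
  shows "wave_kernel Q \<rho> absolutely_integrable_on {0..pi}"
proof (rule absolutely_integrable_matrix)
  have c: "(\<lambda>t. f t * Q t $ a $ b) absolutely_integrable_on {0..pi}" if "continuous_on {0..pi} f" for f a b
    by (rule absolutely_integrable_bilinear_continuous[OF bounded_bilinear_mult that assms])
  have w: "continuous_on {0..pi} (\<lambda>t. c * wave r t)" for c r by (intro continuous_intros wave_continuous)
  fix i j :: "'a + 'a"
  show "(\<lambda>t. wave_kernel Q \<rho> t $ i $ j) absolutely_integrable_on {0..pi}"
  proof (cases i; cases j)
    fix a b assume ij: "i = Inl a" "j = Inl b"
    show ?thesis unfolding ij wave_kernel_entries by (rule c) (rule continuous_on_const)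
  next
    fix a b assume ij: "i = Inl a" "j = Inr b"
    show ?thesis unfolding ij wave_kernel_entries
      using c[OF w[of "1 / (2 * \<i> * of_real \<rho>)" "-2 * \<rho>"], of a b] by simp
  next
    fix a b assume ij: "i = Inr a" "j = Inl b"
    show ?thesis unfolding ij wave_kernel_entries
      using c[OF w[of "- 1 / (2 * \<i> * of_real \<rho>)" "2 * \<rho>"], of a b] by simp
  next
    fix a b assume ij: "i = Inr a" "j = Inr b"
    show ?thesis unfolding ij wave_kernel_entries by (rule c) (rule continuous_on_const)
  qed
qed

lemma norm_wave_kernel_le:
  assumes "\<rho> > 0"
  shows "norm (wave_kernel Q \<rho> t) \<le> (2 * (\<Sum>a\<in>UNIV. \<Sum>b\<in>UNIV. norm (Q t $ a $ b))) / \<rho>"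
proof -
  have e: "norm (wave_kernel Q \<rho> t $ Inl a $ Inl b) = norm (Q t $ a $ b) / (2 * \<rho>)"
     "norm (wave_kernel Q \<rho> t $ Inl a $ Inr b) = norm (Q t $ a $ b) / (2 * \<rho>)"
     "norm (wave_kernel Q \<rho> t $ Inr a $ Inl b) = norm (Q t $ a $ b) / (2 * \<rho>)"
     "norm (wave_kernel Q \<rho> t $ Inr a $ Inr b) = norm (Q t $ a $ b) / (2 * \<rho>)" for a b
    using assms by (simp_all add: wave_kernel_entries norm_mult norm_divide)
  have "norm (wave_kernel Q \<rho> t) \<le> (\<Sum>i\<in>UNIV. \<Sum>j\<in>UNIV. norm (wave_kernel Q \<rho> t $ i $ j))"
    by (rule norm_matrix_le_sum)
  also have "\<dots> = 4 * (\<Sum>a\<in>UNIV. \<Sum>b\<in>UNIV. norm (Q t $ a $ b) / (2 * \<rho>))"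
    unfolding sum_UNIV_sum e by (simp add: sum.distrib flip: sum_distrib_left)
  also have "\<dots> = (2 * (\<Sum>a\<in>UNIV. \<Sum>b\<in>UNIV. norm (Q t $ a $ b))) / \<rho>"
    using assms by (simp add: field_simps flip: sum_divide_distrib)
  finally show ?thesis .
qed

text \<open>The kernel has size \<open>O(1/\<rho>)\<close>, so it is small enough for the Volterra theory once \<open>\<rho>\<close> is large.\<close>

lemma transfer_matrix:
  fixes Q :: "real \<Rightarrow> complex^'m^'m"
  assumes Qi: "\<And>i j. (\<lambda>x. Q x $ i $ j) absolutely_integrable_on {0..pi}"
    and sym: "AE t in lebesgue. cnj_matrix (Q (pi - t)) = Q t"
    and per: "AE x in lebesgue. Q (x + pi) = Q x"
  obtains R C where "R > 0" "\<And>\<rho>. \<rho> \<ge> R \<Longrightarrow> \<exists>T :: complex^('m + 'm)^('m + 'm).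
      T ** cnj_matrix T = mat 1 \<and>
      norm (T - mat 1 - integral {0..pi} (wave_kernel Q \<rho>)) \<le> C / \<rho>\<^sup>2 \<and>
      (\<forall>z. norm z = 1 \<longrightarrow> det (T - mat z ** phase_matrix \<rho>) = 0 \<longrightarrow> complex_of_real (\<rho>\<^sup>2) \<in> schroedinger_spectrum Q)"
proof -
  let ?M = "(**) :: complex^('m + 'm)^('m + 'm) \<Rightarrow> complex^('m + 'm)^('m + 'm) \<Rightarrow> complex^('m + 'm)^('m + 'm)"
  obtain K where K: "K \<ge> 0" "\<And>A B. norm (?M A B) \<le> norm A * norm B * K"
    using bounded_bilinear.nonneg_bounded[OF bounded_bilinear_matrix_mult[where 'n="'m + 'm"]] by (elim exE conjE) simp
  have K': "norm (?M A B) \<le> K * norm A * norm B" for A B using K(2)[of A B] by (simp add: mult_ac)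
  define q where "q = (\<lambda>t. 2 * (\<Sum>a\<in>UNIV. \<Sum>b\<in>UNIV. norm (Q t $ a $ b)))"
  define c where "c = integral {0..pi} q"
  have qi: "q integrable_on {0..pi}"
    unfolding q_def
    by (intro integrable_on_mult_right integrable_sum finite absolutely_integrable_norm_integrable Qi)
  have c0: "c \<ge> 0" unfolding c_def by (rule integral_nonneg[OF qi]) (simp add: q_def sum_nonneg)
  let ?n1 = "norm (mat 1 :: complex^('m + 'm)^('m + 'm))"
  \<comment> \<open>from \<open>R\<close> on, the kernel has norm at most \<open>1/2\<close>; \<open>C\<close> is the constant of the quadratic error\<close>
  define R where "R = 2 * K * c + 1"
  define C where "C = 2 * (K * c)\<^sup>2 * ?n1"
  have R0: "R > 0" using K(1) c0 by (simp add: R_def add_nonneg_pos)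
  show ?thesis
  proof (rule that[of R C, OF R0])
    fix \<rho> assume "\<rho> \<ge> R"
    then have \<rho>: "\<rho> > 0" "2 * K * c \<le> \<rho>" using R0 by (auto simp: R_def)
    note G = absolutely_integrable_wave_kernel[of Q, OF Qi, of \<rho>]
    have Gn: "integral {0..pi} (\<lambda>t. norm (wave_kernel Q \<rho> t)) \<le> c / \<rho>"
    proof -
      have "integral {0..pi} (\<lambda>t. norm (wave_kernel Q \<rho> t)) \<le> integral {0..pi} (\<lambda>t. q t / \<rho>)"
        by (rule integral_le[OF absolutely_integrable_norm_integrable[OF G] integrable_on_divide[OF qi]])
           (use norm_wave_kernel_le[OF \<rho>(1)] in \<open>simp add: q_def\<close>)
      then show ?thesis by (simp add: c_def)
    qed
    have KG: "K * integral {0..pi} (\<lambda>t. norm (wave_kernel Q \<rho> t)) \<le> K * c / \<rho>"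
      using mult_left_mono[OF Gn K(1)] by simp
    also have "\<dots> \<le> 1/2" using \<rho> by (simp add: field_simps)
    finally have small: "K * integral {0..pi} (\<lambda>t. norm (wave_kernel Q \<rho> t)) \<le> 1/2" .
    have symG: "AE t in lebesgue. cnj_matrix (wave_kernel Q \<rho> (pi - t)) = - wave_kernel Q \<rho> t"
      using sym by eventually_elim (rule wave_kernel_reflect)
    obtain X where X: "continuous_on {0..pi} X" "X 0 = mat 1"
      "\<And>x. x \<in> {0..pi} \<Longrightarrow> X x = mat 1 + integral {0..x} (\<lambda>t. wave_kernel Q \<rho> t ** X t)"
      "X pi ** cnj_matrix (X pi) = mat 1"
      "norm (X pi - mat 1 - integral {0..pi} (wave_kernel Q \<rho>))
         \<le> 2 * (K * integral {0..pi} (\<lambda>t. norm (wave_kernel Q \<rho> t)))\<^sup>2 * ?n1"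
      by (rule fundamental_matrix[OF G pi_ge_zero K' K(1) small symG], rule that)
    note X(5)
    also have "2 * (K * integral {0..pi} (\<lambda>t. norm (wave_kernel Q \<rho> t)))\<^sup>2 * ?n1 \<le> 2 * (K * c / \<rho>)\<^sup>2 * ?n1"
    proof -
      have "0 \<le> integral {0..pi} (\<lambda>t. norm (wave_kernel Q \<rho> t))"
        by (rule integral_nonneg[OF absolutely_integrable_norm_integrable[OF G]]) simp
      then show ?thesis
        using KG K(1) by (intro mult_right_mono mult_left_mono power_mono) simp_all
    qed
    also have "\<dots> = C / \<rho>\<^sup>2" by (simp add: C_def power_divide)
    finally have "norm (X pi - mat 1 - integral {0..pi} (wave_kernel Q \<rho>)) \<le> C / \<rho>\<^sup>2" .
    moreover have "complex_of_real (\<rho>\<^sup>2) \<in> schroedinger_spectrum Q"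
      if "norm z = 1" "det (X pi - mat z ** phase_matrix \<rho>) = 0" for z
      using spectrum_if_singular_pencil[OF _ per G X(1,2,3) that] \<rho> by simp
    ultimately show "\<exists>T :: complex^('m + 'm)^('m + 'm).
      T ** cnj_matrix T = mat 1 \<and>
      norm (T - mat 1 - integral {0..pi} (wave_kernel Q \<rho>)) \<le> C / \<rho>\<^sup>2 \<and>
      (\<forall>z. norm z = 1 \<longrightarrow> det (T - mat z ** phase_matrix \<rho>) = 0 \<longrightarrow> complex_of_real (\<rho>\<^sup>2) \<in> schroedinger_spectrum Q)"
      using X(4) by blast
  qed
qed

text \<open>The diagonal blocks integrate exactly to \<open>A\<close> and \<open>-A\<close>; the other blocks carry the factors
\<open>wave (\<plusminus>2\<rho>)\<close> and vanish in the limit by the Riemann--Lebesgue lemma.\<close>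

lemma wave_kernel_integral_limit:
  fixes Q :: "real \<Rightarrow> complex^'m^'m" and \<rho> :: "nat \<Rightarrow> real"
  assumes Qi: "\<And>i j. (\<lambda>x. Q x $ i $ j) absolutely_integrable_on {0..pi}"
    and \<rho>: "filterlim \<rho> at_top sequentially" and pos: "\<And>n. \<rho> n > 0"
  defines "A \<equiv> \<chi> i j. integral {0..pi} (\<lambda>x. Q x $ i $ j)"
  shows "(\<lambda>n. 2 * \<i> * of_real (\<rho> n) * integral {0..pi} (wave_kernel Q (\<rho> n)) $ i $ j)
     \<longlonglongrightarrow> block_matrix A 0 0 (- A) $ i $ j"
proof -
  let ?F = "\<lambda>n. 2 * \<i> * of_real (\<rho> n)"
  have ent: "integral {0..pi} (wave_kernel Q r) $ i $ j = integral {0..pi} (\<lambda>t. wave_kernel Q r t $ i $ j)" for r i j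
  proof -
    have "wave_kernel Q r integrable_on {0..pi}"
      using absolutely_integrable_wave_kernel[of Q, OF Qi, of r] unfolding absolutely_integrable_on_def by blast
    from integral_linear[OF this bounded_linear_entry[of i j]] show ?thesis by (simp add: o_def)
  qed
  have F: "?F n \<noteq> 0" for n using pos[of n] by auto
  have osc: "(\<lambda>n. integral {0..pi} (\<lambda>t. wave (s * \<rho> n) t * Q t $ a $ b)) \<longlonglongrightarrow> 0" if s: "s \<noteq> 0" for s a b
  proof (rule tendsto_norm_zero_cancel)
    have w: "wave r t = cis (- (r * pi / 2)) * cis (r * t)" for r t
      unfolding wave_def cis_mult by (rule arg_cong[of _ _ cis]) (simp add: algebra_simps)
    have "filterlim (\<lambda>n. s * \<rho> n) at_infinity sequentially"
      using tendsto_mult_filterlim_at_infinity[OF tendsto_const s filterlim_at_top_imp_at_infinity[OF \<rho>]] by simp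
    from tendsto_norm_zero[OF riemann_lebesgue[OF Qi[of a b] this]]
    show "(\<lambda>n. norm (integral {0..pi} (\<lambda>t. wave (s * \<rho> n) t * Q t $ a $ b))) \<longlonglongrightarrow> 0"
      unfolding w by (simp add: mult.assoc norm_mult)
  qed
  show ?thesis
  proof (cases i; cases j)
    fix a b assume ij: "i = Inl a" "j = Inl b"
    show ?thesis unfolding ij ent wave_kernel_entries using F by (simp add: A_def)
  next
    fix a b assume ij: "i = Inl a" "j = Inr b"
    have "?F n * integral {0..pi} (\<lambda>t. wave (-2 * \<rho> n) t / ?F n * Q t $ a $ b)
        = integral {0..pi} (\<lambda>t. wave (-2 * \<rho> n) t * Q t $ a $ b)" for n
      unfolding times_divide_eq_left integral_divide using F[of n] by simp
    then show ?thesis unfolding ij ent wave_kernel_entries using osc[of "-2" a b] by simp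
  next
    fix a b assume ij: "i = Inr a" "j = Inl b"
    have "?F n * integral {0..pi} (\<lambda>t. - wave (2 * \<rho> n) t / ?F n * Q t $ a $ b)
        = - integral {0..pi} (\<lambda>t. wave (2 * \<rho> n) t * Q t $ a $ b)" for n
      unfolding times_divide_eq_left integral_divide mult_minus_left integral_neg using F[of n] by simp
    then show ?thesis unfolding ij ent wave_kernel_entries using tendsto_minus[OF osc[of 2 a b]] by simp
  next
    fix a b assume ij: "i = Inr a" "j = Inr b"
    show ?thesis unfolding ij ent wave_kernel_entries using F by (simp add: A_def)
  qed
qed

section \<open>Multipliers at high energy\<close>

text \<open>The angles \<open>\<pi>\<rho> - \<alpha>/(2\<rho>)\<close> zoom in on the first family of multipliers at the scale \<open>1/\<rho>\<close>. The factors \<open>R n\<close> do not depend on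
\<open>\<alpha>\<close> and cancel in quotients of determinants, so the sign change of the limit is inherited by the characteristic
functions.\<close>

lemma unimodular_root_if_limit_changes_sign:
  fixes T V R :: "nat \<Rightarrow> complex^'k^'k" and \<rho> :: "nat \<Rightarrow> real" and L :: "real \<Rightarrow> complex^'k^'k"
  assumes T: "\<And>n. T n ** cnj_matrix (T n) = mat 1" and V: "\<And>n. V n ** cnj_matrix (V n) = mat 1"
    and R: "\<And>n. det (R n) \<noteq> 0" and \<rho>: "filterlim \<rho> at_top sequentially"
    and lim: "\<And>\<alpha> i j. (\<lambda>n. (R n ** (T n - mat (cis (pi * \<rho> n - \<alpha> / (2 * \<rho> n))) ** V n)) $ i $ j) \<longlonglongrightarrow> L \<alpha> $ i $ j"
    and sign: "\<alpha>2 < \<alpha>1" "det (L \<alpha>2) \<noteq> 0" "Re (det (L \<alpha>1) / det (L \<alpha>2)) < 0"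
  shows "\<exists>n \<theta>. det (T n - mat (cis \<theta>) ** V n) = 0"
proof -
  define th where "th = (\<lambda>\<alpha> n. pi * \<rho> n - \<alpha> / (2 * \<rho> n))"
  define p where "p = (\<lambda>n \<theta>. det (T n - mat (cis \<theta>) ** V n))"
  have lim': "(\<lambda>n. det (R n) * p n (th \<alpha> n)) \<longlonglongrightarrow> det (L \<alpha>)" for \<alpha>
    using tendsto_det[OF lim[of \<alpha>]] unfolding det_mul p_def th_def .
  have "(\<lambda>n. (det (R n) * p n (th \<alpha>1 n)) / (det (R n) * p n (th \<alpha>2 n))) \<longlonglongrightarrow> det (L \<alpha>1) / det (L \<alpha>2)"
    by (rule tendsto_divide[OF lim' lim' sign(2)])
  moreover have "(det (R n) * x) / (det (R n) * y) = x / y" for n x y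
    by (rule mult_divide_mult_cancel_left[OF R])
  ultimately have q: "(\<lambda>n. p n (th \<alpha>1 n) / p n (th \<alpha>2 n)) \<longlonglongrightarrow> det (L \<alpha>1) / det (L \<alpha>2)"
    by (simp only:)
  have inv: "(\<lambda>n. inverse (\<rho> n)) \<longlonglongrightarrow> 0"
    by (rule tendsto_inverse_0_at_top[OF \<rho>])
  define c where "c = (\<lambda>n. - (real CARD('k) * (th \<alpha>1 n - th \<alpha>2 n) / 2))"
  have c: "c n = real CARD('k) * (\<alpha>1 - \<alpha>2) / 4 * inverse (\<rho> n)" for n
  proof -
    have "th \<alpha>1 n - th \<alpha>2 n = \<alpha>2 / (2 * \<rho> n) - \<alpha>1 / (2 * \<rho> n)" by (simp add: th_def)
    also have "\<dots> = (\<alpha>2 - \<alpha>1) / (2 * \<rho> n)" by (rule diff_divide_distrib[symmetric])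
    finally have d: "th \<alpha>1 n - th \<alpha>2 n = (\<alpha>2 - \<alpha>1) / (2 * \<rho> n)" .
    show ?thesis unfolding c_def d by (cases "\<rho> n = 0") (simp_all add: field_simps)
  qed
  have c0: "c \<longlonglongrightarrow> 0" unfolding c[abs_def] by (rule tendsto_mult_right_zero[OF inv])
  have "(\<lambda>n. cis (c n)) \<longlonglongrightarrow> 1"
  proof -
    have "(\<lambda>n. exp (\<i> * complex_of_real (c n))) \<longlonglongrightarrow> exp (\<i> * of_real 0)"
      by (rule tendsto_exp[OF tendsto_mult_left[OF tendsto_of_real[OF c0]]])
    then show ?thesis by (simp add: cis_conv_exp)
  qed
  then have "(\<lambda>n. cis (c n) * (p n (th \<alpha>1 n) / p n (th \<alpha>2 n))) \<longlonglongrightarrow> 1 * (det (L \<alpha>1) / det (L \<alpha>2))"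
    by (rule tendsto_mult) (rule q)
  then have "(\<lambda>n. Re (cis (c n) * (p n (th \<alpha>1 n) / p n (th \<alpha>2 n)))) \<longlonglongrightarrow> Re (1 * (det (L \<alpha>1) / det (L \<alpha>2)))"
    by (rule tendsto_Re)
  then have e1: "\<forall>\<^sub>F n in sequentially. Re (cis (c n) * (p n (th \<alpha>1 n) / p n (th \<alpha>2 n))) < 0"
    by (rule order_tendstoD(2)) (use sign(3) in \<open>simp only: mult_1_left\<close>)
  have e2: "\<forall>\<^sub>F n in sequentially. det (R n) * p n (th \<alpha>2 n) \<noteq> 0"
    by (rule tendsto_imp_eventually_ne[OF lim' sign(2)])
  have e3: "\<forall>\<^sub>F n in sequentially. \<rho> n > 0"
    using \<rho> unfolding filterlim_at_top_dense by (rule spec)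
  have "\<forall>\<^sub>F n in sequentially. \<exists>\<theta>. det (T n - mat (cis \<theta>) ** V n) = 0"
    using e1 e2 e3
  proof eventually_elim
    case (elim n)
    have le: "th \<alpha>1 n \<le> th \<alpha>2 n"
    proof -
      have "\<alpha>2 / (2 * \<rho> n) \<le> \<alpha>1 / (2 * \<rho> n)" using sign(1) elim(3) by (intro divide_right_mono) auto
      then show ?thesis unfolding th_def by linarith
    qed
    have nz: "det (T n - mat (cis (th \<alpha>2 n)) ** V n) \<noteq> 0" using elim(2) unfolding p_def by (rule contrapos_nn) (simp only: mult_zero_right)
    show ?case
    proof (rule unimodular_root_if_sign_change[where T="T n" and V="V n" and ?\<theta>1.0="th \<alpha>1 n" and ?\<theta>2.0="th \<alpha>2 n"])
      show "Re (cis (- (real CARD('k) * (th \<alpha>1 n - th \<alpha>2 n) / 2)) *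
          (det (T n - mat (cis (th \<alpha>1 n)) ** V n) / det (T n - mat (cis (th \<alpha>2 n)) ** V n))) < 0"
        using elim(1) unfolding p_def c_def .
    qed (fact T V le nz)+
  qed
  then show ?thesis by (rule eventually_happens'[OF sequentially_bot])
qed

text \<open>The derivative of \<open>cis\<close> at zero, rescaled.\<close>

lemma phase_limit:
  assumes "filterlim \<rho> at_top F"
  shows "((\<lambda>n. 2 * \<i> * of_real (\<rho> n) * (1 - cis (- (\<alpha> / (2 * \<rho> n))))) \<longlongrightarrow> - of_real \<alpha>) F"
proof -
  have d: "((\<lambda>x. (cis (- (\<alpha> * x) / 2) - 1) / of_real x) \<longlongrightarrow> - (\<i> * of_real \<alpha> / 2)) (at_right 0)"
  proof -
    have "((\<lambda>z. exp (- (\<i> * of_real \<alpha> / 2) * z)) has_field_derivative - (\<i> * of_real \<alpha> / 2)) (at (0::complex))"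
      by (auto intro!: derivative_eq_intros)
    then have "((\<lambda>z. (exp (- (\<i> * of_real \<alpha> / 2) * z) - 1) / z) \<longlongrightarrow> - (\<i> * of_real \<alpha> / 2)) (at (0::complex))"
      by (simp add: DERIV_def)
    moreover have "filterlim complex_of_real (at 0) (at_right (0::real))"
    proof (rule filterlim_atI)
      have "(complex_of_real \<longlongrightarrow> of_real 0) (at_right 0)" by (intro tendsto_of_real tendsto_ident_at)
      then show "(complex_of_real \<longlongrightarrow> 0) (at_right 0)" by simp
      show "\<forall>\<^sub>F x in at_right 0. complex_of_real x \<noteq> 0"
        using eventually_at_right_less[of "0::real"] by eventually_elim simp
    qed
    ultimately have "((\<lambda>x. (exp (- (\<i> * of_real \<alpha> / 2) * of_real x) - 1) / of_real x) \<longlongrightarrow> - (\<i> * of_real \<alpha> / 2)) (at_right (0::real))"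
      by (rule filterlim_compose)
    then show ?thesis by (simp add: cis_conv_exp mult.assoc)
  qed
  have "filterlim (\<lambda>n. inverse (\<rho> n)) (at_right 0) F"
    by (rule filterlim_compose[OF filterlim_inverse_at_right_top assms])
  note lim = tendsto_mult_left[OF filterlim_compose[OF d this], of "- (2 * \<i>)"]
  have "- (2 * \<i>) * ((cis (- (\<alpha> * inverse r) / 2) - 1) / of_real (inverse r))
      = 2 * \<i> * of_real r * (1 - cis (- (\<alpha> / (2 * r))))" for r
  proof -
    have a: "- (\<alpha> * inverse r) / 2 = - (\<alpha> / (2 * r))" by (simp flip: divide_inverse)
    have b: "x / complex_of_real (inverse r) = x * of_real r" for x
      unfolding of_real_inverse divide_inverse inverse_inverse_eq ..
    have "- (2 * \<i>) * ((x - 1) * y) = 2 * \<i> * y * (1 - x)" for x y :: complex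
      by (simp add: algebra_simps)
    then show ?thesis unfolding a b .
  qed
  moreover have "- (2 * \<i>) * - (\<i> * complex_of_real \<alpha> / 2) = - of_real \<alpha>" by simp
  ultimately show ?thesis using lim by (simp only:)
qed

text \<open>The upper rows of the pencil are multiplied by \<open>2i\<rho>\<close>, the lower ones by \<open>2i\<rho>/\<gamma>\<close>, where \<open>\<gamma>\<close> compensates the
growth of the phase difference \<open>2i\<rho> (1 - exp(2\<pi>i\<rho>))\<close> of the two families. The case \<open>k = 1\<close> describes
families that interact, \<open>k = 0\<close> families that separate.\<close>

lemma scaled_pencil_limit:
  fixes T :: "nat \<Rightarrow> complex^('m::finite + 'm)^('m + 'm)" and \<rho> :: "nat \<Rightarrow> real" and \<gamma> :: "nat \<Rightarrow> complex"
  defines "s \<equiv> \<lambda>n. 2 * \<i> * complex_of_real (\<rho> n)"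
  assumes F: "\<And>i j. (\<lambda>n. s n * (T n - mat 1) $ i $ j) \<longlonglongrightarrow> block_matrix A 0 0 (- A) $ i $ j"
    and \<rho>: "filterlim \<rho> at_top sequentially"
    and g: "(\<lambda>n. 1 / \<gamma> n) \<longlonglongrightarrow> k" "(\<lambda>n. cis (2 * pi * \<rho> n) / \<gamma> n) \<longlonglongrightarrow> k"
      "(\<lambda>n. s n * (1 - cis (2 * pi * \<rho> n)) / \<gamma> n) \<longlonglongrightarrow> b"
  shows "(\<lambda>n. (block_matrix (mat (s n)) 0 0 (mat (s n / \<gamma> n))
        ** (T n - mat (cis (pi * \<rho> n - \<alpha> / (2 * \<rho> n))) ** phase_matrix (\<rho> n))) $ i $ j)
     \<longlonglongrightarrow> block_matrix (A - mat (of_real \<alpha>)) 0 0 (mat b - mat k ** (A + mat (of_real \<alpha>))) $ i $ j"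
proof -
  define R where "R = (\<lambda>n. block_matrix (mat (s n)) 0 0 (mat (s n / \<gamma> n) :: complex^'m^'m))"
  define z where "z = (\<lambda>n. cis (pi * \<rho> n - \<alpha> / (2 * \<rho> n)))"
  define e where "e = (\<lambda>n. s n * (1 - cis (- (\<alpha> / (2 * \<rho> n)))))"
  have e: "e \<longlonglongrightarrow> - of_real \<alpha>" unfolding e_def s_def by (rule phase_limit[OF \<rho>])
  have R1: "(R n ** M) $ Inl a $ j = s n * M $ Inl a $ j" "(R n ** M) $ Inr a $ j = s n / \<gamma> n * M $ Inr a $ j"
    for n M a j
    by (simp_all add: R_def matrix_matrix_mult_def sum_UNIV_sum mat_def if_distrib[of "\<lambda>x. x * _"] cong: if_cong)
  have zc: "z n * cis (- (pi * \<rho> n)) = cis (- (\<alpha> / (2 * \<rho> n)))"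
    "z n * cis (pi * \<rho> n) = cis (2 * pi * \<rho> n) * cis (- (\<alpha> / (2 * \<rho> n)))" for n
    unfolding z_def cis_mult by (rule arg_cong[of _ _ cis], simp)+
  have id: "(mat 1 :: complex^('m+'m)^('m+'m)) $ Inl a $ Inl b = (if a = b then 1 else 0)"
     "(mat 1 :: complex^('m+'m)^('m+'m)) $ Inl a $ Inr b = 0"
     "(mat 1 :: complex^('m+'m)^('m+'m)) $ Inr a $ Inl b = 0"
     "(mat 1 :: complex^('m+'m)^('m+'m)) $ Inr a $ Inr b = (if a = b then 1 else 0)" for a b
    by (simp_all add: mat_def)
  have Fg: "(\<lambda>n. (s n * (T n - mat 1) $ i $ j) * (1 / \<gamma> n)) \<longlonglongrightarrow> block_matrix A 0 0 (- A) $ i $ j * k" for i j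
    by (rule tendsto_mult[OF F g(1)])
  have "(\<lambda>n. (R n ** (T n - mat (z n) ** phase_matrix (\<rho> n))) $ i $ j)
     \<longlonglongrightarrow> block_matrix (A - mat (of_real \<alpha>)) 0 0 (mat b - mat k ** (A + mat (of_real \<alpha>))) $ i $ j"
  proof (cases i; cases j)
    fix a c assume ij: "i = Inl a" "j = Inl c"
    have eq1: "(R n ** (T n - mat (z n) ** phase_matrix (\<rho> n))) $ i $ j
        = s n * (T n - mat 1) $ Inl a $ Inl c + e n * (if a = c then 1 else 0)" for n
      unfolding ij R1 using zc(1)[of n]
      by (simp add: phase_matrix_def mat_mult_nth id mat_def[of "cis _"] e_def right_diff_distrib)
    have lim1: "(\<lambda>n. s n * (T n - mat 1) $ Inl a $ Inl c + e n * (if a = c then 1 else 0))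
       \<longlonglongrightarrow> block_matrix A 0 0 (- A) $ Inl a $ Inl c + - of_real \<alpha> * (if a = c then 1 else 0)"
      by (intro tendsto_add F tendsto_mult e tendsto_const)
    have eq2: "block_matrix A 0 0 (- A) $ Inl a $ Inl c + - of_real \<alpha> * (if a = c then 1 else 0)
        = block_matrix (A - mat (of_real \<alpha>)) 0 0 (mat b - mat k ** (A + mat (of_real \<alpha>))) $ Inl a $ Inl c"
      by (simp add: mat_def[of "of_real \<alpha>"])
    show ?thesis unfolding eq1 unfolding ij eq2[symmetric] by (rule lim1)
  next
    fix a c assume ij: "i = Inl a" "j = Inr c"
    have "(R n ** (T n - mat (z n) ** phase_matrix (\<rho> n))) $ i $ j = s n * (T n - mat 1) $ Inl a $ Inr c" for n
      unfolding ij R1 by (simp add: phase_matrix_def mat_mult_nth id)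
    then show ?thesis using F[of "Inl a" "Inr c"] unfolding ij by simp
  next
    fix a c assume ij: "i = Inr a" "j = Inl c"
    have "(R n ** (T n - mat (z n) ** phase_matrix (\<rho> n))) $ i $ j = (s n * (T n - mat 1) $ Inr a $ Inl c) * (1 / \<gamma> n)" for n
      unfolding ij R1 by (simp add: phase_matrix_def mat_mult_nth id)
    then show ?thesis using Fg[of "Inr a" "Inl c"] unfolding ij by simp
  next
    fix a c assume ij: "i = Inr a" "j = Inr c"
    have eq1: "(R n ** (T n - mat (z n) ** phase_matrix (\<rho> n))) $ i $ j
        = (s n * (T n - mat 1) $ Inr a $ Inr c) * (1 / \<gamma> n)
          + (s n * (1 - cis (2 * pi * \<rho> n)) / \<gamma> n + (cis (2 * pi * \<rho> n) / \<gamma> n) * e n) * (if a = c then 1 else 0)" for n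
    proof -
      have "(R n ** (T n - mat (z n) ** phase_matrix (\<rho> n))) $ i $ j
        = s n / \<gamma> n * (T n $ Inr a $ Inr c - (z n * cis (pi * \<rho> n)) * (if a = c then 1 else 0))"
        unfolding ij R1 by (simp add: phase_matrix_def mat_mult_nth mat_def[of "cis _"])
      moreover have "x / g * (t - (c * y) * d) = (x * (t - d)) * (1 / g) + (x * (1 - c) / g + (c / g) * (x * (1 - y))) * d"
        for x g t c y d :: complex
        unfolding divide_inverse by algebra
      ultimately show ?thesis unfolding zc(2) e_def by (simp only: id vector_minus_component)
    qed
    have lim1: "(\<lambda>n. (s n * (T n - mat 1) $ Inr a $ Inr c) * (1 / \<gamma> n)
          + (s n * (1 - cis (2 * pi * \<rho> n)) / \<gamma> n + (cis (2 * pi * \<rho> n) / \<gamma> n) * e n) * (if a = c then 1 else 0))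
       \<longlonglongrightarrow> block_matrix A 0 0 (- A) $ Inr a $ Inr c * k + (b + k * - of_real \<alpha>) * (if a = c then 1 else 0)"
      by (intro tendsto_add Fg tendsto_mult e g tendsto_const)
    have eq2: "block_matrix A 0 0 (- A) $ Inr a $ Inr c * k + (b + k * - of_real \<alpha>) * (if a = c then 1 else 0)
        = block_matrix (A - mat (of_real \<alpha>)) 0 0 (mat b - mat k ** (A + mat (of_real \<alpha>))) $ Inr a $ Inr c"
      by (simp add: mat_mult_nth mat_def[of b] mat_def[of "of_real \<alpha>"] distrib_left)
    show ?thesis unfolding eq1 unfolding ij eq2[symmetric] by (rule lim1)
  qed
  then show ?thesis unfolding R_def z_def .
qed

text \<open>Along a subsequence the two families of multipliers either stay at a distance of order \<open>1/\<rho>\<close> from each other, or they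
separate at that scale. In the first case the limit \<open>b\<close> is real because
\<open>Im \<beta> = \<bar>\<beta>\<bar>\<^sup>2 / (4\<rho>)\<close>.\<close>

lemma phase_gap_subsequence:
  fixes \<rho> :: "nat \<Rightarrow> real"
  assumes \<rho>: "filterlim \<rho> at_top sequentially"
  defines "\<beta> \<equiv> \<lambda>n. 2 * \<i> * complex_of_real (\<rho> n) * (1 - cis (2 * pi * \<rho> n))"
  obtains (bounded) r b where "strict_mono r" "(\<beta> \<circ> r) \<longlonglongrightarrow> complex_of_real b" "(\<lambda>n. cis (2 * pi * \<rho> (r n))) \<longlonglongrightarrow> 1"
    | (unbounded) "filterlim \<beta> at_infinity sequentially"
proof (cases "filterlim \<beta> at_infinity sequentially")
  case True
  then show ?thesis by (rule unbounded)
next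
  case False
  then obtain B where B: "\<not> (\<forall>\<^sub>F n in sequentially. B \<le> norm (\<beta> n))"
    unfolding filterlim_at_infinity[OF order_refl] by blast
  then have "infinite {n. norm (\<beta> n) < B}"
    unfolding eventually_sequentially infinite_nat_iff_unbounded_le by (auto simp: not_le)
  then obtain r :: "nat \<Rightarrow> nat" where r: "strict_mono r" "\<And>n. norm (\<beta> (r n)) < B"
    using infinite_enumerate by blast
  have "bounded (range (\<beta> \<circ> r))" unfolding bounded_iff using r(2) by (auto intro!: exI[of _ B] less_imp_le)
  from bounded_imp_convergent_subsequence[OF this]
  obtain l and r' :: "nat \<Rightarrow> nat" where r': "strict_mono r'" and l: "((\<beta> \<circ> r) \<circ> r') \<longlonglongrightarrow> l"
    by blast
  define q where "q = r \<circ> r'"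
  have q: "strict_mono q" unfolding q_def by (rule strict_mono_o[OF r(1) r'])
  have lq: "(\<lambda>n. \<beta> (q n)) \<longlonglongrightarrow> l" using l by (simp add: q_def o_def)
  have \<rho>q: "filterlim (\<lambda>n. \<rho> (q n)) at_top sequentially"
    by (rule filterlim_compose[OF \<rho> filterlim_subseq[OF q]])
  have inv: "(\<lambda>n. inverse (\<rho> (q n))) \<longlonglongrightarrow> 0" by (rule tendsto_inverse_0_at_top[OF \<rho>q])
  have pos: "\<forall>\<^sub>F n in sequentially. \<rho> (q n) > 0" using \<rho>q unfolding filterlim_at_top_dense by (rule spec)
  have im: "Im (\<beta> n) = (norm (\<beta> n))\<^sup>2 * inverse (\<rho> n) / 4" if "\<rho> n > 0" for n
  proof -
    let ?x = "2 * pi * \<rho> n"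
    have "(norm (1 - cis ?x))\<^sup>2 = (1 - cos ?x)\<^sup>2 + (sin ?x)\<^sup>2" by (simp add: cmod_power2)
    also have "\<dots> = 1 - 2 * cos ?x + ((sin ?x)\<^sup>2 + (cos ?x)\<^sup>2)" by (simp add: power2_eq_square algebra_simps)
    also have "\<dots> = 2 * (1 - cos ?x)" by simp
    finally have "(norm (\<beta> n))\<^sup>2 = 8 * (\<rho> n)\<^sup>2 * (1 - cos ?x)"
      by (simp add: \<beta>_def norm_mult power_mult_distrib)
    moreover have "Im (\<beta> n) = 2 * \<rho> n * (1 - cos ?x)" by (simp add: \<beta>_def)
    ultimately show ?thesis using that by (simp add: power2_eq_square)
  qed
  have "(\<lambda>n. (norm (\<beta> (q n)))\<^sup>2 * inverse (\<rho> (q n)) / 4) \<longlonglongrightarrow> (norm l)\<^sup>2 * 0 / 4"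
    by (intro tendsto_intros lq inv) simp_all
  then have "(\<lambda>n. (norm (\<beta> (q n)))\<^sup>2 * inverse (\<rho> (q n)) / 4) \<longlonglongrightarrow> 0"
    by (simp only: mult_zero_right div_0)
  then have "(\<lambda>n. Im (\<beta> (q n))) \<longlonglongrightarrow> 0"
  proof (rule Lim_transform_eventually)
    show "\<forall>\<^sub>F n in sequentially. (norm (\<beta> (q n)))\<^sup>2 * inverse (\<rho> (q n)) / 4 = Im (\<beta> (q n))"
      using pos by eventually_elim (rule im[symmetric])
  qed
  with tendsto_Im[OF lq] have "Im l = 0" using LIMSEQ_unique by blast
  then have l: "l = complex_of_real (Re l)" by (simp add: complex_eq_iff)
  have "(\<lambda>n. 1 - \<beta> (q n) * (of_real (inverse (\<rho> (q n))) / (2 * \<i>))) \<longlonglongrightarrow> 1 - l * (of_real 0 / (2 * \<i>))"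
    by (intro tendsto_intros lq inv) simp
  then have "(\<lambda>n. 1 - \<beta> (q n) * (of_real (inverse (\<rho> (q n))) / (2 * \<i>))) \<longlonglongrightarrow> 1"
    by (simp only: of_real_0 div_0 mult_zero_right diff_zero)
  then have "(\<lambda>n. cis (2 * pi * \<rho> (q n))) \<longlonglongrightarrow> 1"
  proof (rule Lim_transform_eventually)
    have c: "1 - 2 * y * x * (1 - c) * (inverse x / (2 * y)) = c" if "x \<noteq> 0" "y \<noteq> 0" for x y c :: complex
    proof -
      have "2 * y * x * (1 - c) * (inverse x / (2 * y)) = (x * inverse x) * (1 - c) * ((2 * y) / (2 * y))"
        unfolding divide_inverse by (simp only: mult_ac)
      then have "2 * y * x * (1 - c) * (inverse x / (2 * y)) = 1 - c" using that by (simp only: right_inverse) simp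
      then show ?thesis by (simp only: diff_diff_eq2) simp
    qed
    show "\<forall>\<^sub>F n in sequentially. 1 - \<beta> (q n) * (of_real (inverse (\<rho> (q n))) / (2 * \<i>)) = cis (2 * pi * \<rho> (q n))"
      using pos
    proof eventually_elim
      case (elim n)
      then show ?case unfolding \<beta>_def of_real_inverse by (intro c) simp_all
    qed
  qed
  note cis1 = this
  have "(\<beta> \<circ> q) \<longlonglongrightarrow> complex_of_real (Re l)" unfolding o_def l[symmetric] by (rule lq)
  then show ?thesis by (rule bounded[OF q _ cis1])
qed

section \<open>Existence of a unimodular multiplier\<close>

text \<open>The symmetry about 0 becomes a symmetry about the midpoint of the period.\<close>

lemma cnj_matrix_reflect_AE:
  fixes Q :: "real \<Rightarrow> complex^'m^'m"
  assumes PT: "\<And>i j. AE x in lebesgue. cnj (Q (- x) $ i $ j) = Q x $ i $ j"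
    and per: "AE x in lebesgue. Q (x + p) = Q x"
  shows "AE t in lebesgue. cnj_matrix (Q (p - t)) = Q t"
proof -
  have "AE x in lebesgue. \<forall>i\<in>UNIV. \<forall>j\<in>UNIV. cnj (Q (- x) $ i $ j) = Q x $ i $ j"
    by (intro AE_finite_allI finite PT)
  then have "AE x in lebesgue. cnj_matrix (Q (- x)) = Q x"
    by eventually_elim (simp add: vec_eq_iff map_matrix_def)
  from AE_lebesgue_translate[OF this, of "- p"] AE_lebesgue_translate[OF per, of "- p"]
  show ?thesis by eventually_elim simp
qed

lemma charpoly_split_root:
  fixes A :: "complex^'m^'m" and \<mu> :: real
  assumes nz: "charpoly A \<noteq> 0"
  obtains q where "poly q (of_real \<mu>) \<noteq> 0"
    "\<And>\<alpha>. poly (charpoly A) (of_real \<alpha>) = of_real (\<alpha> - \<mu>) ^ alg_multiplicity A (of_real \<mu>) * poly q (of_real \<alpha>)"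
proof -
  obtain q where q: "charpoly A = [:- of_real \<mu>, 1:] ^ order (of_real \<mu>) (charpoly A) * q"
    and nd: "\<not> [:- complex_of_real \<mu>, 1:] dvd q"
    using order_decomp[OF nz, of "of_real \<mu>"] by blast
  show ?thesis
  proof (rule that)
    show "poly q (of_real \<mu>) \<noteq> 0" using nd by (simp add: poly_eq_0_iff_dvd)
    show "poly (charpoly A) (of_real \<alpha>) = of_real (\<alpha> - \<mu>) ^ alg_multiplicity A (of_real \<mu>) * poly q (of_real \<alpha>)" for \<alpha>
    proof -
      have "poly (charpoly A) (of_real \<alpha>)
          = poly ([:- of_real \<mu>, 1:] ^ order (of_real \<mu>) (charpoly A) * q) (of_real \<alpha>)"
        by (rule arg_cong[OF q])
      then show ?thesis by (simp add: alg_multiplicity_def)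
    qed
  qed
qed

text \<open>The limit of the rescaled pencil has the determinant \<open>det (A - \<alpha>) h(\<alpha>)\<close>, where \<open>h(\<alpha>)\<close> is \<open>det (b - \<alpha> - A)\<close> or \<open>1\<close>. At an
eigenvalue \<open>\<mu>\<close> of odd multiplicity it changes sign, provided that \<open>b - \<mu>\<close> is not an eigenvalue; the set \<open>M\<close> provides such a
\<open>\<mu>\<close> for every \<open>b\<close>.\<close>

lemma unimodular_root_at_high_energy:
  fixes Q :: "real \<Rightarrow> complex^'m^'m" and A :: "complex^'m^'m" and \<rho> :: "nat \<Rightarrow> real"
    and T :: "nat \<Rightarrow> complex^('m + 'm)^('m + 'm)"
  assumes T: "\<And>n. T n ** cnj_matrix (T n) = mat 1"
    and F: "\<And>i j. (\<lambda>n. 2 * \<i> * of_real (\<rho> n) * (T n - mat 1) $ i $ j) \<longlonglongrightarrow> block_matrix A 0 0 (- A) $ i $ j"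
    and \<rho>: "filterlim \<rho> at_top sequentially" and pos: "\<And>n. \<rho> n > 0"
    and nz: "charpoly A \<noteq> 0"
    and M: "M \<noteq> {}" "\<And>\<mu>. \<mu> \<in> M \<Longrightarrow> odd (alg_multiplicity A (of_real \<mu>))"
    and sep: "\<And>b. \<exists>\<mu>\<in>M. \<not> is_eigenvalue A (of_real (b - \<mu>))"
  shows "\<exists>n \<theta>. det (T n - mat (cis \<theta>) ** phase_matrix (\<rho> n)) = 0"
proof -
  define s where "s = (\<lambda>n. 2 * \<i> * complex_of_real (\<rho> n))"
  have s0: "s n \<noteq> 0" for n using pos[of n] by (simp add: s_def)
  \<comment> \<open>the part common to both alternatives; \<open>h\<close> is the contribution of the second family\<close>
  have main: "\<exists>n \<theta>. det (T (r n) - mat (cis \<theta>) ** phase_matrix (\<rho> (r n))) = 0"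
    if r: "strict_mono r" and g0: "\<And>n. \<gamma> n \<noteq> 0"
      and g: "(\<lambda>n. 1 / \<gamma> n) \<longlonglongrightarrow> k" "(\<lambda>n. cis (2 * pi * \<rho> (r n)) / \<gamma> n) \<longlonglongrightarrow> k"
        "(\<lambda>n. s (r n) * (1 - cis (2 * pi * \<rho> (r n))) / \<gamma> n) \<longlonglongrightarrow> b"
      and \<mu>: "\<mu> \<in> M" and h: "\<And>\<alpha>. det (mat b - mat k ** (A + mat (complex_of_real \<alpha>))) = poly h (of_real \<alpha>)"
      and h0: "poly h (of_real \<mu>) \<noteq> 0"
    for r :: "nat \<Rightarrow> nat" and \<gamma> k b \<mu> h
  proof -
    define L where "L = (\<lambda>\<alpha>. block_matrix (A - mat (complex_of_real \<alpha>)) 0 0 (mat b - mat k ** (A + mat (of_real \<alpha>))))"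
    obtain q where q0: "poly q (complex_of_real \<mu>) \<noteq> 0"
      and q: "\<And>\<alpha>. poly (charpoly A) (of_real \<alpha>) = of_real (\<alpha> - \<mu>) ^ alg_multiplicity A (of_real \<mu>) * poly q (of_real \<alpha>)"
      by (rule charpoly_split_root[OF nz, of \<mu>], rule that)
    define U where "U = (\<lambda>\<alpha>. (-1) ^ CARD('m) * poly q (complex_of_real \<alpha>) * poly h (of_real \<alpha>))"
    have L: "det (L \<alpha>) = of_real (\<alpha> - \<mu>) ^ alg_multiplicity A (of_real \<mu>) * U \<alpha>" for \<alpha>
      unfolding L_def det_block_diagonal det_minus_mat h q U_def by (simp only: mult_ac)
    have "isCont U \<mu>" unfolding U_def by (intro continuous_intros)
    moreover have "U \<mu> \<noteq> 0" using q0 h0 by (simp add: U_def)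
    ultimately obtain \<alpha>1 \<alpha>2 where \<alpha>: "\<alpha>2 < \<alpha>1" "det (L \<alpha>2) \<noteq> 0" "Re (det (L \<alpha>1) / det (L \<alpha>2)) < 0"
      using odd_zero_sign_change[where U=U, OF _ _ M(2)[OF \<mu>]] unfolding L by blast
    have \<rho>r: "filterlim (\<lambda>n. \<rho> (r n)) at_top sequentially"
      by (rule filterlim_compose[OF \<rho> filterlim_subseq[OF r]])
    have Fr: "(\<lambda>n. 2 * \<i> * of_real (\<rho> (r n)) * (T (r n) - mat 1) $ i $ j) \<longlonglongrightarrow> block_matrix A 0 0 (- A) $ i $ j" for i j
      using LIMSEQ_subseq_LIMSEQ[OF F r] by (simp only: o_def)
    show ?thesis
    proof (rule unimodular_root_if_limit_changes_sign[where T="\<lambda>n. T (r n)" and V="\<lambda>n. phase_matrix (\<rho> (r n))" and L=L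
          and R="\<lambda>n. block_matrix (mat (s (r n))) 0 0 (mat (s (r n) / \<gamma> n))", OF T phase_matrix_unitary _ \<rho>r _ \<alpha>])
      show "det (block_matrix (mat (s (r n))) 0 0 (mat (s (r n) / \<gamma> n) :: complex^'m^'m)) \<noteq> 0" for n
        using s0 g0 by (simp add: det_block_diagonal det_mat)
      show "(\<lambda>n. (block_matrix (mat (s (r n))) 0 0 (mat (s (r n) / \<gamma> n))
          ** (T (r n) - mat (cis (pi * \<rho> (r n) - \<alpha> / (2 * \<rho> (r n)))) ** phase_matrix (\<rho> (r n)))) $ i $ j) \<longlonglongrightarrow> L \<alpha> $ i $ j"
        for \<alpha> i j
        unfolding L_def s_def by (rule scaled_pencil_limit[OF Fr \<rho>r g[unfolded s_def]])
    qed
  qed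
  from \<rho> show ?thesis
  proof (cases rule: phase_gap_subsequence)
    case (bounded r b)
    obtain \<mu> where \<mu>: "\<mu> \<in> M" "\<not> is_eigenvalue A (of_real (b - \<mu>))" using sep by blast
    define h where "h = pcompose (charpoly A) [:complex_of_real b, -1:]"
    have h: "det (mat (of_real b) - mat 1 ** (A + mat (of_real \<alpha>))) = poly h (complex_of_real \<alpha>)" for \<alpha>
    proof -
      have "mat (of_real b) - mat 1 ** (A + mat (of_real \<alpha>)) = mat (complex_of_real b - of_real \<alpha>) - A"
        unfolding matrix_mul_lid by (simp add: vec_eq_iff mat_def)
      then show ?thesis unfolding h_def poly_pcompose poly_charpoly by (simp only:) simp
    qed
    have h0: "poly h (of_real \<mu>) \<noteq> 0"
      using \<mu>(2) by (simp add: h_def poly_pcompose is_eigenvalue_iff_root)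
    have "\<exists>n \<theta>. det (T (r n) - mat (cis \<theta>) ** phase_matrix (\<rho> (r n))) = 0"
    proof (rule main[OF bounded(1) _ _ _ _ \<mu>(1) h h0, where \<gamma>="\<lambda>_. 1"])
      show "(\<lambda>n. s (r n) * (1 - cis (2 * pi * \<rho> (r n))) / 1) \<longlonglongrightarrow> of_real b"
        using bounded(2) by (simp add: s_def o_def)
    qed (use bounded(3) in simp_all)
    then show ?thesis by blast
  next
    case unbounded
    define \<beta> where "\<beta> = (\<lambda>n. s n * (1 - cis (2 * pi * \<rho> n)))"
    have lim: "filterlim \<beta> at_infinity sequentially" using unbounded by (simp add: \<beta>_def s_def)
    then have "\<forall>\<^sub>F n in sequentially. 1 \<le> norm (\<beta> n)"
      using filterlim_at_infinity[of 0 \<beta> sequentially] by auto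
    then obtain N where N: "\<And>n. n \<ge> N \<Longrightarrow> 1 \<le> norm (\<beta> n)" unfolding eventually_sequentially by blast
    define r where "r = (\<lambda>n. n + N)"
    have r: "strict_mono r" by (simp add: r_def strict_mono_def)
    have b0: "\<beta> (r n) \<noteq> 0" for n using N[of "r n"] by (auto simp: r_def)
    have inv: "(\<lambda>n. 1 / \<beta> (r n)) \<longlonglongrightarrow> 0"
      using filterlim_compose[OF tendsto_inverse_0 filterlim_compose[OF lim filterlim_subseq[OF r]]]
      by (simp only: inverse_eq_divide)
    obtain \<mu> where \<mu>: "\<mu> \<in> M" using M(1) by blast
    have "\<exists>n \<theta>. det (T (r n) - mat (cis \<theta>) ** phase_matrix (\<rho> (r n))) = 0"
    proof (rule main[OF r b0 inv _ _ \<mu>, where b=1 and h=1])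
      show "(\<lambda>n. cis (2 * pi * \<rho> (r n)) / \<beta> (r n)) \<longlonglongrightarrow> 0"
        by (rule tendsto_norm_zero_cancel) (use tendsto_norm_zero[OF inv] in \<open>simp add: norm_divide\<close>)
      have "s (r n) * (1 - cis (2 * pi * \<rho> (r n))) / \<beta> (r n) = 1" for n
        using b0[of n] unfolding \<beta>_def by (rule divide_self)
      then show "(\<lambda>n. s (r n) * (1 - cis (2 * pi * \<rho> (r n))) / \<beta> (r n)) \<longlonglongrightarrow> 1" by simp
      have "mat 1 - mat 0 ** (A + mat (complex_of_real \<alpha>)) = (mat 1 :: complex^'m^'m)" for \<alpha>
        by (simp add: vec_eq_iff mat_mult_nth)
      then show "det (mat 1 - mat 0 ** (A + mat (complex_of_real \<alpha>))) = poly 1 (of_real \<alpha>)" for \<alpha> by simp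
    qed simp
    then show ?thesis by blast
  qed
qed

text \<open>Otherwise the three sums \<open>\<mu> j + \<mu> i\<close> all equal \<open>b\<close> for suitable \<open>i\<close>, so one of the diameters is zero; diameters being nonnegative,
the minimum is zero.\<close>

lemma three_shifts_separated:
  fixes \<mu> :: "nat \<Rightarrow> real"
  assumes d: "Min {diameter {\<mu> j1 + \<mu> i1, \<mu> j2 + \<mu> i2, \<mu> j3 + \<mu> i3} | i1 i2 i3.
                      i1 \<in> {1..s} \<and> i2 \<in> {1..s} \<and> i3 \<in> {1..s}} = d" "d \<noteq> 0"
  shows "\<exists>j\<in>{j1, j2, j3}. b - \<mu> j \<notin> \<mu> ` {1..s}"
proof (rule ccontr)
  assume "\<not> ?thesis"
  then have "b - \<mu> j1 \<in> \<mu> ` {1..s}" "b - \<mu> j2 \<in> \<mu> ` {1..s}" "b - \<mu> j3 \<in> \<mu> ` {1..s}" by blast+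
  then obtain i1 i2 i3 where i: "i1 \<in> {1..s}" "i2 \<in> {1..s}" "i3 \<in> {1..s}"
    and e: "b - \<mu> j1 = \<mu> i1" "b - \<mu> j2 = \<mu> i2" "b - \<mu> j3 = \<mu> i3"
    by (elim imageE) (rule that)
  let ?D = "\<lambda>(i1, i2, i3). diameter {\<mu> j1 + \<mu> i1, \<mu> j2 + \<mu> i2, \<mu> j3 + \<mu> i3}"
  let ?S = "{diameter {\<mu> j1 + \<mu> i1, \<mu> j2 + \<mu> i2, \<mu> j3 + \<mu> i3} | i1 i2 i3.
      i1 \<in> {1..s} \<and> i2 \<in> {1..s} \<and> i3 \<in> {1..s}}"
  have "?S \<subseteq> ?D ` ({1..s} \<times> {1..s} \<times> {1..s})"
  proof
    fix y assume "y \<in> ?S"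
    then obtain k1 k2 k3 where "k1 \<in> {1..s}" "k2 \<in> {1..s}" "k3 \<in> {1..s}" 
      "y = diameter {\<mu> j1 + \<mu> k1, \<mu> j2 + \<mu> k2, \<mu> j3 + \<mu> k3}"
      by blast
    then show "y \<in> ?D ` ({1..s} \<times> {1..s} \<times> {1..s})"
      by (intro image_eqI[of _ _ "(k1, k2, k3)"] SigmaI) simp_all
  qed
  then have fin: "finite ?S" by (rule finite_subset) (intro finite_imageI finite_cartesian_product finite_atLeastAtMost)
  have "\<mu> j1 + \<mu> i1 = b" "\<mu> j2 + \<mu> i2 = b" "\<mu> j3 + \<mu> i3 = b" using e by linarith+
  then have "diameter {\<mu> j1 + \<mu> i1, \<mu> j2 + \<mu> i2, \<mu> j3 + \<mu> i3} = 0" by (simp only: insert_absorb2 diameter_singleton)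
  then have z: "0 \<in> ?S" unfolding mem_Collect_eq using i by (intro exI[of _ i1] exI[of _ i2] exI[of _ i3] conjI) simp_all
  have "Min ?S = 0"
  proof (rule Min_eqI[OF fin _ z])
    fix y assume "y \<in> ?S"
    then obtain k1 k2 k3 where y: "y = diameter {\<mu> j1 + \<mu> k1, \<mu> j2 + \<mu> k2, \<mu> j3 + \<mu> k3}" by blast
    show "0 \<le> y" unfolding y by (intro diameter_ge_0 finite_imp_bounded) simp
  qed
  then show False using d by (simp only: simp_thms)
qed

section \<open>Half-lines in the spectrum\<close>

theorem theorem7:
  fixes Q :: "real \<Rightarrow> complex^'m^'m"
    and A :: "complex^'m^'m"
    and \<mu> :: "nat \<Rightarrow> real"
    and s j1 j2 j3 :: nat
    and d :: real
  assumes PT: "\<And>i j. AE x in lebesgue. cnj (Q (- x) $ i $ j) = Q x $ i $ j"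
    and periodic: "\<And>i j. AE x in lebesgue. Q (x + pi) $ i $ j = Q x $ i $ j"
    and Q_L2: "\<And>i j. (\<lambda>x. Q x $ i $ j) \<in> L2_space (lebesgue_on {0..pi})"
    and A_def: "A = (\<chi> i j. integral {0..pi} (\<lambda>x. Q x $ i $ j))"
    and \<mu>_increasing: "strict_mono_on {1..s} \<mu>"
    and \<mu>_eigenvalues: "\<mu> ` {1..s} = {r. is_eigenvalue A (complex_of_real r)}"
    and j_range: "j1 \<in> {1..s}" "j2 \<in> {1..s}" "j3 \<in> {1..s}"
    and j_distinct: "distinct [j1, j2, j3]"
    and odd_mult: "\<And>j. j \<in> {j1, j2, j3} \<Longrightarrow> odd (alg_multiplicity A (complex_of_real (\<mu> j)))"
    and min_diam: "Min {diameter {\<mu> j1 + \<mu> i1, \<mu> j2 + \<mu> i2, \<mu> j3 + \<mu> i3} | i1 i2 i3.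
                      i1 \<in> {1..s} \<and> i2 \<in> {1..s} \<and> i3 \<in> {1..s}} = d"
    and d_nonzero: "d \<noteq> 0"
  shows "\<exists>H::real. complex_of_real ` {H..} \<subseteq> schroedinger_spectrum Q"
proof (rule ccontr)
  assume "\<not> ?thesis"
  then have notin: "\<exists>l\<ge>H. complex_of_real l \<notin> schroedinger_spectrum Q" for H by (auto simp: image_subset_iff)
  have Qi: "(\<lambda>x. Q x $ i $ j) absolutely_integrable_on {0..pi}" for i j
  proof -
    have m: "(\<lambda>x. Q x $ i $ j) \<in> borel_measurable (lebesgue_on {0..pi})"
      and sq: "integrable (lebesgue_on {0..pi}) (\<lambda>x. (norm (Q x $ i $ j))\<^sup>2)"
      using Q_L2[of i j] by (auto simp: L2_space_def)
    have sqi: "(\<lambda>x. (norm (Q x $ i $ j))\<^sup>2) integrable_on {0..pi}"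
      by (rule integrable_on_lebesgue_on[OF sq]) simp
    show ?thesis
    proof (rule measurable_bounded_by_integrable_imp_absolutely_integrable[OF m])
      show "(\<lambda>x. 1 + (norm (Q x $ i $ j))\<^sup>2) integrable_on {0..pi}"
        by (intro integrable_add sqi integrable_const_ivl)
      show "norm (Q x $ i $ j) \<le> 1 + (norm (Q x $ i $ j))\<^sup>2" for x
      proof -
        have "2 * norm (Q x $ i $ j) \<le> (norm (Q x $ i $ j))\<^sup>2 + 1"
          using zero_le_power2[of "norm (Q x $ i $ j) - 1"] by (simp add: power2_diff)
        then show ?thesis using norm_ge_zero[of "Q x $ i $ j"] by linarith
      qed
    qed simp
  qed
  have "AE x in lebesgue. \<forall>i\<in>UNIV. \<forall>j\<in>UNIV. Q (x + pi) $ i $ j = Q x $ i $ j"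
    by (intro AE_finite_allI finite periodic)
  then have per: "AE x in lebesgue. Q (x + pi) = Q x"
    by eventually_elim (simp add: vec_eq_iff)
  obtain R C where R: "R > 0" and TM: "\<And>\<rho>. \<rho> \<ge> R \<Longrightarrow> \<exists>T :: complex^('m + 'm)^('m + 'm).
      T ** cnj_matrix T = mat 1 \<and>
      norm (T - mat 1 - integral {0..pi} (wave_kernel Q \<rho>)) \<le> C / \<rho>\<^sup>2 \<and>
      (\<forall>z. norm z = 1 \<longrightarrow> det (T - mat z ** phase_matrix \<rho>) = 0 \<longrightarrow> complex_of_real (\<rho>\<^sup>2) \<in> schroedinger_spectrum Q)"
    by (rule transfer_matrix[OF Qi cnj_matrix_reflect_AE[OF PT per] per], rule that)
  \<comment> \<open>energies outside of the spectrum that tend to infinity and are in the range of the asymptotics\<close>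
  have "\<exists>l. l \<ge> (R + real n)\<^sup>2 \<and> complex_of_real l \<notin> schroedinger_spectrum Q" for n :: nat
    using notin by blast
  then obtain l where l: "\<And>n :: nat. l n \<ge> (R + real n)\<^sup>2" "\<And>n. complex_of_real (l n) \<notin> schroedinger_spectrum Q"
    by metis
  define \<rho> where "\<rho> = (\<lambda>n. sqrt (l n))"
  have ge: "\<rho> n \<ge> R + real n" for n
    unfolding \<rho>_def using l(1)[of n] R by (intro real_le_rsqrt)
  have pos: "\<rho> n > 0" and geR: "\<rho> n \<ge> R" for n using ge[of n] R by linarith+
  have "0 \<le> l n" for n using l(1)[of n] zero_le_power2[of "R + real n"] by linarith
  then have sq: "(\<rho> n)\<^sup>2 = l n" for n by (simp add: \<rho>_def)
  have \<rho>: "filterlim \<rho> at_top sequentially"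
  proof (rule filterlim_at_top_mono[OF filterlim_real_sequentially])
    have "real n \<le> \<rho> n" for n using ge[of n] R by linarith
    then show "\<forall>\<^sub>F n in sequentially. real n \<le> \<rho> n" by simp
  qed
  have "\<exists>T :: complex^('m + 'm)^('m + 'm). T ** cnj_matrix T = mat 1 \<and>
      norm (T - mat 1 - integral {0..pi} (wave_kernel Q (\<rho> n))) \<le> C / (\<rho> n)\<^sup>2 \<and>
      (\<forall>z. norm z = 1 \<longrightarrow> det (T - mat z ** phase_matrix (\<rho> n)) \<noteq> 0)" (is "\<exists>T. ?P n T") for n
  proof -
    from TM[OF geR[of n]] obtain T :: "complex^('m + 'm)^('m + 'm)" where
      1: "T ** cnj_matrix T = mat 1" "norm (T - mat 1 - integral {0..pi} (wave_kernel Q (\<rho> n))) \<le> C / (\<rho> n)\<^sup>2"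
      and 2: "\<forall>z. norm z = 1 \<longrightarrow> det (T - mat z ** phase_matrix (\<rho> n)) = 0 \<longrightarrow> complex_of_real ((\<rho> n)\<^sup>2) \<in> schroedinger_spectrum Q"
      by (elim exE conjE) (rule that)
    have "\<forall>z. norm z = 1 \<longrightarrow> det (T - mat z ** phase_matrix (\<rho> n)) \<noteq> 0"
      using 2 l(2)[of n] unfolding sq by simp
    with 1 show ?thesis by (intro exI[of _ T] conjI)
  qed
  then have "\<forall>n. \<exists>T. ?P n T" by (rule allI)
  from choice[OF this] obtain T :: "nat \<Rightarrow> complex^('m + 'm)^('m + 'm)" where T': "\<forall>n. ?P n (T n)" by (rule exE)
  have T: "\<And>n. T n ** cnj_matrix (T n) = mat 1"
    and Ta: "\<And>n. norm (T n - mat 1 - integral {0..pi} (wave_kernel Q (\<rho> n))) \<le> C / (\<rho> n)\<^sup>2"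
    and Tn: "\<And>n z. norm z = 1 \<Longrightarrow> det (T n - mat z ** phase_matrix (\<rho> n)) \<noteq> 0"
    using T' by simp_all
  let ?I = "\<lambda>n. integral {0..pi} (wave_kernel Q (\<rho> n))"
  have F: "(\<lambda>n. 2 * \<i> * of_real (\<rho> n) * (T n - mat 1) $ i $ j) \<longlonglongrightarrow> block_matrix A 0 0 (- A) $ i $ j" for i j
  proof -
    \<comment> \<open>the quadratic error of the expansion, multiplied by \<open>2i\<rho>\<close>, is \<open>O(1/\<rho>)\<close>\<close>
    have err: "(\<lambda>n. 2 * \<i> * of_real (\<rho> n) * (T n - mat 1 - ?I n) $ i $ j) \<longlonglongrightarrow> 0"
    proof (rule Lim_null_comparison[where g="\<lambda>n. 2 * C * inverse (\<rho> n)"])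
      show "(\<lambda>n. 2 * C * inverse (\<rho> n)) \<longlonglongrightarrow> 0"
        by (rule tendsto_mult_right_zero[OF tendsto_inverse_0_at_top[OF \<rho>]])
      have "norm (2 * \<i> * of_real (\<rho> n) * (T n - mat 1 - ?I n) $ i $ j) \<le> 2 * C * inverse (\<rho> n)" for n
      proof -
        have "norm ((T n - mat 1 - ?I n) $ i $ j) \<le> C / (\<rho> n)\<^sup>2"
          by (rule order_trans[OF Finite_Cartesian_Product.norm_nth_le order_trans[OF Finite_Cartesian_Product.norm_nth_le Ta]])
        then have "2 * \<rho> n * norm ((T n - mat 1 - ?I n) $ i $ j) \<le> 2 * \<rho> n * (C / (\<rho> n)\<^sup>2)"
          using pos[of n] by (intro mult_left_mono) auto
        also have "\<dots> = 2 * C * inverse (\<rho> n)" using pos[of n] by (simp add: power2_eq_square field_simps)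
        finally show ?thesis using pos[of n] by (simp only: norm_mult) simp
      qed
      then show "\<forall>\<^sub>F n in sequentially. norm (2 * \<i> * of_real (\<rho> n) * (T n - mat 1 - ?I n) $ i $ j) \<le> 2 * C * inverse (\<rho> n)"
        by (intro always_eventually allI)
    qed
    have "(\<lambda>n. 2 * \<i> * of_real (\<rho> n) * ?I n $ i $ j) \<longlonglongrightarrow> block_matrix A 0 0 (- A) $ i $ j"
      unfolding A_def by (rule wave_kernel_integral_limit[OF Qi \<rho> pos])
    from tendsto_add[OF err this] show ?thesis
      by (simp add: right_diff_distrib)
  qed
  have eig: "is_eigenvalue A (of_real x) \<longleftrightarrow> x \<in> \<mu> ` {1..s}" for x using \<mu>_eigenvalues by auto
  \<comment> \<open>otherwise every real number would be an eigenvalue\<close>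
  have nz: "charpoly A \<noteq> 0"
  proof
    assume "charpoly A = 0"
    then have "UNIV = \<mu> ` {1..s}" using eig by (auto simp: is_eigenvalue_iff_root)
    then have "finite (UNIV :: real set)" by (metis finite_imageI finite_atLeastAtMost)
    then show False using infinite_UNIV_char_0 by blast
  qed
  have "\<exists>n \<theta>. det (T n - mat (cis \<theta>) ** phase_matrix (\<rho> n)) = 0"
  proof (rule unimodular_root_at_high_energy[OF T F \<rho> pos nz, where M="\<mu> ` {j1, j2, j3}"])
    show "odd (alg_multiplicity A (of_real m))" if "m \<in> \<mu> ` {j1, j2, j3}" for m
      using odd_mult that by blast
    show "\<exists>m\<in>\<mu> ` {j1, j2, j3}. \<not> is_eigenvalue A (of_real (b - m))" for b
      using three_shifts_separated[OF min_diam d_nonzero, of b] unfolding eig by blast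
  qed simp
  then show False using Tn norm_cis by blast
qed

end
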